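(* Let $\mathbb{H}$ be a finite-dimensional complex Hilbert space, let $T>0$, let $\tilde H\in\mathcal{B}(\mathbb{H})$ be self-adjoint, let $A\in\mathcal{B}(\mathbb{H}\otimes\mathbb{H})$ be self-adjoint and exchange-symmetric (that is, $\mathrm{S}A\mathrm{S}=A$ with $\mathrm{S}$ the flip operator), and let $L\in\mathcal{B}(\mathbb{H})$. Let $\varrho_0\in\mathcal{S}(\mathbb{H})$ and, for each $N\ge 1$, let $(\bar{\boldsymbol\rho}^N_t)_{t\in[0,T]}$ be the solution in $\mathcal{S}(\mathbb{H}^{\otimes N})$ of the $N$-body Lindblad equation $$\frac{\mathrm{d}\bar{\boldsymbol\rho}^N_t}{\mathrm{d}t}=-\mathrm{i}\Bigl[\sum_{l=1}^N\tilde{\mathbf{H}}_l+\frac1N\sum_{1\le l<l'\le N}\mathbf{A}_{ll'},\,\bar{\boldsymbol\rho}^N_t\Bigr]+\sum_{l=1}^N\Bigl(\mathbf{L}_l\bar{\boldsymbol\rho}^N_t\mathbf{L}_l^\dagger-\tfrac12\{\mathbf{L}_l^\dagger\mathbf{L}_l,\bar{\boldsymbol\rho}^N_t\}\Bigr),\qquad \bar{\boldsymbol\rho}^N_0=\varrho_0^{\otimes N}.$$ Let $m_0\in\mathcal{S}(\mathbb{H})$ be faithful ($m_0>0$) and let $(m_t)_{t\in[0,T]}$ be the solution in $\mathcal{S}(\mathbb{H})$, with initial datum $m_0$, of the mean-field Lindblad equation $$\frac{\mathrm{d}m_t}{\mathrm{d}t}=-\mathrm{i}[\tilde H+A^{m_t},m_t]+Lm_tL^\dagger-\tfrac12\{L^\dagger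 L,m_t\},\qquad A^{\sigma}:=\mathrm{tr}_2\bigl((\mathbf{1}\otimes\sigma)A\bigr).$$ Assume in addition that $\mathfrak{H}_N(0)\to0$ as $N\to\infty$, where $\mathfrak{H}_N(t):=\frac1N\mathfrak{D}\bigl(\bar{\boldsymbol\rho}^N_t\,\big\|\,m_t^{\otimes N}\bigr)$. Then, for every fixed $k\ge1$, $$\sup_{t\in[0,T]}\mathfrak{D}\bigl(\bar{\boldsymbol\rho}^{N:(k)}_t\,\big\|\,m_t^{\otimes k}\bigr)\xrightarrow[N\to\infty]{}0,$$ and consequently $$\sup_{t\in[0,T]}\bigl\|\bar{\boldsymbol\rho}^{N:(k)}_t-m_t^{\otimes k}\bigr\|_1\xrightarrow[N\to\infty]{}0 .$$ (In particular, $(\bar{\boldsymbol\rho}^N_t)_{N\ge1}$ is $m_t$-chaotic uniformly on $[0,T]$, i.e. for every fixed $k$ its $k$-th marginals converge to $m_t^{\otimes k}$ in trace norm, uniformly in $t\in[0,T]$.)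
   Context: $\mathcal{B}(\mathbb{H})$ is the space of linear operators on $\mathbb{H}$; $\|O\|_1=\mathrm{tr}(\sqrt{O^\dagger O})$ is the trace norm. $\mathcal{S}(\mathbb{H})=\{\rho\in\mathcal{B}(\mathbb{H}):\rho=\rho^\dagger,\ \rho\ge0,\ \mathrm{tr}(\rho)=1\}$ is the set of density operators; a state $\rho$ is faithful if $\rho>0$. $[X,Y]=XY-YX$ and $\{X,Y\}=XY+YX$. For $O\in\mathcal{B}(\mathbb{H})$, $\mathbf{O}_l\in\mathcal{B}(\mathbb{H}^{\otimes N})$ acts as $O$ on the $l$-th tensor factor and as the identity on the others; for $B\in\mathcal{B}(\mathbb{H}\otimes\mathbb{H})$ and $l\neq l'$, $\mathbf{B}_{ll'}\in\mathcal{B}(\mathbb{H}^{\otimes N})$ acts as $B$ on the $l$-th and $l'$-th factors and as the identity on the others. The flip operator $\mathrm{S}$ on $\mathbb{H}\otimes\mathbb{H}$ is $\mathrm{S}(\psi\otimes\varphi)=\varphi\otimes\psi$. The partial trace $\mathrm{tr}_2:\mathcal{B}(\mathbb{H}\otimes\mathbb{H})\to\mathcal{B}(\mathbb{H})$ is the linear map with $\mathrm{tr}_2(X\otimes Y)=\mathrm{tr}(Y)X$; partial traces over other sets of factors of $\mathbb{H}^{\otimes N}$ are defined analogously. For $N\ge k$, the $k$-th marginal $\bar{\boldsymbol\rho}^{N:(k)}\in\mathcal{S}(\mathbb{H}^{\otimes k})$ of a permutation-invariant (exchangeable) state $\bar{\boldsymbol\rho}^N\in\mathcal{S}(\mathbb{H}^{\otimes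 N})$ is obtained by tracing out any $N-k$ factors (the result does not depend on which); the states $\bar{\boldsymbol\rho}^N_t$ are exchangeable because the initial datum and the generator are permutation-invariant. The (Umegaki) quantum relative entropy of density operators is $\mathfrak{D}(\rho\|\sigma)=\mathrm{tr}(\rho(\log\rho-\log\sigma))$ if $\mathrm{supp}(\rho)\subseteq\mathrm{supp}(\sigma)$ (with the convention $0\log0=0$), and $+\infty$ otherwise, where $\mathrm{supp}$ denotes the orthogonal projection onto the range. *)

theory Defs
  imports
    "HOL-Library.Extended_Real"
    "Jordan_Normal_Form.Schur_Decomposition"
begin

text \<open>The Hilbert space is \<open>\<complex>\<^sup>d\<close> with its standard inner product, and operators on its
  \<open>N\<close>-fold tensor power are complex matrices of size \<open>d ^ N\<close>.  The basis vector
  \<open>e(a\<^sub>1) \<otimes> \<dots> \<otimes> e(a\<^sub>N)\<close> (with \<open>a\<^sub>r < d\<close>) has the index \<open>\<Sum>r=1..N. a\<^sub>r * d ^ (N - r)\<close>,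
  that is, the first factor is the most significant digit in base \<open>d\<close>.\<close>

definition mtrace :: "complex mat \<Rightarrow> complex" where
  "mtrace X = (\<Sum>i<dim_row X. X $$ (i, i))"

definition self_adjoint :: "nat \<Rightarrow> complex mat \<Rightarrow> bool" where
  "self_adjoint n X \<longleftrightarrow> X \<in> carrier_mat n n \<and> mat_adjoint X = X"

definition positive_op :: "nat \<Rightarrow> complex mat \<Rightarrow> bool" where
  "positive_op n X \<longleftrightarrow> self_adjoint n X \<and> (\<forall>v\<in>carrier_vec n. 0 \<le> Re ((X *\<^sub>v v) \<bullet>c v))"

definition strictly_positive_op :: "nat \<Rightarrow> complex mat \<Rightarrow> bool" where
  "strictly_positive_op n X \<longleftrightarrow>
     self_adjoint n X \<and> (\<forall>v\<in>carrier_vec n. v \<noteq> 0\<^sub>v n \<longrightarrow> 0 < Re ((X *\<^sub>v v) \<bullet>c v))"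

definition density_op :: "nat \<Rightarrow> complex mat \<Rightarrow> bool" where
  "density_op n \<rho> \<longleftrightarrow> positive_op n \<rho> \<and> mtrace \<rho> = 1"

definition unitary_op :: "nat \<Rightarrow> complex mat \<Rightarrow> bool" where
  "unitary_op n U \<longleftrightarrow>
     U \<in> carrier_mat n n \<and> mat_adjoint U * U = 1\<^sub>m n \<and> U * mat_adjoint U = 1\<^sub>m n"

text \<open>The functional calculus of a self-adjoint matrix.  The result does not depend on the
  chosen diagonalisation (lemma \<open>herm_fun_eq\<close> below).\<close>

definition herm_fun :: "(real \<Rightarrow> real) \<Rightarrow> complex mat \<Rightarrow> complex mat" where
  "herm_fun f X = (THE Y. \<exists>U e. unitary_op (dim_row X) U \<and>
     X = U * mat_diag (dim_row X) (\<lambda>i. complex_of_real (e i)) * mat_adjoint U \<and>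
     Y = U * mat_diag (dim_row X) (\<lambda>i. complex_of_real (f (e i))) * mat_adjoint U)"

definition trace_norm :: "complex mat \<Rightarrow> real" where
  "trace_norm X = Re (mtrace (herm_fun sqrt (mat_adjoint X * X)))"

definition op_range :: "complex mat \<Rightarrow> complex vec set" where
  "op_range X = {X *\<^sub>v v | v. v \<in> carrier_vec (dim_col X)}"

text \<open>Inclusion of the support projections means inclusion of the ranges.  As \<open>ln 0 = 0\<close> in HOL,
  \<open>herm_fun ln\<close> is the logarithm on the support and zero on the kernel, which implements the
  convention \<open>0 log 0 = 0\<close>.\<close>

definition rel_entropy :: "complex mat \<Rightarrow> complex mat \<Rightarrow> ereal" where
  "rel_entropy \<rho> \<sigma> =
     (if op_range \<rho> \<subseteq> op_range \<sigma>
      then ereal (Re (mtrace (\<rho> * (herm_fun ln \<rho> - herm_fun ln \<sigma>)))) else \<infinity>)"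

definition kron :: "complex mat \<Rightarrow> complex mat \<Rightarrow> complex mat" where
  "kron X Y = mat (dim_row X * dim_row Y) (dim_col X * dim_col Y)
     (\<lambda>(i, j). X $$ (i div dim_row Y, j div dim_col Y) * Y $$ (i mod dim_row Y, j mod dim_col Y))"

primrec tensor_power :: "complex mat \<Rightarrow> nat \<Rightarrow> complex mat" where
  "tensor_power X 0 = 1\<^sub>m 1"
| "tensor_power X (Suc n) = kron (tensor_power X n) X"

text \<open>The partial trace over the second factor of \<open>\<complex>\<^sup>a \<otimes> \<complex>\<^sup>b\<close>; lemma \<open>ptrace2_kron\<close> below
  is its defining property.\<close>

definition ptrace2 :: "nat \<Rightarrow> nat \<Rightarrow> complex mat \<Rightarrow> complex mat" where
  "ptrace2 a b X = mat a a (\<lambda>(i, j). \<Sum>k<b. X $$ (i * b + k, j * b + k))"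

text \<open>The \<open>k\<close>-th marginal of an exchangeable state, for \<open>k \<le> N\<close>: the last \<open>N - k\<close> factors are
  traced out.\<close>

definition marginal :: "nat \<Rightarrow> nat \<Rightarrow> nat \<Rightarrow> complex mat \<Rightarrow> complex mat" where
  "marginal d N k \<rho> = ptrace2 (d ^ k) (d ^ (N - k)) \<rho>"

definition flip_op :: "nat \<Rightarrow> complex mat" where
  "flip_op d = mat (d * d) (d * d)
     (\<lambda>(i, j). if i div d = j mod d \<and> i mod d = j div d then 1 else 0)"

definition digit :: "nat \<Rightarrow> nat \<Rightarrow> nat \<Rightarrow> nat \<Rightarrow> nat" where
  "digit d N l i = i div d ^ (N - l) mod d"

text \<open>Tensor factors are numbered from \<open>1\<close> to \<open>N\<close>.\<close>

definition one_body :: "nat \<Rightarrow> nat \<Rightarrow> complex mat \<Rightarrow> nat \<Rightarrow> complex mat" where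
  "one_body d N X l = kron (1\<^sub>m (d ^ (l - 1))) (kron X (1\<^sub>m (d ^ (N - l))))"

definition two_body :: "nat \<Rightarrow> nat \<Rightarrow> complex mat \<Rightarrow> nat \<Rightarrow> nat \<Rightarrow> complex mat" where
  "two_body d N B l l' = mat (d ^ N) (d ^ N)
     (\<lambda>(i, j). if \<forall>r\<in>{1..N} - {l, l'}. digit d N r i = digit d N r j
       then B $$ (digit d N l i * d + digit d N l' i, digit d N l j * d + digit d N l' j)
       else 0)"

definition msum :: "nat \<Rightarrow> ('i \<Rightarrow> complex mat) \<Rightarrow> 'i set \<Rightarrow> complex mat" where
  "msum n F I = mat n n (\<lambda>(i, j). \<Sum>l\<in>I. F l $$ (i, j))"

definition commut :: "complex mat \<Rightarrow> complex mat \<Rightarrow> complex mat" where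
  "commut X Y = X * Y - Y * X"

definition anticommut :: "complex mat \<Rightarrow> complex mat \<Rightarrow> complex mat" where
  "anticommut X Y = X * Y + Y * X"

definition dissipator :: "complex mat \<Rightarrow> complex mat \<Rightarrow> complex mat" where
  "dissipator L X = L * X * mat_adjoint L - (1/2) \<cdot>\<^sub>m anticommut (mat_adjoint L * L) X"

definition nbody_hamiltonian :: "nat \<Rightarrow> complex mat \<Rightarrow> complex mat \<Rightarrow> nat \<Rightarrow> complex mat" where
  "nbody_hamiltonian d H A N =
     msum (d ^ N) (one_body d N H) {1..N}
     + (1 / of_nat N) \<cdot>\<^sub>m
         msum (d ^ N) (\<lambda>(l, l'). two_body d N A l l') {(l, l'). 1 \<le> l \<and> l < l' \<and> l' \<le> N}"

definition nbody_lindblad ::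
  "nat \<Rightarrow> complex mat \<Rightarrow> complex mat \<Rightarrow> complex mat \<Rightarrow> nat \<Rightarrow> complex mat \<Rightarrow> complex mat" where
  "nbody_lindblad d H A L N X =
     (- \<i>) \<cdot>\<^sub>m commut (nbody_hamiltonian d H A N) X
     + msum (d ^ N) (\<lambda>l. dissipator (one_body d N L l) X) {1..N}"

definition mean_field :: "nat \<Rightarrow> complex mat \<Rightarrow> complex mat \<Rightarrow> complex mat" where
  "mean_field d A \<sigma> = ptrace2 d d (kron (1\<^sub>m d) \<sigma> * A)"

definition mean_field_lindblad ::
  "nat \<Rightarrow> complex mat \<Rightarrow> complex mat \<Rightarrow> complex mat \<Rightarrow> complex mat \<Rightarrow> complex mat" where
  "mean_field_lindblad d H A L X =
     (- \<i>) \<cdot>\<^sub>m commut (H + mean_field d A X) X + dissipator L X"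

text \<open>A curve of density matrices that is differentiable on \<open>[0, T]\<close> (one-sidedly at the end points,
  entry by entry, as there is no topology on the type of matrices) and solves \<open>X' = G X\<close> there.\<close>

definition density_solution ::
  "nat \<Rightarrow> real \<Rightarrow> (complex mat \<Rightarrow> complex mat) \<Rightarrow> complex mat \<Rightarrow> (real \<Rightarrow> complex mat) \<Rightarrow> bool" where
  "density_solution n T G X\<^sub>0 X \<longleftrightarrow>
     X 0 = X\<^sub>0 \<and>
     (\<forall>t\<in>{0..T}. density_op n (X t) \<and>
        (\<forall>i<n. \<forall>j<n. ((\<lambda>s. X s $$ (i, j)) has_vector_derivative G (X t) $$ (i, j))
                        (at t within {0..T})))"

lemma mat_adjoint_carrier [simp]:
  "X \<in> carrier_mat n m \<Longrightarrow> mat_adjoint X \<in> carrier_mat m n"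
  by (auto simp: mat_adjoint_def)

lemma herm_fun_eq:
  assumes U: "unitary_op n U"
    and X: "X = U * mat_diag n (\<lambda>i. complex_of_real (e i)) * mat_adjoint U"
  shows "herm_fun f X = U * mat_diag n (\<lambda>i. complex_of_real (f (e i))) * mat_adjoint U"
proof -
  define D where "D g = mat_diag n (\<lambda>i. complex_of_real (g i))" for g
  note [simp] = mult_carrier_mat[of _ n n _ n] right_mult_one_mat[of _ n n] left_mult_one_mat[of _ n n]
  have D [simp]: "D g \<in> carrier_mat n n" for g by (simp add: D_def)
  have Uc [simp]: "U \<in> carrier_mat n n" and UU: "mat_adjoint U * U = 1\<^sub>m n" "U * mat_adjoint U = 1\<^sub>m n"
    using U by (auto simp: unitary_op_def)
  have Uac [simp]: "mat_adjoint U \<in> carrier_mat n n" by simp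
  have dim: "dim_row X = n" unfolding X using carrier_matD(1)[OF Uc] by simp
  have unique: "V * D (\<lambda>i. f (c i)) * mat_adjoint V = U * D (\<lambda>i. f (e i)) * mat_adjoint U"
    if V: "unitary_op n V" and XV: "X = V * D c * mat_adjoint V" for V c
  proof -
    have Vc [simp]: "V \<in> carrier_mat n n" and VV: "mat_adjoint V * V = 1\<^sub>m n" "V * mat_adjoint V = 1\<^sub>m n"
      using V by (auto simp: unitary_op_def)
    have Vac [simp]: "mat_adjoint V \<in> carrier_mat n n" by simp
    define W where "W = mat_adjoint V * U"
    have Wc [simp]: "W \<in> carrier_mat n n" by (simp add: W_def)
    have XU: "X = U * D e * mat_adjoint U" using X by (simp add: D_def)
    have Xc [simp]: "X \<in> carrier_mat n n" unfolding XU by simp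
    have XU': "X * U = U * D e"
      unfolding XU using UU(1) by (simp add: assoc_mult_mat[of _ n n _ n _ n])
    have VX: "mat_adjoint V * X = D c * mat_adjoint V"
    proof -
      have "mat_adjoint V * X = (mat_adjoint V * V) * D c * mat_adjoint V"
        unfolding XV by (simp add: assoc_mult_mat[of _ n n _ n _ n])
      thus ?thesis using VV(1) by simp
    qed
    have "W * D e = mat_adjoint V * (X * U)"
      unfolding XU' W_def by (simp add: assoc_mult_mat[of _ n n _ n _ n])
    also have "\<dots> = (mat_adjoint V * X) * U"
      by (simp add: assoc_mult_mat[of _ n n _ n _ n])
    also have "\<dots> = D c * W"
      unfolding VX W_def by (simp add: assoc_mult_mat[of _ n n _ n _ n])
    finally have WD: "W * D e = D c * W" .
    have entry: "(W * D g) $$ (i, j) = W $$ (i, j) * of_real (g j)"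
        "(D g * W) $$ (i, j) = of_real (g i) * W $$ (i, j)" if "i < n" "j < n" for g i j
      using that mat_diag_mult_left[OF Wc] mat_diag_mult_right[OF Wc] by (simp_all add: D_def)
    have "W * D (\<lambda>i. f (e i)) = D (\<lambda>i. f (c i)) * W"
    proof (rule eq_matI)
      fix i j assume ij: "i < dim_row (D (\<lambda>i. f (c i)) * W)" "j < dim_col (D (\<lambda>i. f (c i)) * W)"
      have ij': "i < n" "j < n" using ij carrier_matD[OF Wc] carrier_matD[OF D] by auto
      have "W $$ (i, j) * of_real (e j) = of_real (c i) * W $$ (i, j)"
        using WD entry ij' by metis
      hence "W $$ (i, j) = 0 \<or> e j = c i" by auto
      thus "(W * D (\<lambda>i. f (e i))) $$ (i, j) = (D (\<lambda>i. f (c i)) * W) $$ (i, j)"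
        using entry ij' by auto
    qed (use carrier_matD[OF Wc] carrier_matD[OF D] in auto)
    note eq = this
    have VW: "V * W = U"
      unfolding W_def using VV(2) by (simp add: assoc_mult_mat[of _ n n _ n _ n, symmetric])
    have WU: "W * mat_adjoint U = mat_adjoint V"
      unfolding W_def using UU(2) by (simp add: assoc_mult_mat[of _ n n _ n _ n])
    have "V * D (\<lambda>i. f (c i)) * mat_adjoint V = V * (D (\<lambda>i. f (c i)) * W) * mat_adjoint U"
      unfolding WU[symmetric] by (simp add: assoc_mult_mat[of _ n n _ n _ n])
    also have "\<dots> = (V * W) * D (\<lambda>i. f (e i)) * mat_adjoint U"
      unfolding eq[symmetric] by (simp add: assoc_mult_mat[of _ n n _ n _ n])
    finally show ?thesis by (simp add: VW)
  qed
  show ?thesis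
    unfolding herm_fun_def dim
  proof (rule the_equality)
    show "\<exists>U' e'. unitary_op n U' \<and>
        X = U' * mat_diag n (\<lambda>i. complex_of_real (e' i)) * mat_adjoint U' \<and>
        U * mat_diag n (\<lambda>i. complex_of_real (f (e i))) * mat_adjoint U =
        U' * mat_diag n (\<lambda>i. complex_of_real (f (e' i))) * mat_adjoint U'"
      using U X by blast
  next
    fix Y
    assume "\<exists>U' e'. unitary_op n U' \<and>
        X = U' * mat_diag n (\<lambda>i. complex_of_real (e' i)) * mat_adjoint U' \<and>
        Y = U' * mat_diag n (\<lambda>i. complex_of_real (f (e' i))) * mat_adjoint U'"
    then obtain V c where "unitary_op n V" "X = V * D c * mat_adjoint V"
        "Y = V * D (\<lambda>i. f (c i)) * mat_adjoint V"
      by (auto simp: D_def)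
    with unique[of V c]
    show "Y = U * mat_diag n (\<lambda>i. complex_of_real (f (e i))) * mat_adjoint U"
      by (simp add: D_def)
  qed
qed

lemma ptrace2_kron:
  assumes "X \<in> carrier_mat a a" "Y \<in> carrier_mat b b"
  shows "ptrace2 a b (kron X Y) = mtrace Y \<cdot>\<^sub>m X"
proof (rule eq_matI)
  fix i j assume "i < dim_row (mtrace Y \<cdot>\<^sub>m X)" "j < dim_col (mtrace Y \<cdot>\<^sub>m X)"
  hence ij: "i < a" "j < a" using assms by auto
  have "i * b + k < a * b" if "i < a" "k < b" for i k
  proof -
    have "i * b + k < Suc i * b" using that by simp
    also have "\<dots> \<le> a * b" using that by (intro mult_right_mono) auto
    finally show ?thesis .
  qed
  hence "kron X Y $$ (i * b + k, j * b + k) = X $$ (i, j) * Y $$ (k, k)" if "k < b" for k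
    using that ij assms by (auto simp: kron_def)
  thus "ptrace2 a b (kron X Y) $$ (i, j) = (mtrace Y \<cdot>\<^sub>m X) $$ (i, j)"
    using ij assms
    by (simp add: ptrace2_def mtrace_def sum_distrib_left mult.commute)
qed (use assms in \<open>auto simp: ptrace2_def\<close>)

end

theory Submission
  imports Defs "Jordan_Normal_Form.Spectral_Radius"
begin

text \<open>The entropy of product states is additive, so the assumption on the initial entropies says that
  \<open>\<rho>\<^sub>0\<close> and \<open>m\<^sub>0\<close> have relative entropy zero, that is \<open>\<rho>\<^sub>0 = m\<^sub>0\<close>: the system starts in the product
  state \<open>m\<^sub>0 \<otimes> \<dots> \<otimes> m\<^sub>0\<close> and it remains to propagate chaos.  For a product observable
  \<open>X\<^sub>1 \<otimes> \<dots> \<otimes> X\<^sub>N\<close> with at most \<open>k\<close> factors different from the identity, the difference between its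
  expectation in the \<open>N\<close>-body state and in the product of the mean-field states has a derivative that is
  bounded by a multiple of \<open>k\<close> times the largest such difference for \<open>k + 1\<close> factors plus a term of order
  \<open>k\<^sup>2 / N\<close> (the BBGKY hierarchy).  Iterating this over short time steps shows that all entries of the
  \<open>k\<close>-th marginals converge uniformly in time.  Finally \<open>m\<^sub>t\<close> stays faithful with a lower bound
  \<open>c > 0\<close> on its eigenvalues, and the relative entropy with respect to a state with eigenvalues at
  least \<open>c\<close> is at most the squared Hilbert-Schmidt distance divided by \<open>c\<close>.\<close>

text \<open>The hierarchy never closes: an estimate at level \<open>k\<close> consumes one at level
  \<open>k + 1\<close>, and the only a priori information is that a defect has modulus at most
  \<open>2\<close>. Smallness is therefore carried for every \<open>k\<close> at once and without a
  rate, which is what allows the short-time argument to be restarted at the end of each time step.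
  The nontrivial factors of an observable may sit at any sites, because the interaction attaches a
  new site anywhere; differentiation then leads from the class with at most \<open>k\<close> such
  factors into the one with at most \<open>k + 1\<close>. The size of an observable is measured by
  absolute row and column sums: bounds for the factors multiply in a tensor product, so nothing
  depends on the dimension \<open>d ^ N\<close>, and they control expectations in every state. The
  entropy needs more than convergence of entries, since the logarithm of \<open>m t\<close> blows up
  where an eigenvalue approaches zero. The smallest eigenvalue need not be differentiable in time,
  so at a first bad time it is compared with the quadratic form of one fixed eigenvector, which
  touches it from above.\<close>

section \<open>Entrywise formulas for products, adjoints and traces\<close>

lemma index_mult_mat_sum:
  fixes A :: "'a::semiring_0 mat"
  assumes "A \<in> carrier_mat n m" "B \<in> carrier_mat m p" "i < n" "j < p"
  shows "(A * B) $$ (i, j) = (\<Sum>k<m. A $$ (i, k) * B $$ (k, j))"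
  using assms by (auto simp: scalar_prod_def atLeast0LessThan intro!: sum.cong)

lemma index_mat_adjoint:
  fixes X :: "complex mat"
  assumes "X \<in> carrier_mat n m" "i < m" "j < n"
  shows "mat_adjoint X $$ (i, j) = cnj (X $$ (j, i))"
  using assms unfolding mat_adjoint_def by (simp add: mat_of_rows_index)

lemma index_mult_mat_vec_sum:
  fixes A :: "'a::semiring_0 mat"
  assumes "A \<in> carrier_mat n m" "v \<in> carrier_vec m" "i < n"
  shows "(A *\<^sub>v v) $ i = (\<Sum>k<m. A $$ (i, k) * v $ k)"
  using assms by (auto simp: scalar_prod_def atLeast0LessThan intro!: sum.cong)

lemma assoc_mult_mat_square [simp]:
  fixes A B C :: "'a::semiring_0 mat"
  shows "A \<in> carrier_mat n n \<Longrightarrow> B \<in> carrier_mat n n \<Longrightarrow> C \<in> carrier_mat n n \<Longrightarrow>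
    A * B * C = A * (B * C)"
  by (rule assoc_mult_mat)

lemma mult_carrier_mat_square [simp]:
  "A \<in> carrier_mat n n \<Longrightarrow> B \<in> carrier_mat n n \<Longrightarrow> A * B \<in> carrier_mat n n"
  by (rule mult_carrier_mat)

lemma dim_mat_adjoint [simp]:
  "dim_row (mat_adjoint X) = dim_col X" "dim_col (mat_adjoint X) = dim_row X"
  by (auto simp: mat_adjoint_def)

lemma self_adjoint_iff:
  "self_adjoint n X \<longleftrightarrow> X \<in> carrier_mat n n \<and> (\<forall>i<n. \<forall>j<n. X $$ (i, j) = cnj (X $$ (j, i)))"
proof (cases "X \<in> carrier_mat n n")
  case True
  have "mat_adjoint X = X \<longleftrightarrow> (\<forall>i<n. \<forall>j<n. mat_adjoint X $$ (i, j) = X $$ (i, j))"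
    using True mat_adjoint_carrier[OF True] by (auto intro!: eq_matI)
  thus ?thesis using True index_mat_adjoint[OF True] unfolding self_adjoint_def
    by (metis complex_cnj_cnj)
qed (simp add: self_adjoint_def)

lemma mat_adjoint_mat_adjoint:
  fixes X :: "complex mat"
  assumes "X \<in> carrier_mat n m"
  shows "mat_adjoint (mat_adjoint X) = X"
  using assms mat_adjoint_carrier[OF assms] mat_adjoint_carrier[OF mat_adjoint_carrier[OF assms]]
  by (intro eq_matI) (auto simp: index_mat_adjoint[of _ n m] index_mat_adjoint[of _ m n])

lemma mat_adjoint_times:
  fixes X Y :: "complex mat"
  assumes "X \<in> carrier_mat n m" "Y \<in> carrier_mat m p"
  shows "mat_adjoint (X * Y) = mat_adjoint Y * mat_adjoint X"
proof (rule eq_matI)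
  have XY: "X * Y \<in> carrier_mat n p" using assms by simp
  note ca = mat_adjoint_carrier[OF XY] mat_adjoint_carrier[OF assms(1)] mat_adjoint_carrier[OF assms(2)]
  show "dim_row (mat_adjoint (X * Y)) = dim_row (mat_adjoint Y * mat_adjoint X)"
    "dim_col (mat_adjoint (X * Y)) = dim_col (mat_adjoint Y * mat_adjoint X)"
    using ca by auto
  fix i j assume "i < dim_row (mat_adjoint Y * mat_adjoint X)" "j < dim_col (mat_adjoint Y * mat_adjoint X)"
  hence ij: "i < p" "j < n" using ca by auto
  show "mat_adjoint (X * Y) $$ (i, j) = (mat_adjoint Y * mat_adjoint X) $$ (i, j)"
    using ij assms ca
    by (simp add: index_mat_adjoint[OF XY] index_mult_mat_sum[OF ca(3,2)] index_mult_mat_sum[OF assms] 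
        index_mat_adjoint[OF assms(1)] index_mat_adjoint[OF assms(2)] mult.commute del: index_mult_mat)
qed

lemma mtrace_mult_sum:
  assumes "P \<in> carrier_mat n n" "R \<in> carrier_mat n n"
  shows "mtrace (P * R) = (\<Sum>i<n. \<Sum>j<n. P $$ (i, j) * R $$ (j, i))"
  using assms by (auto simp: mtrace_def index_mult_mat_sum[OF assms] simp del: index_mult_mat(1))

lemma mtrace_comm:
  assumes "A \<in> carrier_mat n m" "B \<in> carrier_mat m n"
  shows "mtrace (A * B) = mtrace (B * A)"
proof -
  have "mtrace (A * B) = (\<Sum>i<n. \<Sum>k<m. A $$ (i, k) * B $$ (k, i))"
    using assms by (auto simp: mtrace_def index_mult_mat_sum[OF assms] simp del: index_mult_mat(1))
  also have "\<dots> = (\<Sum>k<m. \<Sum>i<n. B $$ (k, i) * A $$ (i, k))"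
    by (subst sum.swap) (simp add: mult.commute)
  also have "\<dots> = mtrace (B * A)"
    using assms by (auto simp: mtrace_def index_mult_mat_sum[OF assms(2,1)] simp del: index_mult_mat(1))
  finally show ?thesis .
qed

lemma mtrace_add:
  "A \<in> carrier_mat n n \<Longrightarrow> B \<in> carrier_mat n n \<Longrightarrow> mtrace (A + B) = mtrace A + mtrace B"
  by (auto simp: mtrace_def sum.distrib)

lemma mtrace_diff:
  "A \<in> carrier_mat n n \<Longrightarrow> B \<in> carrier_mat n n \<Longrightarrow> mtrace (A - B) = mtrace A - mtrace B"
  by (auto simp: mtrace_def sum_subtractf)

lemma mtrace_smult: "A \<in> carrier_mat n n \<Longrightarrow> mtrace (c \<cdot>\<^sub>m A) = c * mtrace A"
  by (auto simp: mtrace_def sum_distrib_left)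

section \<open>The spectral theorem\<close>

text \<open>The Householder reflection that maps the first basis vector to \<open>v\<close>.\<close>

lemma unitary_with_first_column:
  fixes v :: "complex vec"
  assumes v: "v \<in> carrier_vec n" and n: "0 < n"
    and norm: "(\<Sum>i<n. (cmod (v $ i))\<^sup>2) = 1" and v0: "v $ 0 = complex_of_real r" "r \<le> 0"
  shows "\<exists>W. unitary_op n W \<and> (\<forall>i<n. W $$ (i, 0) = v $ i)"
proof -
  define w where "w i = (if i = 0 then 1 else 0) - v $ i" for i
  \<comment> \<open>As \<open>v\<close> is a unit vector with real first entry \<open>r\<close>, the
    squared norm of \<open>w\<close> is \<open>2 * c\<close>, so dividing by \<open>c\<close> in
    \<open>W\<close> gives the usual normalisation of a reflection. The sign condition on
    \<open>r\<close> yields \<open>c \<ge> 1\<close>, which makes the division safe.\<close>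
  define c where "c = 1 - complex_of_real r"
  have c0: "c \<noteq> 0"
  proof
    assume "c = 0"
    hence "Re c = 0" by simp
    thus False using v0(2) unfolding c_def by simp
  qed
  define W where "W = mat n n (\<lambda>(i, j). (if i = j then 1 else 0) - w i * cnj (w j) / c)"
  have Wc: "W \<in> carrier_mat n n" by (simp add: W_def)
  have w0: "cnj (w 0) = c" using v0 by (simp add: w_def c_def)
  have "(\<Sum>k<n. cnj (w k) * w k) = (\<Sum>k<n. (if k = 0 then 1 - v $ 0 - cnj (v $ 0) else 0) + cnj (v $ k) * v $ k)"
    by (intro sum.cong refl) (auto simp: w_def algebra_simps)
  also have "\<dots> = (\<Sum>k<n. (if k = 0 then 1 - v $ 0 - cnj (v $ 0) else 0) + of_real ((cmod (v $ k))\<^sup>2))"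
    by (intro sum.cong refl) (simp only: complex_norm_square mult.commute)
  also have "\<dots> = 2 * c"
    unfolding sum.distrib of_real_sum[symmetric] norm using n v0 by (simp add: c_def)
  finally have ww: "(\<Sum>k<n. cnj (w k) * w k) = 2 * c" .
  have adj: "mat_adjoint W = W"
  proof -
    have "self_adjoint n W" unfolding self_adjoint_iff using Wc
      by (auto simp: W_def c_def)
    thus ?thesis by (simp add: self_adjoint_def)
  qed
  have "W * W = 1\<^sub>m n"
  proof (rule eq_matI)
    fix i j assume "i < dim_row (1\<^sub>m n :: complex mat)" "j < dim_col (1\<^sub>m n :: complex mat)"
    hence ij: "i < n" "j < n" by auto
    have "(W * W) $$ (i, j) = (\<Sum>k<n. ((if i = k then 1 else 0) - w i * cnj (w k) / c) * ((if k = j then 1 else 0) - w k * cnj (w j) / c))"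
      unfolding index_mult_mat_sum[OF Wc Wc ij] using ij by (simp add: W_def)
    also have "\<dots> = (\<Sum>k<n. (if k = i then (if i = j then 1 else 0) - w i * cnj (w j) / c else 0)
        - (if k = j then w i * cnj (w j) / c else 0) + (w i * cnj (w j) / c\<^sup>2) * (cnj (w k) * w k))"
      by (intro sum.cong refl) (auto simp: field_simps power2_eq_square c0)
    also have "\<dots> = ((if i = j then 1 else 0) - w i * cnj (w j) / c) - w i * cnj (w j) / c
         + (w i * cnj (w j) / c\<^sup>2) * (\<Sum>k<n. cnj (w k) * w k)"
      using ij by (simp add: sum.distrib sum_subtractf sum_distrib_left)
    also have "\<dots> = (if i = j then 1 else 0)"
      unfolding ww using c0 by (simp add: field_simps power2_eq_square)
    finally show "(W * W) $$ (i, j) = 1\<^sub>m n $$ (i, j)" using ij by simp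
  qed (use Wc in auto)
  hence "unitary_op n W" unfolding unitary_op_def using adj Wc by simp
  moreover have "W $$ (i, 0) = v $ i" if "i < n" for i
    using that n c0 by (simp add: W_def w0) (simp add: w_def)
  ultimately show ?thesis by blast
qed

lemma unitary_op_times:
  assumes "unitary_op n U" "unitary_op n V"
  shows "unitary_op n (U * V)"
proof -
  have U: "U \<in> carrier_mat n n" "mat_adjoint U \<in> carrier_mat n n" "mat_adjoint U * U = 1\<^sub>m n" "U * mat_adjoint U = 1\<^sub>m n"
    and V: "V \<in> carrier_mat n n" "mat_adjoint V \<in> carrier_mat n n" "mat_adjoint V * V = 1\<^sub>m n" "V * mat_adjoint V = 1\<^sub>m n"
    using assms by (auto simp: unitary_op_def)
  have "mat_adjoint V * mat_adjoint U * (U * V) = mat_adjoint V * (mat_adjoint U * U) * V"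
    using U(1,2) V(1,2) by (simp add: assoc_mult_mat[of _ n n _ n _ n])
  also have "\<dots> = 1\<^sub>m n" using V by (simp add: U(3))
  finally have 1: "mat_adjoint V * mat_adjoint U * (U * V) = 1\<^sub>m n" .
  have "U * V * (mat_adjoint V * mat_adjoint U) = U * (V * mat_adjoint V) * mat_adjoint U"
    using U(1,2) V(1,2) by (simp add: assoc_mult_mat[of _ n n _ n _ n])
  also have "\<dots> = 1\<^sub>m n" using U by (simp add: V(4))
  finally have 2: "U * V * (mat_adjoint V * mat_adjoint U) = 1\<^sub>m n" .
  show ?thesis unfolding unitary_op_def mat_adjoint_times[OF U(1) V(1)]
    using 1 2 mult_carrier_mat[OF U(1) V(1)] by blast
qed

lemma unitary_op_adjoint: "unitary_op n U \<Longrightarrow> unitary_op n (mat_adjoint U)"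
  by (auto simp: unitary_op_def mat_adjoint_mat_adjoint)

text \<open>The expression that occurs in \<open>herm_fun\<close>: by \<open>herm_fun_eq\<close> a
  function of the operator acts on \<open>e\<close> alone and keeps \<open>U\<close>.\<close>

definition spectral_decomp :: "nat \<Rightarrow> complex mat \<Rightarrow> (nat \<Rightarrow> real) \<Rightarrow> complex mat" where
  "spectral_decomp n U e = U * mat_diag n (\<lambda>i. complex_of_real (e i)) * mat_adjoint U"

lemma spectral_decomp_carrier [simp]: "U \<in> carrier_mat n n \<Longrightarrow> spectral_decomp n U e \<in> carrier_mat n n"
  unfolding spectral_decomp_def by (intro mult_carrier_mat[of _ n n]) auto

lemma index_spectral_decomp:
  assumes U: "U \<in> carrier_mat n n" and ij: "i < n" "j < n"
  shows "spectral_decomp n U e $$ (i, j) = (\<Sum>k<n. U $$ (i, k) * of_real (e k) * cnj (U $$ (j, k)))"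
proof -
  have UD: "U * mat_diag n (\<lambda>i. complex_of_real (e i)) \<in> carrier_mat n n" using U by simp
  have "spectral_decomp n U e $$ (i, j)
     = (\<Sum>k<n. (U * mat_diag n (\<lambda>i. complex_of_real (e i))) $$ (i, k) * mat_adjoint U $$ (k, j))"
    unfolding spectral_decomp_def
    by (rule index_mult_mat_sum[OF UD mat_adjoint_carrier[OF U] ij])
  also have "\<dots> = (\<Sum>k<n. U $$ (i, k) * of_real (e k) * cnj (U $$ (j, k)))"
    using U ij by (intro sum.cong refl)
     (simp add: mat_diag_mult_right[OF U] index_mat_adjoint[OF U])
  finally show ?thesis .
qed

lemma unitary_op_orthonormal_cols:
  assumes "unitary_op n U" "i < n" "j < n"
  shows "(\<Sum>k<n. cnj (U $$ (k, i)) * U $$ (k, j)) = (if i = j then 1 else 0)"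
proof -
  have U: "U \<in> carrier_mat n n" and "(mat_adjoint U * U) $$ (i, j) = (if i = j then 1 else 0)"
    using assms by (auto simp: unitary_op_def)
  thus ?thesis using assms(2,3)
    by (simp add: index_mult_mat_sum[OF mat_adjoint_carrier[OF U] U] index_mat_adjoint[OF U] del: index_mult_mat(1))
qed

lemma unitary_op_orthonormal_rows:
  assumes "unitary_op n U" "i < n" "j < n"
  shows "(\<Sum>k<n. U $$ (i, k) * cnj (U $$ (j, k))) = (if i = j then 1 else 0)"
proof -
  have U: "U \<in> carrier_mat n n" and "(U * mat_adjoint U) $$ (i, j) = (if i = j then 1 else 0)"
    using assms by (auto simp: unitary_op_def)
  thus ?thesis using assms(2,3)
    by (simp add: index_mult_mat_sum[OF U mat_adjoint_carrier[OF U]] index_mat_adjoint[OF U] del: index_mult_mat(1))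
qed

text \<open>For square matrices a left inverse is also a right inverse, so orthonormal columns
  suffice.\<close>

lemma unitary_opI:
  assumes U: "U \<in> carrier_mat n n"
    and "\<And>i j. i < n \<Longrightarrow> j < n \<Longrightarrow> (\<Sum>k<n. cnj (U $$ (k, i)) * U $$ (k, j)) = (if i = j then 1 else 0)"
  shows "unitary_op n U"
proof -
  have ca: "mat_adjoint U \<in> carrier_mat n n" using U by simp
  have 1: "mat_adjoint U * U = 1\<^sub>m n"
    using assms ca
    by (intro eq_matI) (auto simp: index_mult_mat_sum[OF ca U] index_mat_adjoint[OF U] simp del: index_mult_mat(1))
  moreover have "U * mat_adjoint U = 1\<^sub>m n"
    using mat_mult_left_right_inverse[OF ca U 1] .
  ultimately show ?thesis using U by (simp add: unitary_op_def)
qed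

text \<open>Deflation: a unitary whose first column is a unit eigenvector conjugates
  \<open>X\<close> to a matrix whose first column is \<open>\<mu>\<close> times the first basis
  vector. Self-adjointness clears the first row as well, and the induction hypothesis diagonalises
  the remaining block.\<close>

theorem spectral_theorem:
  assumes "self_adjoint n X"
  shows "\<exists>U e. unitary_op n U \<and> X = spectral_decomp n U e"
  using assms
proof (induction n arbitrary: X)
  case 0
  have "unitary_op 0 X" using 0 by (auto simp: unitary_op_def self_adjoint_def intro!: eq_matI)
  moreover have "X = spectral_decomp 0 X (\<lambda>_. 0)"
    using 0 by (auto simp: self_adjoint_def spectral_decomp_def intro!: eq_matI)
  ultimately show ?case by blast
next
  case (Suc n)
  have X: "X \<in> carrier_mat (Suc n) (Suc n)" and Xs: "mat_adjoint X = X"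
    using Suc.prems by (auto simp: self_adjoint_def)
  from spectrum_non_empty[OF X] obtain \<mu> where "eigenvalue X \<mu>" by (auto simp: spectrum_def)
  then obtain u where u: "u \<in> carrier_vec (Suc n)" "u \<noteq> 0\<^sub>v (Suc n)" "X *\<^sub>v u = \<mu> \<cdot>\<^sub>v u"
    using X by (auto simp: eigenvalue_def eigenvector_def)
  define S where "S = (\<Sum>i<Suc n. (cmod (u $ i))\<^sup>2)"
  have S: "S > 0"
  proof -
    obtain i where "i < Suc n" "u $ i \<noteq> 0" using u(1,2) by (auto simp: vec_eq_iff)
    thus ?thesis unfolding S_def by (intro sum_pos2[of _ i]) auto
  qed
  \<comment> \<open>This phase turns the first entry of \<open>u\<close> into minus its modulus,
    because the reflection asks for a first entry that is real and nonpositive.\<close>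
  define ph where "ph = (if u $ 0 = 0 then 1 else - cnj (u $ 0) / of_real (cmod (u $ 0)))"
  have ph: "cmod ph = 1" by (auto simp: ph_def norm_divide)
  define v where "v = (ph / of_real (sqrt S)) \<cdot>\<^sub>v u"
  have v: "v \<in> carrier_vec (Suc n)" using u(1) by (simp add: v_def)
  have vi: "v $ i = (ph / of_real (sqrt S)) * u $ i" if "i < Suc n" for i
    using that u(1) by (simp add: v_def)
  have Xv: "X *\<^sub>v v = \<mu> \<cdot>\<^sub>v v"
    unfolding v_def using X u by (simp add: mult_mat_vec[OF X u(1)] smult_smult_assoc mult.commute)
  have "(\<Sum>i<Suc n. (cmod (v $ i))\<^sup>2) = (\<Sum>i<Suc n. (cmod (u $ i))\<^sup>2 / S)"
    using S ph by (intro sum.cong refl) (simp add: vi norm_mult norm_divide power_mult_distrib power_divide)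
  also have "\<dots> = S / S" unfolding S_def sum_divide_distrib ..
  also have "\<dots> = 1" using S by simp
  finally have vn: "(\<Sum>i<Suc n. (cmod (v $ i))\<^sup>2) = 1" .
  have "v $ 0 = complex_of_real (- cmod (u $ 0) / sqrt S)"
  proof (cases "u $ 0 = 0")
    case False
    have "cnj (u $ 0) * u $ 0 = of_real (cmod (u $ 0)) * of_real (cmod (u $ 0))"
      using complex_norm_square[of "u $ 0"] by (simp add: mult.commute power2_eq_square)
    hence "ph * u $ 0 = - of_real (cmod (u $ 0))"
      using False unfolding ph_def by (simp add: field_simps)
    thus ?thesis by (simp add: vi)
  qed (simp add: vi)
  from unitary_with_first_column[OF v _ vn this] S
  obtain W where W: "unitary_op (Suc n) W" and W0: "\<And>i. i < Suc n \<Longrightarrow> W $$ (i, 0) = v $ i"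
    by (auto simp: divide_nonpos_pos)
  have Wc: "W \<in> carrier_mat (Suc n) (Suc n)" using W by (simp add: unitary_op_def)
  define Wa where "Wa = mat_adjoint W"
  have Wac: "Wa \<in> carrier_mat (Suc n) (Suc n)" using Wc by (simp add: Wa_def)
  have WW: "Wa * W = 1\<^sub>m (Suc n)" "W * Wa = 1\<^sub>m (Suc n)" using W by (auto simp: unitary_op_def Wa_def)
  define Y where "Y = Wa * (X * W)"
  have Yc: "Y \<in> carrier_mat (Suc n) (Suc n)" using Wac X Wc by (simp add: Y_def)
  have XY: "X = W * (Y * Wa)"
  proof -
    have "W * (Y * Wa) = (W * Wa) * X * (W * Wa)"
      using Wac X Wc unfolding Y_def by simp
    thus ?thesis using WW X by simp
  qed
  have Ys: "mat_adjoint Y = Y"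
  proof -
    have "mat_adjoint Y = mat_adjoint (X * W) * W"
      unfolding Y_def using Wac X Wc mat_adjoint_times[of Wa "Suc n" "Suc n" "X * W" "Suc n"]
      by (simp add: Wa_def mat_adjoint_mat_adjoint)
    also have "\<dots> = Wa * X * W" using mat_adjoint_times[OF X Wc] by (simp add: Xs Wa_def)
    finally show ?thesis unfolding Y_def using Wac X Wc by simp
  qed
  have Y0: "Y $$ (i, 0) = (if i = 0 then \<mu> else 0)" if i: "i < Suc n" for i
  proof -
    have XW: "(X * W) $$ (k, 0) = \<mu> * W $$ (k, 0)" if k: "k < Suc n" for k
    proof -
      have "(X * W) $$ (k, 0) = (\<Sum>l<Suc n. X $$ (k, l) * v $ l)"
        using k by (subst index_mult_mat_sum[OF X Wc]) (auto intro!: sum.cong simp: W0 simp del: sum.lessThan_Suc)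
      also have "\<dots> = (X *\<^sub>v v) $ k" using index_mult_mat_vec_sum[OF X v k] by simp
      also have "\<dots> = \<mu> * v $ k" using Xv k v by simp
      finally show ?thesis using W0 k by simp
    qed
    have "Y $$ (i, 0) = (\<Sum>k<Suc n. Wa $$ (i, k) * (X * W) $$ (k, 0))"
      unfolding Y_def using i X Wc by (subst index_mult_mat_sum[OF Wac, of _ "Suc n"]) auto
    also have "\<dots> = \<mu> * (\<Sum>k<Suc n. cnj (W $$ (k, i)) * W $$ (k, 0))"
      unfolding sum_distrib_left using i
      by (intro sum.cong refl) (auto simp: XW Wa_def index_mat_adjoint[OF Wc])
    finally show ?thesis using unitary_op_orthonormal_cols[OF W i, of 0] by simp
  qed
  have Yh: "Y $$ (i, j) = cnj (Y $$ (j, i))" if "i < Suc n" "j < Suc n" for i j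
    using that Ys Yc self_adjoint_iff[of "Suc n" Y] self_adjoint_def[of "Suc n" Y] by blast
  have \<mu>: "\<mu> = of_real (Re \<mu>)" using Yh[of 0 0] Y0[of 0] by (simp add: complex_eq_iff)
  define Z where "Z = mat n n (\<lambda>(i, j). Y $$ (Suc i, Suc j))"
  have "self_adjoint n Z" unfolding self_adjoint_iff by (auto simp: Z_def intro: Yh)
  from Suc.IH[OF this] obtain V e where V: "unitary_op n V" and ZV: "Z = spectral_decomp n V e" by blast
  have Vc: "V \<in> carrier_mat n n" using V by (simp add: unitary_op_def)
  \<comment> \<open>Block diagonal, with a leading \<open>1\<close> for the split-off eigenvector
    and the block \<open>V\<close> below it.\<close>
  define V' where "V' = mat (Suc n) (Suc n) (\<lambda>(i, j). case (i, j) of (Suc i', Suc j') \<Rightarrow> V $$ (i', j') | _ \<Rightarrow> if i = j then 1 else 0)"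
  have V'c: "V' \<in> carrier_mat (Suc n) (Suc n)" by (simp add: V'_def)
  define e' where "e' i = (case i of 0 \<Rightarrow> Re \<mu> | Suc i' \<Rightarrow> e i')" for i
  have V': "unitary_op (Suc n) V'"
  proof (rule unitary_opI[OF V'c])
    fix i j assume ij: "i < Suc n" "j < Suc n"
    show "(\<Sum>k<Suc n. cnj (V' $$ (k, i)) * V' $$ (k, j)) = (if i = j then 1 else 0)"
      using ij unitary_op_orthonormal_cols[OF V, of "i - 1" "j - 1"]
      by (cases i; cases j; subst sum.lessThan_Suc_shift) (auto simp: V'_def)
  qed
  have "Y = spectral_decomp (Suc n) V' e'"
  proof (rule eq_matI)
    fix i j assume "i < dim_row (spectral_decomp (Suc n) V' e')" "j < dim_col (spectral_decomp (Suc n) V' e')"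
    hence ij: "i < Suc n" "j < Suc n" using V'c carrier_matD[OF spectral_decomp_carrier[OF V'c]] by auto
    have Z: "Z $$ (i', j') = (\<Sum>k<n. V $$ (i', k) * of_real (e k) * cnj (V $$ (j', k)))" if "i' < n" "j' < n" for i' j'
      unfolding ZV using index_spectral_decomp[OF Vc that] .
    have Zd: "Z $$ (i', j') = Y $$ (Suc i', Suc j')" if "i' < n" "j' < n" for i' j' using that by (simp add: Z_def)
    show "Y $$ (i, j) = spectral_decomp (Suc n) V' e' $$ (i, j)"
      unfolding index_spectral_decomp[OF V'c ij]
      using ij Y0 Yh[of 0 j] \<mu> Z[of "i - 1" "j - 1"] Zd[of "i - 1" "j - 1"]
      by (cases i; cases j; subst sum.lessThan_Suc_shift) (auto simp: V'_def e'_def)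
  qed (use Yc carrier_matD[OF spectral_decomp_carrier[OF V'c]] in auto)
  hence "X = spectral_decomp (Suc n) (W * V') e'"
    using XY Wc V'c Wac mat_adjoint_carrier[OF V'c]
    by (simp add: spectral_decomp_def mat_adjoint_times[OF Wc V'c] Wa_def
        assoc_mult_mat[of _ "Suc n" "Suc n" _ "Suc n" _ "Suc n"])
  thus ?case using unitary_op_times[OF W V'] by blast
qed

section \<open>Products, traces and quadratic forms of spectral decompositions\<close>

lemma dim_spectral_decomp [simp]:
  "dim_row (spectral_decomp n U e) = dim_row U" "dim_col (spectral_decomp n U e) = dim_row U"
  by (auto simp: spectral_decomp_def)

lemma spectral_decomp_cong:
  assumes "\<And>i. i < n \<Longrightarrow> a i = b i"
  shows "spectral_decomp n U a = spectral_decomp n U b"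
proof -
  have "mat_diag n (\<lambda>i. complex_of_real (a i)) = mat_diag n (\<lambda>i. complex_of_real (b i))"
    using assms by (intro eq_matI) (auto simp: mat_diag_def)
  thus ?thesis by (simp add: spectral_decomp_def)
qed

lemma sum_rotate3:
  "(\<Sum>i\<in>A. \<Sum>j\<in>B. \<Sum>k\<in>C. f i j k) = (\<Sum>k\<in>C. \<Sum>i\<in>A. \<Sum>j\<in>B. f i j k)"
proof -
  have "(\<Sum>i\<in>A. \<Sum>j\<in>B. \<Sum>k\<in>C. f i j k) = (\<Sum>i\<in>A. \<Sum>k\<in>C. \<Sum>j\<in>B. f i j k)"
    by (intro sum.cong refl) (rule sum.swap)
  also have "\<dots> = (\<Sum>k\<in>C. \<Sum>i\<in>A. \<Sum>j\<in>B. f i j k)" by (rule sum.swap)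
  finally show ?thesis .
qed

lemma spectral_decomp_mult:
  assumes U: "unitary_op n U"
  shows "spectral_decomp n U a * spectral_decomp n U b = spectral_decomp n U (\<lambda>i. a i * b i)"
proof -
  define D where "D e = mat_diag n (\<lambda>i. complex_of_real (e i))" for e
  have Uc: "U \<in> carrier_mat n n" "mat_adjoint U \<in> carrier_mat n n" and UU: "mat_adjoint U * U = 1\<^sub>m n"
    and Dc: "D e \<in> carrier_mat n n" for e
    using U by (auto simp: unitary_op_def D_def)
  have "spectral_decomp n U a * spectral_decomp n U b = U * D a * (mat_adjoint U * U) * D b * mat_adjoint U"
    unfolding spectral_decomp_def D_def[symmetric] using Uc(1) Dc
    by (simp add: assoc_mult_mat[of _ n n _ n _ n])
  also have "\<dots> = U * (D a * D b) * mat_adjoint U"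
    unfolding UU using Uc(1) Dc
    by (simp add: assoc_mult_mat[of _ n n _ n _ n] right_mult_one_mat[of _ n n])
  also have "D a * D b = D (\<lambda>i. a i * b i)"
    by (simp add: D_def)
  finally show ?thesis unfolding spectral_decomp_def D_def .
qed

lemma spectral_decomp_1:
  assumes U: "unitary_op n U"
  shows "spectral_decomp n U (\<lambda>_. 1) = 1\<^sub>m n"
proof -
  have "U \<in> carrier_mat n n" using U by (simp add: unitary_op_def)
  thus ?thesis using unitary_op_orthonormal_rows[OF U]
    by (intro eq_matI) (auto simp: index_spectral_decomp)
qed

lemma spectral_decomp_adjoint:
  assumes U: "U \<in> carrier_mat n n"
  shows "mat_adjoint (spectral_decomp n U e) = spectral_decomp n U e"
proof -
  have "self_adjoint n (spectral_decomp n U e)"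
    unfolding self_adjoint_iff using U by (auto simp: index_spectral_decomp[OF U] intro!: sum.cong)
  thus ?thesis by (simp add: self_adjoint_def)
qed

text \<open>For \<open>\<rho> = U diag(p) U\<^sup>*\<close> and \<open>\<sigma> = V diag(q) V\<^sup>*\<close> the relative entropy is the classical one of the
  distributions \<open>overlap i j * p i\<close> and \<open>overlap i j * q j\<close> (Nussbaum and Szkola).\<close>

definition overlap :: "nat \<Rightarrow> complex mat \<Rightarrow> complex mat \<Rightarrow> nat \<Rightarrow> nat \<Rightarrow> real" where
  "overlap n U V i j = (cmod ((mat_adjoint U * V) $$ (i, j)))\<^sup>2"

lemma overlap_nonneg [simp]: "0 \<le> overlap n U V i j"
  by (simp add: overlap_def)

lemma overlap_rows:
  assumes "unitary_op n U" "unitary_op n V" "i < n"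
  shows "(\<Sum>j<n. overlap n U V i j) = 1"
proof -
  have "complex_of_real (\<Sum>j<n. overlap n U V i j) = 1"
    using unitary_op_orthonormal_rows[OF unitary_op_times[OF unitary_op_adjoint[OF assms(1)] assms(2)] assms(3) assms(3)]
    unfolding overlap_def of_real_sum complex_norm_square by simp
  thus ?thesis by (simp only: of_real_eq_1_iff)
qed

lemma overlap_cols:
  assumes "unitary_op n U" "unitary_op n V" "j < n"
  shows "(\<Sum>i<n. overlap n U V i j) = 1"
proof -
  have "complex_of_real (\<Sum>i<n. overlap n U V i j) = 1"
    using unitary_op_orthonormal_cols[OF unitary_op_times[OF unitary_op_adjoint[OF assms(1)] assms(2)] assms(3) assms(3)]
    unfolding overlap_def of_real_sum complex_norm_square by (simp add: mult.commute)
  thus ?thesis by (simp only: of_real_eq_1_iff)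
qed

text \<open>Cyclicity moves \<open>U\<close> to the right end, so the second operator is written in
  the eigenbasis of the first and only its diagonal, with the squared moduli of the entries of
  \<open>W\<close>, is seen by the trace.\<close>

lemma mtrace_spectral_mult:
  assumes U: "unitary_op n U" and V: "unitary_op n V"
  shows "mtrace (spectral_decomp n U a * spectral_decomp n V b) =
    of_real (\<Sum>i<n. \<Sum>j<n. overlap n U V i j * (a i * b j))"
proof -
  define D where "D e = mat_diag n (\<lambda>i. complex_of_real (e i))" for e
  define W where "W = mat_adjoint U * V"
  have Uc: "U \<in> carrier_mat n n" "mat_adjoint U \<in> carrier_mat n n"
    and Vc: "V \<in> carrier_mat n n" "mat_adjoint V \<in> carrier_mat n n"
    and Dc: "D e \<in> carrier_mat n n" for e
    using U V by (auto simp: unitary_op_def D_def)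
  have Wc: "W \<in> carrier_mat n n" using Uc Vc by (simp add: W_def)
  have Wa: "mat_adjoint W = mat_adjoint V * U"
    unfolding W_def mat_adjoint_times[OF Uc(2) Vc(1)] using Uc by (simp add: mat_adjoint_mat_adjoint)
  have sW: "spectral_decomp n W b \<in> carrier_mat n n" using Wc by simp
  have "spectral_decomp n U a * spectral_decomp n V b =
      U * (D a * (mat_adjoint U * spectral_decomp n V b))"
    unfolding spectral_decomp_def[of n U] D_def[symmetric] using Uc(1) Vc(1) Dc
    by (simp add: assoc_mult_mat[of _ n n _ n _ n])
  hence "mtrace (spectral_decomp n U a * spectral_decomp n V b) =
      mtrace ((D a * (mat_adjoint U * spectral_decomp n V b)) * U)"
    using Uc Vc Dc by (simp add: mtrace_comm[of U n n])
  also have "(D a * (mat_adjoint U * spectral_decomp n V b)) * U = D a * spectral_decomp n W b"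
    unfolding spectral_decomp_def[of n V] spectral_decomp_def[of n W] D_def[symmetric] Wa
    unfolding W_def using Uc(1) Vc(1) Dc
    by (simp add: assoc_mult_mat[of _ n n _ n _ n])
  also have "mtrace (D a * spectral_decomp n W b) = (\<Sum>i<n. of_real (a i) * spectral_decomp n W b $$ (i, i))"
    unfolding mtrace_def D_def mat_diag_mult_left[OF sW] by simp
  also have "\<dots> = (\<Sum>i<n. \<Sum>j<n. of_real (overlap n U V i j * (a i * b j)))"
  proof (intro sum.cong refl)
    fix i assume "i \<in> {..<n}"
    hence i: "i < n" by simp
    show "of_real (a i) * spectral_decomp n W b $$ (i, i) = (\<Sum>j<n. of_real (overlap n U V i j * (a i * b j)))"
      unfolding index_spectral_decomp[OF Wc i i] sum_distrib_left overlap_def W_def[symmetric]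
        of_real_mult complex_norm_square
      by (intro sum.cong refl) (simp add: algebra_simps)
  qed
  finally show ?thesis by (simp only: of_real_sum)
qed

lemma mtrace_spectral_decomp:
  assumes U: "unitary_op n U"
  shows "mtrace (spectral_decomp n U a) = of_real (\<Sum>i<n. a i)"
proof -
  have Uc: "U \<in> carrier_mat n n" using U by (simp add: unitary_op_def)
  have "spectral_decomp n U a = spectral_decomp n U a * spectral_decomp n U (\<lambda>_. 1)"
    by (simp add: spectral_decomp_mult[OF U])
  hence "mtrace (spectral_decomp n U a) = of_real (\<Sum>i<n. \<Sum>j<n. overlap n U U i j * (a i * 1))"
    using mtrace_spectral_mult[OF U U, of a "\<lambda>_. 1"] by simp
  also have "(\<Sum>i<n. \<Sum>j<n. overlap n U U i j * (a i * 1)) = (\<Sum>i<n. a i)"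
    by (intro sum.cong refl) (simp add: sum_distrib_right[symmetric] overlap_rows[OF U U])
  finally show ?thesis .
qed

lemma inner_mult_mat_vec:
  fixes X :: "complex mat"
  assumes "X \<in> carrier_mat n n" "v \<in> carrier_vec n"
  shows "(X *\<^sub>v v) \<bullet>c v = (\<Sum>i<n. \<Sum>j<n. cnj (v $ i) * X $$ (i, j) * v $ j)"
  using assms
  by (auto simp: scalar_prod_def atLeast0LessThan sum_distrib_right intro!: sum.cong)

lemma inner_spectral_decomp:
  assumes U: "U \<in> carrier_mat n n" and v: "v \<in> carrier_vec n"
  shows "(spectral_decomp n U e *\<^sub>v v) \<bullet>c v =
    of_real (\<Sum>k<n. e k * (cmod (\<Sum>i<n. cnj (U $$ (i, k)) * v $ i))\<^sup>2)"
proof -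
  have "(spectral_decomp n U e *\<^sub>v v) \<bullet>c v = (\<Sum>i<n. \<Sum>j<n. \<Sum>k<n.
      cnj (v $ i) * (U $$ (i, k) * of_real (e k) * cnj (U $$ (j, k))) * v $ j)"
    unfolding inner_mult_mat_vec[OF spectral_decomp_carrier[OF U] v]
    by (intro sum.cong refl) (simp add: index_spectral_decomp[OF U] sum_distrib_left sum_distrib_right)
  also have "\<dots> = (\<Sum>k<n. \<Sum>i<n. \<Sum>j<n.
      cnj (v $ i) * (U $$ (i, k) * of_real (e k) * cnj (U $$ (j, k))) * v $ j)"
    by (rule sum_rotate3)
  also have "\<dots> = (\<Sum>k<n. of_real (e k) * ((\<Sum>j<n. cnj (U $$ (j, k)) * v $ j) * cnj (\<Sum>i<n. cnj (U $$ (i, k)) * v $ i)))"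
    unfolding sum_distrib_left sum_distrib_right cnj_sum
    by (intro sum.cong refl) (simp add: algebra_simps)
  also have "\<dots> = of_real (\<Sum>k<n. e k * (cmod (\<Sum>i<n. cnj (U $$ (i, k)) * v $ i))\<^sup>2)"
    unfolding of_real_sum of_real_mult complex_norm_square ..
  finally show ?thesis .
qed

text \<open>The quadratic form of the identity, computed once in the columns of \<open>U\<close> and
  once in the standard basis.\<close>

lemma parseval:
  assumes U: "unitary_op n U" and v: "v \<in> carrier_vec n"
  shows "(\<Sum>k<n. (cmod (\<Sum>i<n. cnj (U $$ (i, k)) * v $ i))\<^sup>2) = (\<Sum>i<n. (cmod (v $ i))\<^sup>2)"
proof -
  have Uc: "U \<in> carrier_mat n n" using U by (simp add: unitary_op_def)
  have "complex_of_real (\<Sum>k<n. (cmod (\<Sum>i<n. cnj (U $$ (i, k)) * v $ i))\<^sup>2) = (1\<^sub>m n *\<^sub>v v) \<bullet>c v"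
    using inner_spectral_decomp[OF Uc v, of "\<lambda>_. 1"] by (simp add: spectral_decomp_1[OF U])
  also have "\<dots> = of_real (\<Sum>i<n. (cmod (v $ i))\<^sup>2)"
    using v unfolding of_real_sum complex_norm_square
    by (auto simp: scalar_prod_def atLeast0LessThan intro!: sum.cong)
  finally show ?thesis by (simp only: of_real_eq_iff)
qed

lemma spectral_eigenvector:
  assumes U: "unitary_op n U" and k: "k < n"
  shows "spectral_decomp n U e *\<^sub>v col U k = of_real (e k) \<cdot>\<^sub>v col U k"
proof (rule eq_vecI)
  have Uc: "U \<in> carrier_mat n n" using U by (simp add: unitary_op_def)
  fix i assume "i < dim_vec (of_real (e k) \<cdot>\<^sub>v col U k)"
  hence i: "i < n" using Uc by simp
  have "(spectral_decomp n U e *\<^sub>v col U k) $ i = (\<Sum>j<n. \<Sum>l<n. U $$ (i, l) * of_real (e l) * (cnj (U $$ (j, l)) * U $$ (j, k)))"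
    using Uc k i
    by (subst index_mult_mat_vec_sum[OF spectral_decomp_carrier[OF Uc] _ i])
     (auto simp: index_spectral_decomp[OF Uc i] sum_distrib_right intro!: sum.cong)
  also have "\<dots> = (\<Sum>l<n. U $$ (i, l) * of_real (e l) * (if l = k then 1 else 0))"
    by (subst sum.swap, intro sum.cong refl)
      (auto simp: sum_distrib_left[symmetric] unitary_op_orthonormal_cols[OF U _ k])
  also have "\<dots> = (of_real (e k) \<cdot>\<^sub>v col U k) $ i"
    using k i Uc by (simp add: sum.delta if_distrib[of "\<lambda>x. _ * x"] cong: if_cong)
  finally show "(spectral_decomp n U e *\<^sub>v col U k) $ i = (of_real (e k) \<cdot>\<^sub>v col U k) $ i" .
qed (use assms in \<open>auto simp: unitary_op_def spectral_decomp_def\<close>)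

lemma norm_unitary_col:
  assumes U: "unitary_op n U" and k: "k < n"
  shows "(\<Sum>i<n. (cmod (col U k $ i))\<^sup>2) = 1"
proof -
  have Uc: "U \<in> carrier_mat n n" using U by (simp add: unitary_op_def)
  have "complex_of_real (\<Sum>i<n. (cmod (col U k $ i))\<^sup>2) = 1"
    using unitary_op_orthonormal_cols[OF U k k] Uc k
    unfolding of_real_sum complex_norm_square by (simp add: mult.commute)
  thus ?thesis by (simp only: of_real_eq_1_iff)
qed

lemma inner_unitary_col:
  assumes U: "unitary_op n U" and k: "k < n"
  shows "(spectral_decomp n U e *\<^sub>v col U k) \<bullet>c col U k = of_real (e k)"
proof -
  have Uc: "U \<in> carrier_mat n n" using U by (simp add: unitary_op_def)
  have cv: "col U k \<in> carrier_vec n" using Uc k by simp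
  have "(spectral_decomp n U e *\<^sub>v col U k) \<bullet>c col U k =
    of_real (\<Sum>l<n. e l * (cmod (if l = k then 1 else 0))\<^sup>2)"
    unfolding inner_spectral_decomp[OF Uc cv]
    using unitary_op_orthonormal_cols[OF U _ k] Uc k by (intro arg_cong[of _ _ of_real] sum.cong) auto
  also have "\<dots> = of_real (e k)"
    using k by (simp add: if_distrib[of "\<lambda>x. _ * x"] if_distrib[of cmod] if_distrib[of "\<lambda>x. x\<^sup>2"] cong: if_cong)
  finally show ?thesis .
qed

lemma positive_op_spectral:
  assumes "positive_op n X"
  shows "\<exists>U e. unitary_op n U \<and> X = spectral_decomp n U e \<and> (\<forall>i<n. 0 \<le> e i)"
proof -
  have sa: "self_adjoint n X" using assms by (simp add: positive_op_def)
  from spectral_theorem[OF sa] obtain U e where U: "unitary_op n U" and X: "X = spectral_decomp n U e" by blast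
  have Uc: "U \<in> carrier_mat n n" using U by (simp add: unitary_op_def)
  have "0 \<le> e i" if "i < n" for i
    using assms inner_unitary_col[OF U that, of e] Uc that unfolding positive_op_def X by (metis Re_complex_of_real col_carrier_vec)
  thus ?thesis using U X by blast
qed

lemma strictly_positive_op_spectral:
  assumes "strictly_positive_op n X"
  shows "\<exists>U e. unitary_op n U \<and> X = spectral_decomp n U e \<and> (\<forall>i<n. 0 < e i)"
proof -
  have sa: "self_adjoint n X" using assms by (simp add: strictly_positive_op_def)
  from spectral_theorem[OF sa] obtain U e where U: "unitary_op n U" and X: "X = spectral_decomp n U e" by blast
  have Uc: "U \<in> carrier_mat n n" using U by (simp add: unitary_op_def)
  have "0 < e i" if i: "i < n" for i
  proof -
    have c: "col U i \<in> carrier_vec n" using Uc i by simp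
    have "col U i \<noteq> 0\<^sub>v n"
    proof
      assume "col U i = 0\<^sub>v n"
      with norm_unitary_col[OF U i] show False by simp
    qed
    thus ?thesis using assms inner_unitary_col[OF U i, of e] c unfolding strictly_positive_op_def X
      by (metis Re_complex_of_real)
  qed
  thus ?thesis using U X by blast
qed

section \<open>Relative entropy and trace norm\<close>

definition frob_sq :: "complex mat \<Rightarrow> real" where
  "frob_sq X = (\<Sum>i<dim_row X. \<Sum>j<dim_col X. (cmod (X $$ (i, j)))\<^sup>2)"

lemma frob_sq_nonneg: "0 \<le> frob_sq X"
  unfolding frob_sq_def by (intro sum_nonneg) auto

lemma frob_sq_le:
  assumes "X \<in> carrier_mat n n" "\<And>i j. i < n \<Longrightarrow> j < n \<Longrightarrow> cmod (X $$ (i, j)) \<le> c"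
  shows "frob_sq X \<le> (real n * c)\<^sup>2"
proof -
  have "frob_sq X \<le> (\<Sum>i<n. \<Sum>j<n. c\<^sup>2)"
    unfolding frob_sq_def using assms by (auto intro!: sum_mono power_mono simp del: sum_constant)
  also have "\<dots> = (real n * c)\<^sup>2" by (simp add: power2_eq_square)
  finally show ?thesis .
qed

lemma frob_sq_eq_0:
  assumes "X \<in> carrier_mat n m" "frob_sq X = 0"
  shows "X = 0\<^sub>m n m"
proof (rule eq_matI)
  fix i j assume "i < dim_row (0\<^sub>m n m :: complex mat)" "j < dim_col (0\<^sub>m n m :: complex mat)"
  hence ij: "i < n" "j < m" by auto
  have "(\<Sum>i<n. \<Sum>j<m. (cmod (X $$ (i, j)))\<^sup>2) = 0"
    using assms by (auto simp: frob_sq_def)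
  with ij have "(cmod (X $$ (i, j)))\<^sup>2 = 0"
    by (subst (asm) sum_nonneg_eq_0_iff, simp, simp add: sum_nonneg)
      (subst (asm) sum_nonneg_eq_0_iff, auto)
  thus "X $$ (i, j) = 0\<^sub>m n m $$ (i, j)" using ij by simp
qed (use assms in auto)

lemma frob_sq_mtrace:
  assumes "X \<in> carrier_mat n m"
  shows "mtrace (mat_adjoint X * X) = of_real (frob_sq X)"
proof -
  have "mtrace (mat_adjoint X * X) = (\<Sum>j<m. \<Sum>i<n. cnj (X $$ (i, j)) * X $$ (i, j))"
    using assms unfolding mtrace_def
    by (auto intro!: sum.cong simp: index_mult_mat_sum[OF mat_adjoint_carrier[OF assms] assms] index_mat_adjoint[OF assms] simp del: index_mult_mat(1))
  also have "\<dots> = (\<Sum>i<n. \<Sum>j<m. of_real ((cmod (X $$ (i, j)))\<^sup>2))"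
    unfolding complex_norm_square by (subst sum.swap) (simp add: mult.commute)
  finally show ?thesis using assms by (simp add: frob_sq_def)
qed

lemma self_adjoint_diff:
  assumes "self_adjoint n X" "self_adjoint n Y"
  shows "self_adjoint n (X - Y)"
proof -
  have X: "X $$ (i, j) = cnj (X $$ (j, i))" and Y: "Y $$ (i, j) = cnj (Y $$ (j, i))" if "i < n" "j < n" for i j
    using assms that unfolding self_adjoint_iff by blast+
  have c: "X \<in> carrier_mat n n" "Y \<in> carrier_mat n n" using assms by (auto simp: self_adjoint_def)
  have "(X - Y) $$ (i, j) = cnj ((X - Y) $$ (j, i))" if "i < n" "j < n" for i j
    using that c X[OF that] Y[OF that] by simp
  thus ?thesis unfolding self_adjoint_iff using c by auto
qed

text \<open>Expanding the trace of the squared difference leaves two single sums of squares and a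
  cross term. Unit row and column sums of the overlaps spread the single sums over the double sum,
  where the square is completed.\<close>

lemma frob_sq_spectral_diff:
  assumes U: "unitary_op n U" and V: "unitary_op n V"
  shows "frob_sq (spectral_decomp n U p - spectral_decomp n V q) =
    (\<Sum>i<n. \<Sum>j<n. overlap n U V i j * (p i - q j)\<^sup>2)"
proof -
  let ?R = "spectral_decomp n U p" and ?S = "spectral_decomp n V q"
  have Uc: "U \<in> carrier_mat n n" and Vc: "V \<in> carrier_mat n n" using U V by (auto simp: unitary_op_def)
  have R: "?R \<in> carrier_mat n n" and S: "?S \<in> carrier_mat n n" using Uc Vc by auto
  have sq: "mtrace (X * X) = of_real (\<Sum>i<n. (a i)\<^sup>2)" if "X = spectral_decomp n W a" "unitary_op n W" for X W a
    using that(2) unfolding that(1) by (simp add: spectral_decomp_mult mtrace_spectral_decomp power2_eq_square)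
  have "self_adjoint n (?R - ?S)"
    using R S spectral_decomp_adjoint[OF Uc] spectral_decomp_adjoint[OF Vc]
    by (intro self_adjoint_diff) (auto simp: self_adjoint_def)
  hence ad: "mat_adjoint (?R - ?S) = ?R - ?S" by (simp add: self_adjoint_def)
  have "(?R - ?S) * (?R - ?S) = (?R * ?R - ?S * ?R) - (?R * ?S - ?S * ?S)"
    using mult_minus_distrib_mat[OF minus_carrier_mat[OF S] R S, of ?R]
      minus_mult_distrib_mat[OF R S R] minus_mult_distrib_mat[OF R S S] by simp
  hence "mtrace ((?R - ?S) * (?R - ?S)) = mtrace (?R * ?R) - mtrace (?S * ?R) - (mtrace (?R * ?S) - mtrace (?S * ?S))"
    using R S by (simp add: mtrace_diff[of _ n] minus_carrier_mat[of _ n n])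
  also have "mtrace (?S * ?R) = mtrace (?R * ?S)" using mtrace_comm[OF S R] .
  finally have "complex_of_real (frob_sq (?R - ?S)) =
      of_real ((\<Sum>i<n. (p i)\<^sup>2) + (\<Sum>i<n. (q i)\<^sup>2) - 2 * (\<Sum>i<n. \<Sum>j<n. overlap n U V i j * (p i * q j)))"
    using frob_sq_mtrace[OF minus_carrier_mat[OF S], of ?R]
    unfolding ad sq[OF refl U] sq[OF refl V] mtrace_spectral_mult[OF U V]
    by simp
  hence "frob_sq (?R - ?S) = (\<Sum>i<n. (p i)\<^sup>2) + (\<Sum>i<n. (q i)\<^sup>2) - 2 * (\<Sum>i<n. \<Sum>j<n. overlap n U V i j * (p i * q j))"
    by (simp only: of_real_eq_iff)
  also have "(\<Sum>i<n. (p i)\<^sup>2) = (\<Sum>i<n. \<Sum>j<n. overlap n U V i j * (p i)\<^sup>2)"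
    by (simp add: sum_distrib_right[symmetric] overlap_rows[OF U V])
  also have "(\<Sum>j<n. (q j)\<^sup>2) = (\<Sum>i<n. \<Sum>j<n. overlap n U V i j * (q j)\<^sup>2)"
    by (subst sum.swap) (simp add: sum_distrib_right[symmetric] overlap_cols[OF U V])
  also have "(\<Sum>i<n. \<Sum>j<n. overlap n U V i j * (p i)\<^sup>2) + (\<Sum>i<n. \<Sum>j<n. overlap n U V i j * (q j)\<^sup>2)
      - 2 * (\<Sum>i<n. \<Sum>j<n. overlap n U V i j * (p i * q j)) =
     (\<Sum>i<n. \<Sum>j<n. overlap n U V i j * (p i)\<^sup>2 + overlap n U V i j * (q j)\<^sup>2 - 2 * (overlap n U V i j * (p i * q j)))"
    by (simp only: sum.distrib sum_subtractf sum_distrib_left)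
  also have "\<dots> = (\<Sum>i<n. \<Sum>j<n. overlap n U V i j * (p i - q j)\<^sup>2)"
    by (intro sum.cong refl) (simp add: power2_diff algebra_simps)
  finally show ?thesis .
qed

text \<open>An operator with positive eigenvalues is invertible, with inverse given by the
  reciprocal eigenvalues. Relative entropies with respect to a faithful state therefore never fall
  into the infinite case.\<close>

lemma op_range_faithful:
  assumes V: "unitary_op n V" and q: "\<And>i. i < n \<Longrightarrow> 0 < q i" and R: "R \<in> carrier_mat n n"
  shows "op_range R \<subseteq> op_range (spectral_decomp n V q)"
proof
  let ?S = "spectral_decomp n V q" and ?I = "spectral_decomp n V (\<lambda>i. 1 / q i)"
  have Vc: "V \<in> carrier_mat n n" using V by (simp add: unitary_op_def)
  have S: "?S \<in> carrier_mat n n" and I: "?I \<in> carrier_mat n n" using Vc by auto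
  have "?S * ?I = spectral_decomp n V (\<lambda>_. 1)"
    unfolding spectral_decomp_mult[OF V] using q
    by (intro spectral_decomp_cong) (auto dest: less_imp_neq[OF q])
  hence SI: "?S * ?I = 1\<^sub>m n" by (simp add: spectral_decomp_1[OF V])
  fix y assume "y \<in> op_range R"
  hence y: "y \<in> carrier_vec n" using R by (auto simp: op_range_def)
  have "y = ?S *\<^sub>v (?I *\<^sub>v y)"
    using y S I by (simp add: assoc_mult_mat_vec[symmetric, of _ n n _ n] SI)
  moreover have "?I *\<^sub>v y \<in> carrier_vec (dim_col ?S)" using I y S by auto
  ultimately show "y \<in> op_range ?S" unfolding op_range_def by blast
qed

text \<open>Unit row sums of the overlaps bring the single sum of \<open>p i * ln (p i)\<close> into
  the same double-sum form as the cross term; an eigenvalue \<open>p i = 0\<close> contributes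
  nothing because of the factor in front.\<close>

lemma rel_entropy_spectral:
  assumes U: "unitary_op n U" and V: "unitary_op n V" and q: "\<And>i. i < n \<Longrightarrow> 0 < q i"
  shows "rel_entropy (spectral_decomp n U p) (spectral_decomp n V q) =
    ereal (\<Sum>i<n. \<Sum>j<n. overlap n U V i j * (p i * (ln (p i) - ln (q j))))"
proof -
  let ?R = "spectral_decomp n U p" and ?S = "spectral_decomp n V q"
  have Uc: "U \<in> carrier_mat n n" and Vc: "V \<in> carrier_mat n n" using U V by (auto simp: unitary_op_def)
  have hf: "herm_fun ln ?R = spectral_decomp n U (\<lambda>i. ln (p i))" "herm_fun ln ?S = spectral_decomp n V (\<lambda>i. ln (q i))"
    using herm_fun_eq[OF U refl] herm_fun_eq[OF V refl] by (simp_all add: spectral_decomp_def)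
  have "?R * (herm_fun ln ?R - herm_fun ln ?S) =
      ?R * spectral_decomp n U (\<lambda>i. ln (p i)) - ?R * spectral_decomp n V (\<lambda>i. ln (q i))"
    unfolding hf using Uc Vc by (simp add: mult_minus_distrib_mat[of _ n n _ n])
  hence "mtrace (?R * (herm_fun ln ?R - herm_fun ln ?S)) =
      mtrace (?R * spectral_decomp n U (\<lambda>i. ln (p i))) - mtrace (?R * spectral_decomp n V (\<lambda>i. ln (q i)))"
    using Uc Vc by (simp add: mtrace_diff[of _ n])
  also have "mtrace (?R * spectral_decomp n U (\<lambda>i. ln (p i))) = of_real (\<Sum>i<n. p i * ln (p i))"
    by (simp add: spectral_decomp_mult[OF U] mtrace_spectral_decomp[OF U])
  also have "(\<Sum>i<n. p i * ln (p i)) = (\<Sum>i<n. \<Sum>j<n. overlap n U V i j * (p i * ln (p i)))"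
    by (simp add: sum_distrib_right[symmetric] overlap_rows[OF U V])
  finally have "mtrace (?R * (herm_fun ln ?R - herm_fun ln ?S)) =
    of_real (\<Sum>i<n. \<Sum>j<n. overlap n U V i j * (p i * (ln (p i) - ln (q j))))"
    unfolding mtrace_spectral_mult[OF U V] of_real_diff[symmetric]
    by (simp add: sum_subtractf[symmetric] algebra_simps)
  thus ?thesis unfolding rel_entropy_def
    using op_range_faithful[OF V q spectral_decomp_carrier[OF Uc, of p]] by simp
qed

text \<open>From \<open>ln x \<le> x - 1\<close> at \<open>x = sqrt q / sqrt p\<close>. Taking the
  square root first leaves a quadratic remainder of Hellinger type, which later identifies the case
  of equality.\<close>

lemma mult_ln_diff_ge:
  fixes p q :: real
  assumes "0 \<le> p" "0 < q"
  shows "p - q + (sqrt p - sqrt q)\<^sup>2 \<le> p * (ln p - ln q)"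
proof (cases "p = 0")
  case False
  hence p: "0 < p" using assms by simp
  have "ln (sqrt q / sqrt p) \<le> sqrt q / sqrt p - 1"
    using p assms by (intro ln_le_minus_one) simp
  moreover have "ln (sqrt q / sqrt p) = (ln q - ln p) / 2"
    using p assms by (simp add: ln_div ln_sqrt)
  ultimately have "ln p - ln q \<ge> 2 * (1 - sqrt q / sqrt p)" by simp
  hence "p * (ln p - ln q) \<ge> p * (2 * (1 - sqrt q / sqrt p))" using p by (intro mult_left_mono) auto
  also have "p * (2 * (1 - sqrt q / sqrt p)) = 2 * p - 2 * sqrt p * sqrt q"
    using p by (simp add: field_simps)
  finally show ?thesis using p assms by (simp add: power2_diff)
qed (use assms in simp)

text \<open>From \<open>ln x \<le> x - 1\<close> at \<open>x = p / q\<close>; the remainder is the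
  chi-square term.\<close>

lemma mult_ln_diff_le:
  fixes p q :: real
  assumes "0 \<le> p" "0 < q"
  shows "p * (ln p - ln q) \<le> p - q + (p - q)\<^sup>2 / q"
proof (cases "p = 0")
  case False
  hence p: "0 < p" using assms by simp
  have "ln (p / q) \<le> p / q - 1"
    using p assms by (intro ln_le_minus_one) simp
  hence "p * (ln p - ln q) \<le> p * (p / q - 1)"
    using p assms by (intro mult_left_mono) (auto simp: ln_div)
  also have "p * (p / q - 1) = p - q + (p - q)\<^sup>2 / q"
    using assms by (simp add: field_simps power2_eq_square)
  finally show ?thesis .
qed (use assms in \<open>simp add: power2_eq_square\<close>)

text \<open>Removes the linear part \<open>p - q\<close> of both scalar estimates after summation,
  as the two states have equal trace.\<close>

lemma overlap_sum_diff:
  assumes U: "unitary_op n U" and V: "unitary_op n V" and "(\<Sum>i<n. p i) = (\<Sum>i<n. q i)"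
  shows "(\<Sum>i<n. \<Sum>j<n. overlap n U V i j * (p i - q j)) = 0"
proof -
  have "(\<Sum>i<n. \<Sum>j<n. overlap n U V i j * p i) = (\<Sum>i<n. p i)"
    by (simp add: sum_distrib_right[symmetric] overlap_rows[OF U V])
  moreover have "(\<Sum>i<n. \<Sum>j<n. overlap n U V i j * q j) = (\<Sum>i<n. q i)"
    by (subst sum.swap) (simp add: sum_distrib_right[symmetric] overlap_cols[OF U V])
  ultimately show ?thesis using assms(3) by (simp add: sum_subtractf right_diff_distrib)
qed

text \<open>Serves twice: it shows that the entropy is nonnegative, and its left side detects when
  the entropy vanishes.\<close>

lemma spectral_entropy_ge:
  assumes U: "unitary_op n U" and V: "unitary_op n V" and s: "(\<Sum>i<n. p i) = (\<Sum>i<n. q i)"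
    and p: "\<And>i. i < n \<Longrightarrow> 0 \<le> p i" and q: "\<And>i. i < n \<Longrightarrow> 0 < q i"
  shows "(\<Sum>i<n. \<Sum>j<n. overlap n U V i j * (sqrt (p i) - sqrt (q j))\<^sup>2)
    \<le> (\<Sum>i<n. \<Sum>j<n. overlap n U V i j * (p i * (ln (p i) - ln (q j))))"
proof -
  have "(\<Sum>i<n. \<Sum>j<n. overlap n U V i j * (sqrt (p i) - sqrt (q j))\<^sup>2) =
     (\<Sum>i<n. \<Sum>j<n. overlap n U V i j * (p i - q j + (sqrt (p i) - sqrt (q j))\<^sup>2))"
    using overlap_sum_diff[OF U V s] by (simp add: distrib_left sum.distrib)
  also have "\<dots> \<le> (\<Sum>i<n. \<Sum>j<n. overlap n U V i j * (p i * (ln (p i) - ln (q j))))"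
    using mult_ln_diff_ge p q by (intro sum_mono mult_left_mono) auto
  finally show ?thesis .
qed

text \<open>Zero entropy forces every Hellinger term to vanish, so \<open>p i = q j\<close> wherever
  the overlap is nonzero. The Hilbert-Schmidt distance is a sum with the same weights, hence zero,
  although the two eigenbases may differ.\<close>

lemma spectral_entropy_eq_0:
  assumes U: "unitary_op n U" and V: "unitary_op n V" and s: "(\<Sum>i<n. p i) = (\<Sum>i<n. q i)"
    and p: "\<And>i. i < n \<Longrightarrow> 0 \<le> p i" and q: "\<And>i. i < n \<Longrightarrow> 0 < q i"
    and 0: "(\<Sum>i<n. \<Sum>j<n. overlap n U V i j * (p i * (ln (p i) - ln (q j)))) = 0"
  shows "spectral_decomp n U p = spectral_decomp n V q"
proof -
  let ?R = "spectral_decomp n U p" and ?S = "spectral_decomp n V q"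
  have Uc: "U \<in> carrier_mat n n" and Vc: "V \<in> carrier_mat n n" using U V by (auto simp: unitary_op_def)
  have R: "?R \<in> carrier_mat n n" and S: "?S \<in> carrier_mat n n" using Uc Vc by auto
  have nn: "0 \<le> overlap n U V i j * (sqrt (p i) - sqrt (q j))\<^sup>2" for i j by simp
  have z: "overlap n U V i j * (sqrt (p i) - sqrt (q j))\<^sup>2 = 0" if ij: "i < n" "j < n" for i j
  proof -
    have "(\<Sum>i<n. \<Sum>j<n. overlap n U V i j * (sqrt (p i) - sqrt (q j))\<^sup>2) \<le> 0"
      using spectral_entropy_ge[OF U V s p q] 0 by simp
    hence "(\<Sum>i<n. \<Sum>j<n. overlap n U V i j * (sqrt (p i) - sqrt (q j))\<^sup>2) = 0"
      by (intro antisym sum_nonneg nn)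
    hence "(\<Sum>j<n. overlap n U V i j * (sqrt (p i) - sqrt (q j))\<^sup>2) = 0"
      using ij by (subst (asm) sum_nonneg_eq_0_iff) (auto intro!: sum_nonneg nn)
    thus ?thesis using ij by (subst (asm) sum_nonneg_eq_0_iff) auto
  qed
  have "overlap n U V i j * (p i - q j)\<^sup>2 = 0" if ij: "i < n" "j < n" for i j
    using z[OF ij] by auto
  hence "frob_sq (?R - ?S) = 0"
    unfolding frob_sq_spectral_diff[OF U V] by (intro sum.neutral ballI) simp
  from frob_sq_eq_0[OF minus_carrier_mat[OF S] this] have D: "?R - ?S = 0\<^sub>m n n" .
  show ?thesis
  proof (rule eq_matI)
    fix i j assume "i < dim_row ?S" "j < dim_col ?S"
    hence ij: "i < n" "j < n" using S by auto
    have "(?R - ?S) $$ (i, j) = 0" using D ij by simp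
    thus "?R $$ (i, j) = ?S $$ (i, j)" using ij Uc Vc by simp
  qed (use Uc Vc in auto)
qed

lemma density_op_spectral:
  assumes "density_op n \<rho>"
  shows "\<exists>U p. unitary_op n U \<and> \<rho> = spectral_decomp n U p \<and> (\<forall>i<n. 0 \<le> p i) \<and> (\<Sum>i<n. p i) = 1"
proof -
  from assms have "positive_op n \<rho>" and tr: "mtrace \<rho> = 1" by (auto simp: density_op_def)
  from positive_op_spectral[OF this(1)] obtain U p
    where U: "unitary_op n U" "\<rho> = spectral_decomp n U p" "\<forall>i<n. 0 \<le> p i" by blast
  moreover have "(\<Sum>i<n. p i) = 1"
    using tr unfolding U(2) mtrace_spectral_decomp[OF U(1)] by (simp only: of_real_eq_1_iff)
  ultimately show ?thesis by blast
qed

text \<open>The upper bound is a reverse Pinsker inequality: the chi-square estimate term by term,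
  with each \<open>q j\<close> in the denominator replaced by the lower bound
  \<open>c\<close>.\<close>

lemma rel_entropy_bounds:
  assumes \<rho>: "density_op n \<rho>" and V: "unitary_op n V" and q: "\<And>i. i < n \<Longrightarrow> c \<le> q i" "0 < c"
    and s: "(\<Sum>i<n. q i) = 1"
  shows "0 \<le> rel_entropy \<rho> (spectral_decomp n V q)"
    and "rel_entropy \<rho> (spectral_decomp n V q) \<le> ereal (frob_sq (\<rho> - spectral_decomp n V q) / c)"
proof -
  obtain U p where U: "unitary_op n U" and R: "\<rho> = spectral_decomp n U p" and p: "\<And>i. i < n \<Longrightarrow> 0 \<le> p i"
    and sp: "(\<Sum>i<n. p i) = 1" using density_op_spectral[OF \<rho>] by blast
  have q': "0 < q i" if "i < n" for i using q that by force
  have s': "(\<Sum>i<n. p i) = (\<Sum>i<n. q i)" using s sp by simp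
  have D: "rel_entropy \<rho> (spectral_decomp n V q) =
      ereal (\<Sum>i<n. \<Sum>j<n. overlap n U V i j * (p i * (ln (p i) - ln (q j))))"
    unfolding R by (rule rel_entropy_spectral[OF U V]) (rule q')
  have "0 \<le> (\<Sum>i<n. \<Sum>j<n. overlap n U V i j * (sqrt (p i) - sqrt (q j))\<^sup>2)"
    by (intro sum_nonneg) auto
  also note spectral_entropy_ge[OF U V s' p q']
  finally show "0 \<le> rel_entropy \<rho> (spectral_decomp n V q)"
    unfolding D by simp
  have "(\<Sum>i<n. \<Sum>j<n. overlap n U V i j * (p i * (ln (p i) - ln (q j))))
      \<le> (\<Sum>i<n. \<Sum>j<n. overlap n U V i j * (p i - q j + (p i - q j)\<^sup>2 / c))"
  proof (intro sum_mono mult_left_mono)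
    fix i j assume ij: "i \<in> {..<n}" "j \<in> {..<n}"
    have "p i * (ln (p i) - ln (q j)) \<le> p i - q j + (p i - q j)\<^sup>2 / q j"
      using mult_ln_diff_le p q' ij by simp
    also have "\<dots> \<le> p i - q j + (p i - q j)\<^sup>2 / c"
      using q ij q'[of j] by (intro add_left_mono divide_left_mono) auto
    finally show "p i * (ln (p i) - ln (q j)) \<le> p i - q j + (p i - q j)\<^sup>2 / c" .
  qed simp
  also have "\<dots> = (\<Sum>i<n. \<Sum>j<n. overlap n U V i j * (p i - q j)\<^sup>2) / c"
    using overlap_sum_diff[OF U V s'] by (simp add: distrib_left sum.distrib sum_divide_distrib)
  finally show "rel_entropy \<rho> (spectral_decomp n V q) \<le> ereal (frob_sq (\<rho> - spectral_decomp n V q) / c)"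
    unfolding D unfolding R frob_sq_spectral_diff[OF U V] by simp
qed

text \<open>The trace norm is the sum of the singular values, and each of the \<open>n\<close>
  singular values is at most the Hilbert-Schmidt norm. The factor \<open>n\<close> does no harm,
  because the bound is applied in the fixed dimension \<open>d ^ k\<close>.\<close>

lemma trace_norm_bounds:
  assumes X: "X \<in> carrier_mat n n"
  shows "0 \<le> trace_norm X" "trace_norm X \<le> real n * sqrt (frob_sq X)"
proof -
  let ?Y = "mat_adjoint X * X"
  have Xa: "mat_adjoint X \<in> carrier_mat n n" using X by simp
  have Y: "?Y \<in> carrier_mat n n" using X by simp
  have "self_adjoint n ?Y" unfolding self_adjoint_def
    using X Y mat_adjoint_times[OF Xa X] by (simp add: mat_adjoint_mat_adjoint)
  moreover have "0 \<le> Re ((?Y *\<^sub>v v) \<bullet>c v)" if v: "v \<in> carrier_vec n" for v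
  proof -
    have "(?Y *\<^sub>v v) \<bullet>c v = (\<Sum>i<n. \<Sum>j<n. \<Sum>k<n. (X $$ (k, j) * v $ j) * cnj (X $$ (k, i) * v $ i))"
      unfolding inner_mult_mat_vec[OF Y v]
      by (intro sum.cong refl) (simp add: index_mult_mat_sum[OF Xa X] index_mat_adjoint[OF X] sum_distrib_left sum_distrib_right algebra_simps del: index_mult_mat(1))
    also have "\<dots> = (\<Sum>k<n. \<Sum>i<n. \<Sum>j<n. (X $$ (k, j) * v $ j) * cnj (X $$ (k, i) * v $ i))"
      by (rule sum_rotate3)
    also have "\<dots> = (\<Sum>k<n. (\<Sum>j<n. X $$ (k, j) * v $ j) * cnj (\<Sum>i<n. X $$ (k, i) * v $ i))"
      unfolding sum_product cnj_sum by (rule sum.cong[OF refl]) (rule sum.swap)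
    also have "\<dots> = of_real (\<Sum>k<n. (cmod (\<Sum>j<n. X $$ (k, j) * v $ j))\<^sup>2)"
      unfolding of_real_sum complex_norm_square ..
    finally show ?thesis by (simp add: sum_nonneg)
  qed
  ultimately have "positive_op n ?Y" by (simp add: positive_op_def)
  from positive_op_spectral[OF this] obtain U s where U: "unitary_op n U" and YU: "?Y = spectral_decomp n U s"
    and s: "\<And>i. i < n \<Longrightarrow> 0 \<le> s i" by blast
  have "herm_fun sqrt ?Y = spectral_decomp n U (\<lambda>i. sqrt (s i))"
    unfolding YU using herm_fun_eq[OF U refl] by (simp add: spectral_decomp_def)
  hence tn: "trace_norm X = (\<Sum>i<n. sqrt (s i))"
    unfolding trace_norm_def by (simp add: mtrace_spectral_decomp[OF U])
  show "0 \<le> trace_norm X" unfolding tn using s by (intro sum_nonneg) auto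
  have "complex_of_real (frob_sq X) = of_real (\<Sum>i<n. s i)"
    using frob_sq_mtrace[OF X] mtrace_spectral_decomp[OF U, of s] YU by simp
  hence fs: "frob_sq X = (\<Sum>i<n. s i)" by (simp only: of_real_eq_iff)
  have "sqrt (s i) \<le> sqrt (frob_sq X)" if "i < n" for i
    unfolding fs using that s by (intro real_sqrt_le_mono member_le_sum) auto
  hence "trace_norm X \<le> (\<Sum>i<n. sqrt (frob_sq X))" unfolding tn by (intro sum_mono) auto
  thus "trace_norm X \<le> real n * sqrt (frob_sq X)" by simp
qed

section \<open>Tensor products in digit coordinates\<close>

lemma digit_less: "0 < d \<Longrightarrow> digit d N l i < d"
  by (simp add: digit_def)

lemma digit_add_left:
  assumes "l \<le> M"
  shows "digit d (M + N) l i = digit d M l (i div d ^ N)"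
proof -
  have "M + N - l = N + (M - l)" using assms by simp
  thus ?thesis by (simp add: digit_def power_add div_mult2_eq)
qed

lemma digit_add_right:
  assumes "0 < d" "1 \<le> l" "l \<le> N"
  shows "digit d (M + N) (M + l) i = digit d N l (i mod d ^ N)"
proof -
  have "d ^ N = d ^ (N - l) * d ^ l" using assms by (simp add: power_add[symmetric])
  hence "(i mod d ^ N) div d ^ (N - l) = i div d ^ (N - l) mod d ^ l"
    using assms by (simp add: mod_mult2_eq)
  moreover have "i div d ^ (N - l) mod d ^ l mod d = i div d ^ (N - l) mod d"
    using assms by (intro mod_mod_cancel) (simp add: dvd_power)
  ultimately show ?thesis using assms by (simp add: digit_def)
qed

lemma digit_Suc: "l \<le> N \<Longrightarrow> digit d (Suc N) l i = digit d N l (i div d)"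
  using digit_add_left[of l N d 1 i] by simp

lemma digit_last: "digit d (Suc N) (Suc N) i = i mod d"
  by (simp add: digit_def)

lemma digits_inject:
  assumes "i < d ^ N" "j < d ^ N" "\<And>l. l \<in> {1..N} \<Longrightarrow> digit d N l i = digit d N l j"
  shows "i = j"
  using assms
proof (induction N arbitrary: i j)
  case (Suc N)
  have "i div d = j div d"
  proof (rule Suc.IH)
    show "i div d < d ^ N" "j div d < d ^ N"
      using Suc.prems(1,2) by (auto simp: less_mult_imp_div_less mult.commute)
    fix l assume "l \<in> {1..N}"
    thus "digit d N l (i div d) = digit d N l (j div d)"
      using Suc.prems(3)[of l] digit_Suc[of l N d] by simp
  qed
  moreover have "i mod d = j mod d" using Suc.prems(3)[of "Suc N"] by (simp add: digit_last)
  ultimately show ?case by (metis div_mult_mod_eq)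
qed simp

lemma sum_lessThan_mult:
  fixes f :: "nat \<Rightarrow> 'a::comm_monoid_add"
  shows "(\<Sum>i<m * d. f i) = (\<Sum>q<m. \<Sum>r<d. f (q * d + r))"
proof -
  have "(\<Sum>i<m * d. f i) = (\<Sum>q<m. sum f {q * d..<q * d + d})"
    by (rule sum.nat_group[symmetric])
  also have "\<dots> = (\<Sum>q<m. \<Sum>r<d. f (q * d + r))"
    by (rule sum.cong[OF refl]) (simp add: sum.atLeastLessThan_shift_0[of f] atLeast0LessThan)
  finally show ?thesis .
qed

text \<open>An index below \<open>d ^ N\<close> is the same as a tuple of \<open>N\<close> digits,
  so a sum of products over indices factorises. Traces, products and row sums of tensor products all
  reduce to this.\<close>

lemma sum_prod_digits:
  fixes f :: "nat \<Rightarrow> nat \<Rightarrow> 'a::comm_semiring_1"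
  shows "(\<Sum>i<d ^ N. \<Prod>l=1..N. f l (digit d N l i)) = (\<Prod>l=1..N. \<Sum>x<d. f l x)"
proof (induction N)
  case (Suc N)
  have "(\<Sum>i<d ^ Suc N. \<Prod>l=1..Suc N. f l (digit d (Suc N) l i))
      = (\<Sum>q<d ^ N. \<Sum>r<d. (\<Prod>l=1..N. f l (digit d N l q)) * f (Suc N) r)"
    unfolding power_Suc2 sum_lessThan_mult
  proof (intro sum.cong refl)
    fix q r assume "r \<in> {..<d}"
    hence r: "(q * d + r) div d = q" "(q * d + r) mod d = r" "r mod d = r" by auto
    have "(\<Prod>l=1..N. f l (digit d (Suc N) l (q * d + r))) = (\<Prod>l=1..N. f l (digit d N l q))"
      by (intro prod.cong refl) (simp add: digit_Suc r)
    thus "(\<Prod>l=1..Suc N. f l (digit d (Suc N) l (q * d + r))) = (\<Prod>l=1..N. f l (digit d N l q)) * f (Suc N) r"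
      by (simp add: digit_last r)
  qed
  also have "\<dots> = (\<Prod>l=1..Suc N. \<Sum>x<d. f l x)"
    unfolding sum_distrib_left[symmetric] sum_distrib_right[symmetric] Suc.IH by simp
  finally show ?case .
qed simp

lemma sum2_prod_digits:
  fixes f :: "nat \<Rightarrow> nat \<Rightarrow> nat \<Rightarrow> 'a::comm_semiring_1"
  shows "(\<Sum>i<d ^ N. \<Sum>j<d ^ N. \<Prod>l=1..N. f l (digit d N l i) (digit d N l j))
    = (\<Prod>l=1..N. \<Sum>x<d. \<Sum>y<d. f l x y)"
proof -
  have "(\<Sum>i<d ^ N. \<Sum>j<d ^ N. \<Prod>l=1..N. f l (digit d N l i) (digit d N l j))
      = (\<Sum>i<d ^ N. \<Prod>l=1..N. \<Sum>y<d. f l (digit d N l i) y)"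
    by (intro sum.cong refl sum_prod_digits)
  also have "\<dots> = (\<Prod>l=1..N. \<Sum>x<d. \<Sum>y<d. f l x y)" by (rule sum_prod_digits)
  finally show ?thesis .
qed

text \<open>The operator \<open>X 1\<close> tensor ... tensor \<open>X N\<close>, given by its
  entries and not by iterating \<open>kron\<close>: the factors are then the values of a function,
  and replacing one of them is an update \<open>X(l := Y)\<close>.\<close>

definition tprod :: "nat \<Rightarrow> nat \<Rightarrow> (nat \<Rightarrow> complex mat) \<Rightarrow> complex mat" where
  "tprod d N X = mat (d ^ N) (d ^ N) (\<lambda>(i, j). \<Prod>l=1..N. X l $$ (digit d N l i, digit d N l j))"

lemma tprod_carrier [simp]: "tprod d N X \<in> carrier_mat (d ^ N) (d ^ N)"
  by (simp add: tprod_def)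

lemma dim_tprod [simp]: "dim_row (tprod d N X) = d ^ N" "dim_col (tprod d N X) = d ^ N"
  by (simp_all add: tprod_def)

lemma index_tprod:
  "i < d ^ N \<Longrightarrow> j < d ^ N \<Longrightarrow>
    tprod d N X $$ (i, j) = (\<Prod>l=1..N. X l $$ (digit d N l i, digit d N l j))"
  by (simp add: tprod_def)

lemma tprod_cong: "(\<And>l. l \<in> {1..N} \<Longrightarrow> X l = Y l) \<Longrightarrow> tprod d N X = tprod d N Y"
  by (auto simp: tprod_def intro!: prod.cong)

lemma tprod_mult:
  assumes d: "0 < d" and X: "\<And>l. l \<in> {1..N} \<Longrightarrow> X l \<in> carrier_mat d d"
    and Y: "\<And>l. l \<in> {1..N} \<Longrightarrow> Y l \<in> carrier_mat d d"
  shows "tprod d N X * tprod d N Y = tprod d N (\<lambda>l. X l * Y l)"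
proof (rule eq_matI)
  fix i j assume "i < dim_row (tprod d N (\<lambda>l. X l * Y l))" "j < dim_col (tprod d N (\<lambda>l. X l * Y l))"
  hence ij: "i < d ^ N" "j < d ^ N" by auto
  have "(tprod d N X * tprod d N Y) $$ (i, j) =
      (\<Sum>k<d ^ N. \<Prod>l=1..N. X l $$ (digit d N l i, digit d N l k) * Y l $$ (digit d N l k, digit d N l j))"
    using ij by (subst index_mult_mat_sum[OF tprod_carrier tprod_carrier ij])
      (simp add: index_tprod prod.distrib)
  also have "\<dots> = (\<Prod>l=1..N. \<Sum>x<d. X l $$ (digit d N l i, x) * Y l $$ (x, digit d N l j))"
    by (rule sum_prod_digits[of "\<lambda>l x. X l $$ (digit d N l i, x) * Y l $$ (x, digit d N l j)"])
  also have "\<dots> = (\<Prod>l=1..N. (X l * Y l) $$ (digit d N l i, digit d N l j))"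
  proof (intro prod.cong refl)
    fix l assume l: "l \<in> {1..N}"
    show "(\<Sum>x<d. X l $$ (digit d N l i, x) * Y l $$ (x, digit d N l j)) = (X l * Y l) $$ (digit d N l i, digit d N l j)"
      by (rule index_mult_mat_sum[OF X[OF l] Y[OF l] digit_less[OF d] digit_less[OF d], symmetric])
  qed
  finally show "(tprod d N X * tprod d N Y) $$ (i, j) = tprod d N (\<lambda>l. X l * Y l) $$ (i, j)"
    using ij by (simp add: index_tprod)
qed auto

lemma tprod_adjoint:
  assumes d: "0 < d" and X: "\<And>l. l \<in> {1..N} \<Longrightarrow> X l \<in> carrier_mat d d"
  shows "mat_adjoint (tprod d N X) = tprod d N (\<lambda>l. mat_adjoint (X l))"
proof (rule eq_matI)
  fix i j assume "i < dim_row (tprod d N (\<lambda>l. mat_adjoint (X l)))" "j < dim_col (tprod d N (\<lambda>l. mat_adjoint (X l)))"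
  hence ij: "i < d ^ N" "j < d ^ N" by auto
  show "mat_adjoint (tprod d N X) $$ (i, j) = tprod d N (\<lambda>l. mat_adjoint (X l)) $$ (i, j)"
    using ij by (simp add: index_mat_adjoint[OF tprod_carrier] index_tprod index_mat_adjoint[OF X] digit_less[OF d])
qed auto

lemma mtrace_tprod:
  assumes "\<And>l. l \<in> {1..N} \<Longrightarrow> X l \<in> carrier_mat d d"
  shows "mtrace (tprod d N X) = (\<Prod>l=1..N. mtrace (X l))"
proof -
  have "mtrace (tprod d N X) = (\<Sum>i<d ^ N. \<Prod>l=1..N. X l $$ (digit d N l i, digit d N l i))"
    by (simp add: mtrace_def index_tprod)
  also have "\<dots> = (\<Prod>l=1..N. \<Sum>x<d. X l $$ (x, x))" by (rule sum_prod_digits)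
  also have "\<dots> = (\<Prod>l=1..N. mtrace (X l))"
  proof (intro prod.cong refl)
    fix l assume "l \<in> {1..N}"
    thus "(\<Sum>x<d. X l $$ (x, x)) = mtrace (X l)" using assms[of l] by (auto simp: mtrace_def)
  qed
  finally show ?thesis .
qed

lemma tprod_0 [simp]: "tprod d 0 X = 1\<^sub>m 1"
  by (auto simp: tprod_def intro!: eq_matI)

lemma tprod_1: "X (Suc 0) \<in> carrier_mat d d \<Longrightarrow> tprod d (Suc 0) X = X (Suc 0)"
  by (auto simp: tprod_def digit_def intro!: eq_matI)

text \<open>Different indices differ in some digit, and there the diagonal factor is zero.\<close>

lemma tprod_diag:
  assumes d: "0 < d"
  shows "tprod d N (\<lambda>l. mat_diag d (f l)) = mat_diag (d ^ N) (\<lambda>i. \<Prod>l=1..N. f l (digit d N l i))"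
proof (rule eq_matI)
  fix i j assume "i < dim_row (mat_diag (d ^ N) (\<lambda>i. \<Prod>l=1..N. f l (digit d N l i)))"
    "j < dim_col (mat_diag (d ^ N) (\<lambda>i. \<Prod>l=1..N. f l (digit d N l i)))"
  hence ij: "i < d ^ N" "j < d ^ N" by (auto simp: mat_diag_def)
  show "tprod d N (\<lambda>l. mat_diag d (f l)) $$ (i, j) = mat_diag (d ^ N) (\<lambda>i. \<Prod>l=1..N. f l (digit d N l i)) $$ (i, j)"
  proof (cases "i = j")
    case False
    then obtain l where l: "l \<in> {1..N}" "digit d N l i \<noteq> digit d N l j" using digits_inject[OF ij] by blast
    have "(\<Prod>l=1..N. mat_diag d (f l) $$ (digit d N l i, digit d N l j)) = 0"
      using l by (intro prod_zero bexI[of _ l]) (auto simp: mat_diag_def digit_less[OF d])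
    thus ?thesis using ij False by (simp add: index_tprod) (simp add: mat_diag_def)
  qed (use ij in \<open>simp add: index_tprod, simp add: mat_diag_def digit_less[OF d]\<close>)
qed (auto simp: mat_diag_def)

lemma tprod_one:
  assumes d: "0 < d"
  shows "tprod d N (\<lambda>_. 1\<^sub>m d) = 1\<^sub>m (d ^ N)"
  using tprod_diag[OF d, of N "\<lambda>_ _. 1"] by simp

section \<open>Kronecker products, one-body and two-body operators in digit coordinates\<close>

lemma index_kron:
  assumes "X \<in> carrier_mat a a" "Y \<in> carrier_mat b b" "i < a * b" "j < a * b"
  shows "kron X Y $$ (i, j) = X $$ (i div b, j div b) * Y $$ (i mod b, j mod b)"
  using assms by (auto simp: kron_def)

lemma kron_carrier: "X \<in> carrier_mat a a \<Longrightarrow> Y \<in> carrier_mat b b \<Longrightarrow> kron X Y \<in> carrier_mat (a * b) (a * b)"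
  by (auto simp: kron_def)

text \<open>The bridge between the iterated \<open>kron\<close> in which tensor powers, one-body
  operators and marginals are expressed and the coordinates in which they are computed.\<close>

lemma kron_tprod:
  assumes d: "0 < d"
  shows "kron (tprod d M X) (tprod d N Y) = tprod d (M + N) (\<lambda>l. if l \<le> M then X l else Y (l - M))"
    (is "?L = ?R")
proof (rule eq_matI)
  have c: "?L \<in> carrier_mat (d ^ M * d ^ N) (d ^ M * d ^ N)" by (intro kron_carrier tprod_carrier)
  show "dim_row ?L = dim_row ?R" "dim_col ?L = dim_col ?R" using c by (auto simp: power_add)
  fix i j assume "i < dim_row ?R" "j < dim_col ?R"
  hence ij: "i < d ^ M * d ^ N" "j < d ^ M * d ^ N" by (auto simp: power_add)
  have b: "i div d ^ N < d ^ M" "j div d ^ N < d ^ M" "i mod d ^ N < d ^ N" "j mod d ^ N < d ^ N"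
    using ij d by (auto simp: less_mult_imp_div_less)
  have u: "{1..M + N} = {1..M} \<union> (\<lambda>l. M + l) ` {1..N}"
    by (simp add: image_add_atLeastAtMost) (auto simp del: image_add_atLeastAtMost)
  let ?f = "\<lambda>l. (if l \<le> M then X l else Y (l - M)) $$ (digit d (M + N) l i, digit d (M + N) l j)"
  have "?R $$ (i, j) = prod ?f ({1..M} \<union> (\<lambda>l. M + l) ` {1..N})"
    unfolding u[symmetric] using ij by (intro index_tprod) (auto simp: power_add)
  also have "\<dots> = prod ?f {1..M} * prod ?f ((\<lambda>l. M + l) ` {1..N})"
    by (rule prod.union_disjoint) auto
  also have "prod ?f {1..M} = tprod d M X $$ (i div d ^ N, j div d ^ N)"
    using b by (auto simp: index_tprod digit_add_left intro!: prod.cong)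
  also have "prod ?f ((\<lambda>l. M + l) ` {1..N}) = tprod d N Y $$ (i mod d ^ N, j mod d ^ N)"
    using b by (subst prod.reindex) (auto simp: index_tprod digit_add_right[OF d] intro!: prod.cong)
  finally show "?L $$ (i, j) = ?R $$ (i, j)"
    by (simp add: index_kron[OF tprod_carrier tprod_carrier ij])
qed

lemma tensor_power_tprod:
  assumes d: "0 < d" and X: "X \<in> carrier_mat d d"
  shows "tensor_power X N = tprod d N (\<lambda>_. X)"
proof (induction N)
  case (Suc N)
  have "kron (tprod d N (\<lambda>_. X)) (tprod d 1 (\<lambda>_. X)) = tprod d (N + 1) (\<lambda>_. X)"
    using kron_tprod[OF d, of N "\<lambda>_. X" 1 "\<lambda>_. X"] by simp
  thus ?case using Suc X by (simp add: tprod_1)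
qed simp

lemma one_body_tprod:
  assumes d: "0 < d" and X: "X \<in> carrier_mat d d" and l: "l \<in> {1..N}"
  shows "one_body d N X l = tprod d N ((\<lambda>_. 1\<^sub>m d)(l := X))"
proof -
  have "one_body d N X l = kron (tprod d (l - 1) (\<lambda>_. 1\<^sub>m d)) (kron (tprod d 1 (\<lambda>_. X)) (tprod d (N - l) (\<lambda>_. 1\<^sub>m d)))"
    using X by (simp add: one_body_def tprod_one[OF d] tprod_1)
  also have "\<dots> = tprod d (l - 1 + (1 + (N - l))) ((\<lambda>_. 1\<^sub>m d)(l := X))"
    unfolding kron_tprod[OF d] using l by (intro tprod_cong) auto
  also have "l - 1 + (1 + (N - l)) = N" using l by simp
  finally show ?thesis .
qed

definition mat_unit :: "nat \<Rightarrow> nat \<Rightarrow> nat \<Rightarrow> complex mat" where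
  "mat_unit n a b = mat n n (\<lambda>(i, j). if i = a \<and> j = b then 1 else 0)"

lemma mat_unit_carrier [simp]: "mat_unit n a b \<in> carrier_mat n n"
  by (simp add: mat_unit_def)

text \<open>With \<open>A\<close> read as a \<open>d\<close> by \<open>d\<close> array of blocks of
  size \<open>d\<close>, it is the sum of \<open>mat_unit d a b\<close> tensor
  \<open>mat_block d A a b\<close>.\<close>

definition mat_block :: "nat \<Rightarrow> complex mat \<Rightarrow> nat \<Rightarrow> nat \<Rightarrow> complex mat" where
  "mat_block d A a b = mat d d (\<lambda>(i, j). A $$ (a * d + i, b * d + j))"

lemma mat_block_carrier [simp]: "mat_block d A a b \<in> carrier_mat d d"
  by (simp add: mat_block_def)

lemma sum_mat_unit:
  assumes "x < d" "y < d"
  shows "(\<Sum>a<d. \<Sum>b<d. mat_unit d a b $$ (x, y) * f a b) = f x y"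
proof -
  have "(\<Sum>a<d. \<Sum>b<d. mat_unit d a b $$ (x, y) * f a b) = (\<Sum>a<d. if a = x then f x y else 0)"
    using assms by (intro sum.cong refl) (auto simp: mat_unit_def if_distrib[of "\<lambda>z. z * _"] cong: if_cong)
  thus ?thesis using assms by simp
qed

lemma index_tprod_upd:
  assumes "l \<in> {1..N}" "i < d ^ N" "j < d ^ N"
  shows "tprod d N (X(l := Y)) $$ (i, j) =
    Y $$ (digit d N l i, digit d N l j) * (\<Prod>r\<in>{1..N} - {l}. X r $$ (digit d N r i, digit d N r j))"
  using assms by (subst index_tprod) (auto simp: prod.remove[of _ l] intro!: arg_cong2[of _ _ _ _ "(*)"] prod.cong)

lemma index_tprod_upd2:
  assumes "l \<in> {1..N}" "l' \<in> {1..N}" "l \<noteq> l'" "i < d ^ N" "j < d ^ N"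
  shows "tprod d N (X(l := Y, l' := Z)) $$ (i, j) =
    Y $$ (digit d N l i, digit d N l j) * Z $$ (digit d N l' i, digit d N l' j) *
    (\<Prod>r\<in>{1..N} - {l, l'}. X r $$ (digit d N r i, digit d N r j))"
proof -
  let ?h = "\<lambda>r. (X(l := Y)) r $$ (digit d N r i, digit d N r j)"
  have s: "{1..N} - {l'} - {l} = {1..N} - {l, l'}" by auto
  have "tprod d N (X(l := Y, l' := Z)) $$ (i, j) = Z $$ (digit d N l' i, digit d N l' j) * prod ?h ({1..N} - {l'})"
    using assms by (intro index_tprod_upd)
  also have "prod ?h ({1..N} - {l'}) = ?h l * prod ?h ({1..N} - {l'} - {l})"
    using assms by (intro prod.remove) auto
  also have "prod ?h ({1..N} - {l'} - {l}) = (\<Prod>r\<in>{1..N} - {l, l'}. X r $$ (digit d N r i, digit d N r j))"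
    unfolding s by (intro prod.cong) auto
  finally show ?thesis by (simp only: fun_upd_same mult_ac)
qed

text \<open>Reduces the interaction to \<open>d * d\<close> product operators, so that the calculus
  of one-factor updates also covers pairs of sites.\<close>

lemma two_body_tprod:
  assumes d: "0 < d" and l: "l \<in> {1..N}" "l' \<in> {1..N}" "l \<noteq> l'" and ij: "i < d ^ N" "j < d ^ N"
  shows "two_body d N A l l' $$ (i, j) =
    (\<Sum>a<d. \<Sum>b<d. tprod d N ((\<lambda>_. 1\<^sub>m d)(l := mat_unit d a b, l' := mat_block d A a b)) $$ (i, j))"
proof -
  let ?g = "\<lambda>r. digit d N r"
  have P: "(\<Prod>r\<in>{1..N} - {l, l'}. (1\<^sub>m d :: complex mat) $$ (?g r i, ?g r j)) =
      (if \<forall>r\<in>{1..N} - {l, l'}. ?g r i = ?g r j then 1 else 0)" (is "?P = _")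
  proof (cases "\<forall>r\<in>{1..N} - {l, l'}. ?g r i = ?g r j")
    case False
    then obtain r where "r \<in> {1..N} - {l, l'}" "?g r i \<noteq> ?g r j" by blast
    hence "?P = 0" by (intro prod_zero bexI[of _ r]) (auto simp: digit_less[OF d])
    thus ?thesis unfolding if_not_P[OF False] .
  qed (simp add: digit_less[OF d])
  have "(\<Sum>a<d. \<Sum>b<d. tprod d N ((\<lambda>_. 1\<^sub>m d)(l := mat_unit d a b, l' := mat_block d A a b)) $$ (i, j)) =
     (\<Sum>a<d. \<Sum>b<d. mat_unit d a b $$ (?g l i, ?g l j) * (mat_block d A a b $$ (?g l' i, ?g l' j) * ?P))"
    by (simp add: index_tprod_upd2[OF l ij] mult.assoc)
  also have "\<dots> = mat_block d A (?g l i) (?g l j) $$ (?g l' i, ?g l' j) * ?P"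
    by (rule sum_mat_unit) (auto simp: digit_less[OF d])
  also have "\<dots> = two_body d N A l l' $$ (i, j)"
    unfolding P using ij by (simp add: two_body_def mat_block_def digit_less[OF d])
  finally show ?thesis ..
qed

lemma flip_op_carrier: "flip_op d \<in> carrier_mat (d * d) (d * d)"
  by (simp add: flip_op_def)

lemma pair_less: "a < (d::nat) \<Longrightarrow> b < e \<Longrightarrow> a * e + b < d * e"
proof -
  assume "a < d" "b < e"
  hence "a * e + b < Suc a * e" by simp
  also have "\<dots> \<le> d * e" using \<open>a < d\<close> by (intro mult_right_mono) auto
  finally show ?thesis .
qed

lemma flip_symmetric_index:
  assumes A: "A \<in> carrier_mat (d * d) (d * d)" and S: "flip_op d * A * flip_op d = A"
    and x: "x < d" "x' < d" "y < d" "y' < d"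
  shows "A $$ (x * d + x', y * d + y') = A $$ (x' * d + x, y' * d + y)"
proof -
  let ?F = "flip_op d"
  have F: "?F \<in> carrier_mat (d * d) (d * d)" by (rule flip_op_carrier)
  have i: "x * d + x' < d * d" "y * d + y' < d * d" "x' * d + x < d * d" "y' * d + y < d * d"
    using x by (auto intro: pair_less)
  \<comment> \<open>The flip is a permutation matrix: row \<open>u * d + u'\<close> has its only
    nonzero entry in column \<open>u' * d + u\<close>. \<open>Fr\<close> is the same fact for
    columns.\<close>
  have Fl: "?F $$ (u * d + u', k) = (if k = u' * d + u then 1 else 0)" if "u < d" "u' < d" "k < d * d" for u u' k
  proof -
    have "(u = k mod d \<and> u' = k div d) \<longleftrightarrow> k = u' * d + u" using that by (metis div_mult_mod_eq div_mult_self3 div_less add.commute mod_mult_self3 mod_less less_nat_zero_code add_0)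
    thus ?thesis using that by (auto simp: flip_op_def pair_less)
  qed
  have Fr: "?F $$ (k, u * d + u') = (if k = u' * d + u then 1 else 0)" if "u < d" "u' < d" "k < d * d" for u u' k
  proof -
    have "(k div d = u' \<and> k mod d = u) \<longleftrightarrow> k = u' * d + u" using that by (metis div_mult_mod_eq div_mult_self3 div_less add.commute mod_mult_self3 mod_less less_nat_zero_code add_0)
    thus ?thesis using that by (auto simp: flip_op_def pair_less)
  qed
  have "A $$ (x * d + x', y * d + y') = (?F * A * ?F) $$ (x * d + x', y * d + y')" using S by simp
  also have "\<dots> = (\<Sum>k<d * d. (?F * A) $$ (x * d + x', k) * ?F $$ (k, y * d + y'))"
    by (rule index_mult_mat_sum[OF _ F i(1,2)]) (use F A in simp)
  also have "\<dots> = (?F * A) $$ (x * d + x', y' * d + y)"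
    using i x by (simp add: Fr if_distrib[of "\<lambda>z. _ * z"] cong: if_cong del: index_mult_mat)
  also have "\<dots> = (\<Sum>k<d * d. ?F $$ (x * d + x', k) * A $$ (k, y' * d + y))"
    by (rule index_mult_mat_sum[OF F A i(1,4)])
  also have "\<dots> = A $$ (x' * d + x, y' * d + y)"
    using i x by (simp add: Fl if_distrib[of "\<lambda>z. z * _"] cong: if_cong)
  finally show ?thesis .
qed

text \<open>Exchange symmetry of \<open>A\<close> makes the two sites interchangeable, so the sum
  over \<open>l < l'\<close> can be handled as a sum over unordered pairs.\<close>

lemma two_body_commute:
  assumes d: "0 < d" and A: "A \<in> carrier_mat (d * d) (d * d)" "flip_op d * A * flip_op d = A"
  shows "two_body d N A l l' = two_body d N A l' l"
  by (auto simp: two_body_def insert_commute flip_symmetric_index[OF A] digit_less[OF d] intro!: eq_matI)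

section \<open>Operators with bounded rows and columns\<close>

text \<open>The hypothesis of the Schur test. It plays the role of an operator norm bound, can be
  read off the entries, and behaves well under sums, products and tensor products.\<close>

definition schur_bounded :: "nat \<Rightarrow> real \<Rightarrow> complex mat \<Rightarrow> bool" where
  "schur_bounded n r X \<longleftrightarrow> X \<in> carrier_mat n n \<and>
     (\<forall>i<n. (\<Sum>j<n. cmod (X $$ (i, j))) \<le> r) \<and> (\<forall>j<n. (\<Sum>i<n. cmod (X $$ (i, j))) \<le> r)"

lemma schur_bounded_carrier: "schur_bounded n r X \<Longrightarrow> X \<in> carrier_mat n n"
  by (simp add: schur_bounded_def)

lemma schur_bounded_mono: "schur_bounded n r X \<Longrightarrow> r \<le> s \<Longrightarrow> schur_bounded n s X"
  by (force simp: schur_bounded_def)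

lemma schur_bounded_one: "schur_bounded n 1 (1\<^sub>m n)"
  by (auto simp: schur_bounded_def if_distrib[of cmod] cong: if_cong)

lemma schur_bounded_mat_unit: "schur_bounded n 1 (mat_unit n a b)"
proof -
  have "(\<Sum>j<n. cmod (mat_unit n a b $$ (i, j))) \<le> (\<Sum>j<n. if j = b then 1 else 0)" if "i < n" for i
    using that by (intro sum_mono) (auto simp: mat_unit_def)
  moreover have "(\<Sum>i<n. cmod (mat_unit n a b $$ (i, j))) \<le> (\<Sum>i<n. if i = a then 1 else 0)" if "j < n" for j
    using that by (intro sum_mono) (auto simp: mat_unit_def)
  moreover have "(\<Sum>i<n. if i = c then 1 else 0) \<le> (1::real)" for c by simp
  ultimately show ?thesis unfolding schur_bounded_def
    by (intro conjI allI impI mat_unit_carrier) (blast intro: order.trans)+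
qed

lemma schur_bounded_smult:
  assumes "schur_bounded n r X"
  shows "schur_bounded n (cmod c * r) (c \<cdot>\<^sub>m X)"
  using assms by (auto simp: schur_bounded_def norm_mult sum_distrib_left[symmetric] mult_left_mono)

lemma schur_bounded_add:
  assumes "schur_bounded n r X" "schur_bounded n s Y"
  shows "schur_bounded n (r + s) (X + Y)"
proof -
  have c: "X \<in> carrier_mat n n" "Y \<in> carrier_mat n n" using assms by (auto simp: schur_bounded_def)
  have "(\<Sum>j<n. cmod ((X + Y) $$ (i, j))) \<le> r + s" if "i < n" for i
  proof -
    have "(\<Sum>j<n. cmod ((X + Y) $$ (i, j))) \<le> (\<Sum>j<n. cmod (X $$ (i, j))) + (\<Sum>j<n. cmod (Y $$ (i, j)))"
      unfolding sum.distrib[symmetric] using that c by (intro sum_mono) (auto intro: norm_triangle_ineq)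
    also have "\<dots> \<le> r + s" using assms that by (intro add_mono) (auto simp: schur_bounded_def)
    finally show ?thesis .
  qed
  moreover have "(\<Sum>i<n. cmod ((X + Y) $$ (i, j))) \<le> r + s" if "j < n" for j
  proof -
    have "(\<Sum>i<n. cmod ((X + Y) $$ (i, j))) \<le> (\<Sum>i<n. cmod (X $$ (i, j))) + (\<Sum>i<n. cmod (Y $$ (i, j)))"
      unfolding sum.distrib[symmetric] using that c by (intro sum_mono) (auto intro: norm_triangle_ineq)
    also have "\<dots> \<le> r + s" using assms that by (intro add_mono) (auto simp: schur_bounded_def)
    finally show ?thesis .
  qed
  ultimately show ?thesis using c by (auto simp: schur_bounded_def)
qed

lemma schur_bounded_diff:
  assumes "schur_bounded n r X" "schur_bounded n s Y"
  shows "schur_bounded n (r + s) (X - Y)"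
proof -
  have c: "X \<in> carrier_mat n n" "Y \<in> carrier_mat n n" using assms by (auto simp: schur_bounded_def)
  have "X - Y = X + (-1) \<cdot>\<^sub>m Y" using c by (intro eq_matI) auto
  thus ?thesis using schur_bounded_add[OF assms(1) schur_bounded_smult[OF assms(2), of "-1"]] by simp
qed

lemma schur_bounded_mult:
  assumes X: "schur_bounded n r X" and Y: "schur_bounded n s Y" and nn: "0 \<le> r" "0 \<le> s"
  shows "schur_bounded n (r * s) (X * Y)"
proof -
  have c: "X \<in> carrier_mat n n" "Y \<in> carrier_mat n n" using assms by (auto simp: schur_bounded_def)
  have le: "cmod ((X * Y) $$ (i, j)) \<le> (\<Sum>k<n. cmod (X $$ (i, k)) * cmod (Y $$ (k, j)))" if "i < n" "j < n" for i j
    unfolding index_mult_mat_sum[OF c that] by (rule order.trans[OF norm_sum]) (simp add: norm_mult)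
  have "(\<Sum>j<n. cmod ((X * Y) $$ (i, j))) \<le> r * s" if i: "i < n" for i
  proof -
    have "(\<Sum>j<n. cmod ((X * Y) $$ (i, j))) \<le> (\<Sum>j<n. \<Sum>k<n. cmod (X $$ (i, k)) * cmod (Y $$ (k, j)))"
      using le i by (intro sum_mono) auto
    also have "\<dots> = (\<Sum>k<n. cmod (X $$ (i, k)) * (\<Sum>j<n. cmod (Y $$ (k, j))))"
      by (subst sum.swap) (simp add: sum_distrib_left)
    also have "\<dots> \<le> (\<Sum>k<n. cmod (X $$ (i, k)) * s)"
      using Y by (intro sum_mono mult_left_mono) (auto simp: schur_bounded_def)
    also have "\<dots> \<le> r * s" unfolding sum_distrib_right[symmetric]
      using X i nn by (intro mult_right_mono) (auto simp: schur_bounded_def)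
    finally show ?thesis .
  qed
  moreover have "(\<Sum>i<n. cmod ((X * Y) $$ (i, j))) \<le> r * s" if j: "j < n" for j
  proof -
    have "(\<Sum>i<n. cmod ((X * Y) $$ (i, j))) \<le> (\<Sum>i<n. \<Sum>k<n. cmod (X $$ (i, k)) * cmod (Y $$ (k, j)))"
      using le j by (intro sum_mono) auto
    also have "\<dots> = (\<Sum>k<n. (\<Sum>i<n. cmod (X $$ (i, k))) * cmod (Y $$ (k, j)))"
      by (subst sum.swap) (simp add: sum_distrib_right)
    also have "\<dots> \<le> (\<Sum>k<n. r * cmod (Y $$ (k, j)))"
      using X by (intro sum_mono mult_right_mono) (auto simp: schur_bounded_def)
    also have "\<dots> \<le> r * s" unfolding sum_distrib_left[symmetric]
      using Y j nn by (intro mult_left_mono) (auto simp: schur_bounded_def)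
    finally show ?thesis .
  qed
  ultimately show ?thesis using c by (auto simp: schur_bounded_def)
qed

lemma schur_bounded_ex:
  assumes "X \<in> carrier_mat n n"
  shows "\<exists>r\<ge>0. schur_bounded n r X"
proof (intro exI conjI)
  let ?r = "\<Sum>i<n. \<Sum>j<n. cmod (X $$ (i, j))"
  show "0 \<le> ?r" by (intro sum_nonneg) auto
  have "(\<Sum>j<n. cmod (X $$ (i, j))) \<le> ?r" if "i < n" for i
    using that by (intro member_le_sum[of i "{..<n}" "\<lambda>i. \<Sum>j<n. cmod (X $$ (i, j))"]) (auto intro: sum_nonneg)
  moreover have "(\<Sum>i<n. cmod (X $$ (i, j))) \<le> ?r" if "j < n" for j
    using that by (intro sum_mono member_le_sum[of j "{..<n}"]) auto
  ultimately show "schur_bounded n ?r X" using assms by (simp add: schur_bounded_def)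
qed

text \<open>A row or column sum of a tensor product is the product of the row or column sums of the
  factors, so the bound \<open>1\<close> survives for every \<open>N\<close>.\<close>

lemma schur_bounded_tprod:
  assumes d: "0 < d" and X: "\<And>l. l \<in> {1..N} \<Longrightarrow> schur_bounded d 1 (X l)"
  shows "schur_bounded (d ^ N) 1 (tprod d N X)"
proof -
  have "(\<Sum>j<d ^ N. cmod (tprod d N X $$ (i, j))) \<le> 1" if i: "i < d ^ N" for i
  proof -
    have "(\<Sum>j<d ^ N. cmod (tprod d N X $$ (i, j))) =
        (\<Sum>j<d ^ N. \<Prod>l=1..N. cmod (X l $$ (digit d N l i, digit d N l j)))"
      using i by (simp add: index_tprod prod_norm)
    also have "\<dots> = (\<Prod>l=1..N. \<Sum>x<d. cmod (X l $$ (digit d N l i, x)))"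
      by (rule sum_prod_digits[of "\<lambda>l x. cmod (X l $$ (digit d N l i, x))"])
    also have "\<dots> \<le> 1" using X digit_less[OF d] by (intro prod_le_1) (auto simp: schur_bounded_def intro: sum_nonneg)
    finally show ?thesis .
  qed
  moreover have "(\<Sum>i<d ^ N. cmod (tprod d N X $$ (i, j))) \<le> 1" if j: "j < d ^ N" for j
  proof -
    have "(\<Sum>i<d ^ N. cmod (tprod d N X $$ (i, j))) =
        (\<Sum>i<d ^ N. \<Prod>l=1..N. cmod (X l $$ (digit d N l i, digit d N l j)))"
      using j by (simp add: index_tprod prod_norm)
    also have "\<dots> = (\<Prod>l=1..N. \<Sum>x<d. cmod (X l $$ (x, digit d N l j)))"
      by (rule sum_prod_digits[of "\<lambda>l x. cmod (X l $$ (x, digit d N l j))"])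
    also have "\<dots> \<le> 1" using X digit_less[OF d] by (intro prod_le_1) (auto simp: schur_bounded_def intro: sum_nonneg)
    finally show ?thesis .
  qed
  ultimately show ?thesis by (simp add: schur_bounded_def)
qed

section \<open>Expectations of bounded operators in a state\<close>

lemma density_op_carrier: "density_op n \<rho> \<Longrightarrow> \<rho> \<in> carrier_mat n n"
  by (simp add: density_op_def positive_op_def self_adjoint_def)

text \<open>The inequality between geometric and arithmetic mean, applied to each term of the
  spectral expansion of the entry.\<close>

lemma density_op_entry_le:
  assumes "density_op n \<rho>" "i < n" "j < n"
  shows "cmod (\<rho> $$ (i, j)) \<le> (Re (\<rho> $$ (i, i)) + Re (\<rho> $$ (j, j))) / 2"
proof -
  obtain U p where U: "unitary_op n U" and R: "\<rho> = spectral_decomp n U p" and p: "\<And>i. i < n \<Longrightarrow> 0 \<le> p i"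
    using density_op_spectral[OF assms(1)] by blast
  have Uc: "U \<in> carrier_mat n n" using U by (simp add: unitary_op_def)
  have dg: "Re (\<rho> $$ (k, k)) = (\<Sum>l<n. p l * (cmod (U $$ (k, l)))\<^sup>2)" if "k < n" for k
  proof -
    have "\<rho> $$ (k, k) = (\<Sum>l<n. of_real (p l * (cmod (U $$ (k, l)))\<^sup>2))"
      unfolding R index_spectral_decomp[OF Uc that that] of_real_mult complex_norm_square
      by (intro sum.cong refl) (simp add: algebra_simps)
    thus ?thesis by simp
  qed
  have "cmod (\<rho> $$ (i, j)) \<le> (\<Sum>l<n. cmod (U $$ (i, l) * of_real (p l) * cnj (U $$ (j, l))))"
    unfolding R index_spectral_decomp[OF Uc assms(2,3)] by (rule norm_sum)
  also have "\<dots> \<le> (\<Sum>l<n. p l * (((cmod (U $$ (i, l)))\<^sup>2 + (cmod (U $$ (j, l)))\<^sup>2) / 2))"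
  proof (intro sum_mono)
    fix l assume "l \<in> {..<n}"
    hence l: "0 \<le> p l" using p by simp
    have "cmod (U $$ (i, l)) * cmod (U $$ (j, l)) \<le> ((cmod (U $$ (i, l)))\<^sup>2 + (cmod (U $$ (j, l)))\<^sup>2) / 2"
      using sum_squares_bound[of "cmod (U $$ (i, l))" "cmod (U $$ (j, l))"] by simp
    from mult_left_mono[OF this l]
    show "cmod (U $$ (i, l) * of_real (p l) * cnj (U $$ (j, l))) \<le> p l * (((cmod (U $$ (i, l)))\<^sup>2 + (cmod (U $$ (j, l)))\<^sup>2) / 2)"
      using l by (simp add: norm_mult algebra_simps)
  qed
  also have "\<dots> = (Re (\<rho> $$ (i, i)) + Re (\<rho> $$ (j, j))) / 2"
    unfolding dg[OF assms(2)] dg[OF assms(3)]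
    by (simp add: sum.distrib sum_divide_distrib add_divide_distrib distrib_left)
  finally show ?thesis .
qed

text \<open>Each entry of the state is at most the mean of two diagonal entries. One half of the
  double sum is then controlled by the column sums of \<open>P\<close>, the other by its row sums,
  and the diagonal adds up to one.\<close>

lemma cmod_mtrace_mult_le:
  assumes P: "schur_bounded n r P" and \<rho>: "density_op n \<rho>" and r: "0 \<le> r"
  shows "cmod (mtrace (P * \<rho>)) \<le> r"
proof -
  have c: "P \<in> carrier_mat n n" "\<rho> \<in> carrier_mat n n" using P \<rho> by (auto simp: schur_bounded_def density_op_carrier)
  let ?t = "\<lambda>i. Re (\<rho> $$ (i, i))"
  have t: "0 \<le> ?t i" if "i < n" for i
    using order.trans[OF norm_ge_zero density_op_entry_le[OF \<rho> that that]] by simp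
  have tr: "(\<Sum>i<n. ?t i) = 1"
    using \<rho> c(2) by (auto simp: density_op_def mtrace_def Re_sum[symmetric])
  have "cmod (mtrace (P * \<rho>)) \<le> (\<Sum>i<n. \<Sum>j<n. cmod (P $$ (i, j) * \<rho> $$ (j, i)))"
    unfolding mtrace_mult_sum[OF c] by (intro sum_norm_le order.refl)
  also have "\<dots> \<le> (\<Sum>i<n. \<Sum>j<n. cmod (P $$ (i, j)) * ((?t j + ?t i) / 2))"
    unfolding norm_mult using density_op_entry_le[OF \<rho>] by (intro sum_mono mult_left_mono) auto
  also have "\<dots> = ((\<Sum>i<n. \<Sum>j<n. cmod (P $$ (i, j)) * ?t j) + (\<Sum>i<n. \<Sum>j<n. cmod (P $$ (i, j)) * ?t i)) / 2"
    by (simp add: sum.distrib sum_divide_distrib add_divide_distrib distrib_left)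
  also have "(\<Sum>i<n. \<Sum>j<n. cmod (P $$ (i, j)) * ?t j) = (\<Sum>j<n. (\<Sum>i<n. cmod (P $$ (i, j))) * ?t j)"
    by (subst sum.swap) (simp add: sum_distrib_right)
  also have "\<dots> \<le> (\<Sum>j<n. r * ?t j)"
    using P t by (intro sum_mono mult_right_mono) (auto simp: schur_bounded_def)
  also have "(\<Sum>i<n. \<Sum>j<n. cmod (P $$ (i, j)) * ?t i) = (\<Sum>i<n. (\<Sum>j<n. cmod (P $$ (i, j))) * ?t i)"
    by (simp add: sum_distrib_right)
  also have "\<dots> \<le> (\<Sum>i<n. r * ?t i)"
    using P t by (intro sum_mono mult_right_mono) (auto simp: schur_bounded_def)
  finally show ?thesis by (simp add: sum_distrib_left[symmetric] tr)
qed

section \<open>Marginals\<close>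

lemma marginal_carrier [simp]: "marginal d N k \<rho> \<in> carrier_mat (d ^ k) (d ^ k)"
  by (simp add: marginal_def ptrace2_def)

lemma tprod_mat_unit:
  assumes d: "0 < d" and ij: "i < d ^ k" "j < d ^ k"
  shows "tprod d k (\<lambda>l. mat_unit d (digit d k l j) (digit d k l i)) = mat_unit (d ^ k) j i"
proof (rule eq_matI)
  fix p q assume "p < dim_row (mat_unit (d ^ k) j i)" "q < dim_col (mat_unit (d ^ k) j i)"
  hence pq: "p < d ^ k" "q < d ^ k" by (auto simp: mat_unit_def)
  let ?f = "\<lambda>l. mat_unit d (digit d k l j) (digit d k l i) $$ (digit d k l p, digit d k l q)"
  show "tprod d k (\<lambda>l. mat_unit d (digit d k l j) (digit d k l i)) $$ (p, q) = mat_unit (d ^ k) j i $$ (p, q)"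
  proof (cases "p = j \<and> q = i")
    case True
    thus ?thesis using pq by (simp add: index_tprod) (simp add: mat_unit_def digit_less[OF d])
  next
    case False
    have "\<exists>l\<in>{1..k}. digit d k l p \<noteq> digit d k l j \<or> digit d k l q \<noteq> digit d k l i"
      using False digits_inject[OF pq(1) ij(2)] digits_inject[OF pq(2) ij(1)] by blast
    then obtain l where l: "l \<in> {1..k}" "digit d k l p \<noteq> digit d k l j \<or> digit d k l q \<noteq> digit d k l i" by blast
    have "prod ?f {1..k} = 0"
      using l by (intro prod_zero bexI[of _ l]) (auto simp: mat_unit_def digit_less[OF d])
    thus ?thesis unfolding index_tprod[OF pq] using pq False by (auto simp: mat_unit_def[of "d ^ k"])
  qed
qed (auto simp: mat_unit_def)

text \<open>Turns convergence of marginals into convergence of expectations of product observables.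
  The indices of the matrix units are transposed because the trace against the unit at
  \<open>(j, i)\<close> selects the entry \<open>(i, j)\<close>.\<close>

lemma marginal_eq_mtrace:
  assumes d: "0 < d" and k: "k \<le> N" and ij: "i < d ^ k" "j < d ^ k" and \<rho>: "\<rho> \<in> carrier_mat (d ^ N) (d ^ N)"
  shows "marginal d N k \<rho> $$ (i, j) =
    mtrace (tprod d N (\<lambda>l. if l \<le> k then mat_unit d (digit d k l j) (digit d k l i) else 1\<^sub>m d) * \<rho>)"
proof -
  define b where "b = d ^ (N - k)"
  have dN: "d ^ N = d ^ k * b" using k by (simp add: b_def power_add[symmetric])
  have b0: "0 < b" using d by (simp add: b_def)
  define P where "P = tprod d N (\<lambda>l. if l \<le> k then mat_unit d (digit d k l j) (digit d k l i) else 1\<^sub>m d)"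
  have P: "P \<in> carrier_mat (d ^ N) (d ^ N)" by (simp add: P_def)
  have "kron (tprod d k (\<lambda>l. mat_unit d (digit d k l j) (digit d k l i))) (tprod d (N - k) (\<lambda>_. 1\<^sub>m d)) = P"
    unfolding kron_tprod[OF d] P_def using k by (simp add: if_distrib cong: if_cong)
  hence PK: "P = kron (mat_unit (d ^ k) j i) (1\<^sub>m b)"
    by (simp add: tprod_mat_unit[OF d ij] tprod_one[OF d] b_def)
  have "mtrace (P * \<rho>) = (\<Sum>p<d ^ N. \<Sum>q<d ^ N. P $$ (p, q) * \<rho> $$ (q, p))"
    by (rule mtrace_mult_sum[OF P \<rho>])
  also have "\<dots> = (\<Sum>p<d ^ k. \<Sum>r<b. \<Sum>q<d ^ k. \<Sum>s<b.
       (if p = j \<and> q = i then if r = s then \<rho> $$ (q * b + s, p * b + r) else 0 else 0))"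
    unfolding dN sum_lessThan_mult
    by (intro sum.cong refl) (auto simp: PK index_kron[OF mat_unit_carrier one_carrier_mat] pair_less, auto simp: mat_unit_def)
  also have "\<dots> = (\<Sum>p<d ^ k. \<Sum>r<b. if p = j then \<rho> $$ (i * b + r, p * b + r) else 0)"
  proof (intro sum.cong refl)
    fix p r assume "r \<in> {..<b}"
    hence "(\<Sum>q<d ^ k. \<Sum>s<b. (if p = j \<and> q = i then if r = s then \<rho> $$ (q * b + s, p * b + r) else 0 else 0))
       = (\<Sum>q<d ^ k. if q = i then if p = j then \<rho> $$ (i * b + r, p * b + r) else 0 else 0)"
      by (intro sum.cong refl) auto
    thus "(\<Sum>q<d ^ k. \<Sum>s<b. (if p = j \<and> q = i then if r = s then \<rho> $$ (q * b + s, p * b + r) else 0 else 0))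
       = (if p = j then \<rho> $$ (i * b + r, p * b + r) else 0)"
      using ij by simp
  qed
  also have "\<dots> = (\<Sum>r<b. \<rho> $$ (i * b + r, j * b + r))"
    by (subst sum.swap) (use ij in simp)
  also have "\<dots> = marginal d N k \<rho> $$ (i, j)"
    using ij by (simp add: marginal_def ptrace2_def b_def)
  finally show ?thesis by (simp add: P_def)
qed

lemma density_op_ptrace2:
  assumes \<rho>: "density_op (a * b) \<rho>" and b: "0 < b"
  shows "density_op a (ptrace2 a b \<rho>)"
proof -
  let ?R = "ptrace2 a b \<rho>"
  have c: "\<rho> \<in> carrier_mat (a * b) (a * b)" using \<rho> by (rule density_op_carrier)
  have R: "?R \<in> carrier_mat a a" by (simp add: ptrace2_def)
  have h: "\<rho> $$ (i, j) = cnj (\<rho> $$ (j, i))" if "i < a * b" "j < a * b" for i j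
    using \<rho> that unfolding density_op_def positive_op_def self_adjoint_iff by blast
  have "self_adjoint a ?R"
    unfolding self_adjoint_iff
  proof (intro conjI allI impI R)
    fix i j assume "i < a" "j < a"
    thus "?R $$ (i, j) = cnj (?R $$ (j, i))"
      by (simp add: ptrace2_def) (intro sum.cong refl h pair_less, auto)
  qed
  moreover have "0 \<le> Re ((?R *\<^sub>v v) \<bullet>c v)" if v: "v \<in> carrier_vec a" for v
  proof -
    \<comment> \<open>The vector \<open>v\<close> tensor the \<open>k\<close>-th basis vector: the
      quadratic form of the partial trace at \<open>v\<close> is the sum over \<open>k\<close> of
      the forms of \<open>\<rho>\<close> at \<open>w k\<close>, which gives positivity.\<close>
    define w where "w k = vec (a * b) (\<lambda>p. if p mod b = k then v $ (p div b) else 0)" for k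
    have w: "w k \<in> carrier_vec (a * b)" for k by (simp add: w_def)
    have q: "(\<rho> *\<^sub>v w k) \<bullet>c w k = (\<Sum>i<a. \<Sum>j<a. cnj (v $ i) * \<rho> $$ (i * b + k, j * b + k) * v $ j)" if k: "k < b" for k
    proof -
      have "(\<rho> *\<^sub>v w k) \<bullet>c w k = (\<Sum>i<a. \<Sum>r<b. \<Sum>j<a. \<Sum>s<b.
         (if r = k then if s = k then cnj (v $ i) * \<rho> $$ (i * b + r, j * b + s) * v $ j else 0 else 0))"
        unfolding inner_mult_mat_vec[OF c w] sum_lessThan_mult
        by (intro sum.cong refl) (simp add: w_def pair_less)
      also have "\<dots> = (\<Sum>i<a. \<Sum>r<b. if r = k then \<Sum>j<a. cnj (v $ i) * \<rho> $$ (i * b + k, j * b + k) * v $ j else 0)"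
        using k by (intro sum.cong refl) simp
      also have "\<dots> = (\<Sum>i<a. \<Sum>j<a. cnj (v $ i) * \<rho> $$ (i * b + k, j * b + k) * v $ j)"
        using k by simp
      finally show ?thesis .
    qed
    have "(?R *\<^sub>v v) \<bullet>c v = (\<Sum>i<a. \<Sum>j<a. \<Sum>k<b. cnj (v $ i) * \<rho> $$ (i * b + k, j * b + k) * v $ j)"
      unfolding inner_mult_mat_vec[OF R v]
      by (intro sum.cong refl) (simp add: ptrace2_def sum_distrib_left sum_distrib_right)
    also have "\<dots> = (\<Sum>k<b. (\<rho> *\<^sub>v w k) \<bullet>c w k)"
      by (subst sum_rotate3) (simp add: q)
    finally have "Re ((?R *\<^sub>v v) \<bullet>c v) = (\<Sum>k<b. Re ((\<rho> *\<^sub>v w k) \<bullet>c w k))" by (simp add: Re_sum)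
    also have "\<dots> \<ge> 0" using \<rho> w by (intro sum_nonneg) (auto simp: density_op_def positive_op_def)
    finally show ?thesis .
  qed
  moreover have "mtrace ?R = 1"
  proof -
    have "mtrace ?R = (\<Sum>i<a. \<Sum>k<b. \<rho> $$ (i * b + k, i * b + k))"
      by (simp add: mtrace_def ptrace2_def)
    also have "\<dots> = mtrace \<rho>" using c by (simp add: mtrace_def sum_lessThan_mult)
    finally show ?thesis using \<rho> by (simp add: density_op_def)
  qed
  ultimately show ?thesis by (simp add: density_op_def positive_op_def)
qed

lemma density_op_marginal:
  assumes "density_op (d ^ N) \<rho>" "k \<le> N" "0 < d"
  shows "density_op (d ^ k) (marginal d N k \<rho>)"
  unfolding marginal_def using assms by (intro density_op_ptrace2) (auto simp: power_add[symmetric])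

lemma marginal_tensor_power:
  assumes d: "0 < d" and X: "X \<in> carrier_mat d d" and tr: "mtrace X = 1" and k: "k \<le> N"
  shows "marginal d N k (tensor_power X N) = tensor_power X k"
proof -
  have "tensor_power X N = kron (tensor_power X k) (tensor_power X (N - k))"
    using k by (simp add: tensor_power_tprod[OF d X] kron_tprod[OF d])
  moreover have "mtrace (tensor_power X (N - k)) = 1"
    using X tr by (simp add: tensor_power_tprod[OF d X] mtrace_tprod)
  ultimately have "marginal d N k (tensor_power X N) = 1 \<cdot>\<^sub>m tensor_power X k"
    unfolding marginal_def using X
    by (simp add: ptrace2_kron[of _ "d ^ k" _ "d ^ (N - k)"] tensor_power_tprod[OF d X])
  also have "\<dots> = tensor_power X k" by (intro eq_matI) auto
  finally show ?thesis .
qed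

lemma tensor_power_spectral:
  assumes d: "0 < d" and U: "unitary_op d U"
  shows "unitary_op (d ^ N) (tprod d N (\<lambda>_. U))"
    and "tensor_power (spectral_decomp d U e) N =
      spectral_decomp (d ^ N) (tprod d N (\<lambda>_. U)) (\<lambda>i. \<Prod>l=1..N. e (digit d N l i))"
proof -
  have Uc: "U \<in> carrier_mat d d" "mat_adjoint U \<in> carrier_mat d d"
    and UU: "mat_adjoint U * U = 1\<^sub>m d" "U * mat_adjoint U = 1\<^sub>m d" using U by (auto simp: unitary_op_def)
  show "unitary_op (d ^ N) (tprod d N (\<lambda>_. U))"
    using Uc UU by (simp add: unitary_op_def tprod_adjoint[OF d] tprod_mult[OF d] tprod_one[OF d])
  have dc: "mat_diag d f \<in> carrier_mat d d" for f :: "nat \<Rightarrow> complex" by simp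
  have Sc: "spectral_decomp d U e \<in> carrier_mat d d" using Uc by simp
  have "tensor_power (spectral_decomp d U e) N =
     tprod d N (\<lambda>_. U) * tprod d N (\<lambda>_. mat_diag d (\<lambda>i. complex_of_real (e i))) * tprod d N (\<lambda>_. mat_adjoint U)"
    unfolding tensor_power_tprod[OF d Sc]
    using Uc dc by (simp only: tprod_mult[OF d] mult_carrier_mat_square spectral_decomp_def)
  thus "tensor_power (spectral_decomp d U e) N =
      spectral_decomp (d ^ N) (tprod d N (\<lambda>_. U)) (\<lambda>i. \<Prod>l=1..N. e (digit d N l i))"
    using Uc by (simp only: spectral_decomp_def tprod_adjoint[OF d] tprod_diag[OF d] of_real_prod)
qed

section \<open>The equations of motion of product observables\<close>

lemma mtrace_mult_comm_assoc:
  assumes "A \<in> carrier_mat n n" "B \<in> carrier_mat n n" "C \<in> carrier_mat n n"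
  shows "mtrace (A * (B * C)) = mtrace (C * A * B)"
  using assms mtrace_comm[of "A * B" n n C] by simp

lemma msum_carrier [simp]: "msum n F I \<in> carrier_mat n n"
  by (simp add: msum_def)

lemma mult_msum:
  assumes P: "P \<in> carrier_mat n n" and F: "\<And>q. q \<in> I \<Longrightarrow> F q \<in> carrier_mat n n"
  shows "P * msum n F I = msum n (\<lambda>q. P * F q) I"
proof (rule eq_matI)
  fix i j assume "i < dim_row (msum n (\<lambda>q. P * F q) I)" "j < dim_col (msum n (\<lambda>q. P * F q) I)"
  hence ij: "i < n" "j < n" by (auto simp: msum_def)
  have "(P * msum n F I) $$ (i, j) = (\<Sum>k<n. \<Sum>q\<in>I. P $$ (i, k) * F q $$ (k, j))"
    unfolding index_mult_mat_sum[OF P msum_carrier ij] using ij by (simp add: msum_def sum_distrib_left)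
  also have "\<dots> = (\<Sum>q\<in>I. (P * F q) $$ (i, j))"
    using index_mult_mat_sum[OF P F ij] by (subst sum.swap) simp
  finally show "(P * msum n F I) $$ (i, j) = msum n (\<lambda>q. P * F q) I $$ (i, j)"
    using ij by (simp add: msum_def)
qed (use P in \<open>auto simp: msum_def\<close>)

lemma msum_mult:
  assumes P: "P \<in> carrier_mat n n" and F: "\<And>q. q \<in> I \<Longrightarrow> F q \<in> carrier_mat n n"
  shows "msum n F I * P = msum n (\<lambda>q. F q * P) I"
proof (rule eq_matI)
  fix i j assume "i < dim_row (msum n (\<lambda>q. F q * P) I)" "j < dim_col (msum n (\<lambda>q. F q * P) I)"
  hence ij: "i < n" "j < n" by (auto simp: msum_def)
  have "(msum n F I * P) $$ (i, j) = (\<Sum>k<n. \<Sum>q\<in>I. F q $$ (i, k) * P $$ (k, j))"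
    unfolding index_mult_mat_sum[OF msum_carrier P ij] using ij by (simp add: msum_def sum_distrib_right)
  also have "\<dots> = (\<Sum>q\<in>I. (F q * P) $$ (i, j))"
    using index_mult_mat_sum[OF F P ij] by (subst sum.swap) simp
  finally show "(msum n F I * P) $$ (i, j) = msum n (\<lambda>q. F q * P) I $$ (i, j)"
    using ij by (simp add: msum_def)
qed (use P in \<open>auto simp: msum_def\<close>)

lemma mtrace_msum:
  assumes "\<And>q. q \<in> I \<Longrightarrow> F q \<in> carrier_mat n n"
  shows "mtrace (msum n F I) = (\<Sum>q\<in>I. mtrace (F q))"
proof -
  have "mtrace (msum n F I) = (\<Sum>q\<in>I. \<Sum>i<n. F q $$ (i, i))"
    unfolding mtrace_def by (subst sum.swap) (simp add: msum_def)
  also have "\<dots> = (\<Sum>q\<in>I. mtrace (F q))"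
  proof (intro sum.cong refl)
    fix q assume "q \<in> I"
    hence "dim_row (F q) = n" using assms by auto
    thus "(\<Sum>i<n. F q $$ (i, i)) = mtrace (F q)" by (simp add: mtrace_def)
  qed
  finally show ?thesis .
qed

lemma commut_carrier [simp]: "X \<in> carrier_mat n n \<Longrightarrow> Y \<in> carrier_mat n n \<Longrightarrow> commut X Y \<in> carrier_mat n n"
  by (simp add: commut_def minus_carrier_mat[of _ n n])

lemma anticommut_carrier [simp]: "X \<in> carrier_mat n n \<Longrightarrow> Y \<in> carrier_mat n n \<Longrightarrow> anticommut X Y \<in> carrier_mat n n"
  by (simp add: anticommut_def)

text \<open>The dissipator in the Heisenberg picture, that is, its adjoint for the trace
  pairing.\<close>

definition dissipator_dual :: "complex mat \<Rightarrow> complex mat \<Rightarrow> complex mat" where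
  "dissipator_dual L X = mat_adjoint L * X * L - (1/2) \<cdot>\<^sub>m anticommut (mat_adjoint L * L) X"

lemma dissipator_carrier [simp]: "L \<in> carrier_mat n n \<Longrightarrow> X \<in> carrier_mat n n \<Longrightarrow> dissipator L X \<in> carrier_mat n n"
  unfolding dissipator_def by (intro minus_carrier_mat) simp

lemma dissipator_dual_carrier [simp]: "L \<in> carrier_mat n n \<Longrightarrow> X \<in> carrier_mat n n \<Longrightarrow> dissipator_dual L X \<in> carrier_mat n n"
  unfolding dissipator_dual_def by (intro minus_carrier_mat) simp

lemma mtrace_commut_mult:
  assumes P: "P \<in> carrier_mat n n" and K: "K \<in> carrier_mat n n" and R: "R \<in> carrier_mat n n"
  shows "mtrace (commut P K * R) = mtrace (P * K * R) - mtrace (K * P * R)"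
proof -
  have "commut P K * R = P * K * R - K * P * R"
    unfolding commut_def using P K R by (intro minus_mult_distrib_mat[of _ n n _ _ n]) auto
  thus ?thesis using P K R by (simp only: mtrace_diff[of _ n] mult_carrier_mat_square)
qed

lemma mtrace_commut_msum:
  assumes P: "P \<in> carrier_mat n n" and R: "R \<in> carrier_mat n n"
    and F: "\<And>q. q \<in> I \<Longrightarrow> F q \<in> carrier_mat n n"
  shows "mtrace (commut P (msum n F I) * R) = (\<Sum>q\<in>I. mtrace (commut P (F q) * R))"
proof -
  have "mtrace (commut P (msum n F I) * R) = mtrace (P * msum n F I * R) - mtrace (msum n F I * P * R)"
    by (rule mtrace_commut_mult[OF P msum_carrier R])
  also have "P * msum n F I * R = msum n (\<lambda>q. P * F q * R) I"
    using P R F by (simp add: mult_msum[OF P F] msum_mult[OF R] del: assoc_mult_mat_square)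
  also have "mtrace \<dots> = (\<Sum>q\<in>I. mtrace (P * F q * R))"
    using P R F by (intro mtrace_msum) simp
  also have "msum n F I * P * R = msum n (\<lambda>q. F q * P * R) I"
    using P R F by (simp add: msum_mult[OF P F] msum_mult[OF R] del: assoc_mult_mat_square)
  also have "mtrace \<dots> = (\<Sum>q\<in>I. mtrace (F q * P * R))"
    using P R F by (intro mtrace_msum) simp
  also have "(\<Sum>q\<in>I. mtrace (P * F q * R)) - (\<Sum>q\<in>I. mtrace (F q * P * R)) = (\<Sum>q\<in>I. mtrace (commut P (F q) * R))"
    unfolding sum_subtractf[symmetric]
    using P R F by (intro sum.cong refl) (simp only: mtrace_commut_mult)
  finally show ?thesis .
qed

lemma add_diff_add_mat:
  fixes B :: "'a::ab_group_add mat"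
  assumes "B \<in> carrier_mat n m" "C \<in> carrier_mat n m" "D \<in> carrier_mat n m" "E \<in> carrier_mat n m"
  shows "B + C - (D + E) = (B - D) + (C - E)"
  using assms by (intro eq_matI) auto

lemma smult_diff_mat:
  fixes B :: "'a::ring mat"
  assumes "B \<in> carrier_mat n m" "C \<in> carrier_mat n m"
  shows "c \<cdot>\<^sub>m (B - C) = c \<cdot>\<^sub>m B - c \<cdot>\<^sub>m C"
  using assms by (intro eq_matI) (auto simp: right_diff_distrib)

lemma mtrace_mult_commut:
  assumes P: "P \<in> carrier_mat n n" and K: "K \<in> carrier_mat n n" and R: "R \<in> carrier_mat n n"
  shows "mtrace (P * commut K R) = mtrace (commut P K * R)"
proof -
  have "P * commut K R = P * (K * R) - P * (R * K)"
    unfolding commut_def using P K R by (intro mult_minus_distrib_mat) auto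
  moreover have "commut P K * R = P * K * R - K * P * R"
    unfolding commut_def using P K R by (intro minus_mult_distrib_mat) auto
  moreover have "mtrace (P * (R * K)) = mtrace (K * P * R)"
    by (rule mtrace_mult_comm_assoc[OF P R K])
  ultimately show ?thesis using P K R by (simp add: mtrace_diff[of _ n])
qed

lemma mtrace_mult_dissipator:
  assumes P: "P \<in> carrier_mat n n" and L: "L \<in> carrier_mat n n" and R: "R \<in> carrier_mat n n"
  shows "mtrace (P * dissipator L R) = mtrace (dissipator_dual L P * R)"
proof -
  define M where "M = mat_adjoint L"
  have M: "M \<in> carrier_mat n n" using L by (simp add: M_def)
  define K where "K = M * L"
  have K: "K \<in> carrier_mat n n" using L M by (simp add: K_def)
  have 1: "P * dissipator L R = P * (L * R * M) - P * ((1/2) \<cdot>\<^sub>m anticommut K R)"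
    unfolding dissipator_def M_def[symmetric] K_def[symmetric] using P L M K R
    by (intro mult_minus_distrib_mat) auto
  have 2: "P * ((1/2) \<cdot>\<^sub>m anticommut K R) = (1/2) \<cdot>\<^sub>m (P * (K * R) + P * (R * K))"
    unfolding anticommut_def using P K R
    by (simp add: mult_smult_distrib[of _ n n _ n] mult_add_distrib_mat[of _ n n _ n])
  have 3: "dissipator_dual L P * R = M * P * L * R - (1/2) \<cdot>\<^sub>m anticommut K P * R"
    unfolding dissipator_dual_def M_def[symmetric] K_def[symmetric] using P L M K R
    by (intro minus_mult_distrib_mat) auto
  have 4: "(1/2) \<cdot>\<^sub>m anticommut K P * R = (1/2) \<cdot>\<^sub>m (K * P * R + P * K * R)"
    unfolding anticommut_def using P K R
    by (simp add: mult_smult_assoc_mat[of _ n n _ n] add_mult_distrib_mat[of _ n n _ _ n])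
  have 5: "mtrace (P * (L * R * M)) = mtrace (M * P * L * R)"
    using mtrace_mult_comm_assoc[of P n "L * R" M] P L R M by (simp add: assoc_mult_mat[of _ n n _ n _ n])
  have 6: "mtrace (P * (R * K)) = mtrace (K * P * R)"
    by (rule mtrace_mult_comm_assoc[OF P R K])
  have "mtrace (P * dissipator L R) = mtrace (P * (L * R * M)) - 1/2 * (mtrace (P * (K * R)) + mtrace (P * (R * K)))"
    unfolding 1 2 using P L M K R by (simp add: mtrace_diff[of _ n] mtrace_smult[of _ n] mtrace_add[of _ n])
  moreover have "mtrace (dissipator_dual L P * R) = mtrace (M * P * L * R) - 1/2 * (mtrace (K * P * R) + mtrace (P * K * R))"
    unfolding 3 4 using P L M K R by (simp add: mtrace_diff[of _ n] mtrace_smult[of _ n] mtrace_add[of _ n])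
  moreover have "P * (K * R) = P * K * R" using P K R by simp
  ultimately show ?thesis using 5 6 by simp
qed

lemma mat_adjoint_one: "mat_adjoint (1\<^sub>m n :: complex mat) = 1\<^sub>m n"
  by (intro eq_matI) (auto simp: index_mat_adjoint[of _ n n])

lemma tprod_upd_add:
  assumes "l \<in> {1..N}" "Y \<in> carrier_mat d d" "Z \<in> carrier_mat d d" "0 < d"
  shows "tprod d N (X(l := Y + Z)) = tprod d N (X(l := Y)) + tprod d N (X(l := Z))"
  using assms by (intro eq_matI) (auto simp: index_tprod_upd digit_less distrib_right simp del: fun_upd_apply)

lemma tprod_upd_diff:
  assumes "l \<in> {1..N}" "Y \<in> carrier_mat d d" "Z \<in> carrier_mat d d" "0 < d"
  shows "tprod d N (X(l := Y - Z)) = tprod d N (X(l := Y)) - tprod d N (X(l := Z))"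
  using assms by (intro eq_matI) (auto simp: index_tprod_upd digit_less left_diff_distrib simp del: fun_upd_apply)

lemma tprod_upd_smult:
  assumes "l \<in> {1..N}" "Y \<in> carrier_mat d d" "0 < d"
  shows "tprod d N (X(l := c \<cdot>\<^sub>m Y)) = c \<cdot>\<^sub>m tprod d N (X(l := Y))"
  using assms by (intro eq_matI) (auto simp: index_tprod_upd digit_less simp del: fun_upd_apply)

lemma tprod_mult_upd:
  assumes d: "0 < d" and X: "\<And>r. r \<in> {1..N} \<Longrightarrow> X r \<in> carrier_mat d d" and V: "V \<in> carrier_mat d d"
  shows "tprod d N X * tprod d N ((\<lambda>_. 1\<^sub>m d)(l := V)) = tprod d N (X(l := X l * V))"
    and "tprod d N ((\<lambda>_. 1\<^sub>m d)(l := V)) * tprod d N X = tprod d N (X(l := V * X l))"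
  by (rule tprod_mult[OF d, THEN trans]; (rule tprod_cong)?; use X V in \<open>simp add: right_mult_one_mat[of _ d d] left_mult_one_mat[of _ d d]\<close>)+

lemma tprod_mult_upd2:
  assumes d: "0 < d" and X: "\<And>r. r \<in> {1..N} \<Longrightarrow> X r \<in> carrier_mat d d"
    and V: "V \<in> carrier_mat d d" "W \<in> carrier_mat d d" and l: "l \<noteq> l'"
  shows "tprod d N X * tprod d N ((\<lambda>_. 1\<^sub>m d)(l := V, l' := W)) = tprod d N (X(l := X l * V, l' := X l' * W))"
    and "tprod d N ((\<lambda>_. 1\<^sub>m d)(l := V, l' := W)) * tprod d N X = tprod d N (X(l := V * X l, l' := W * X l'))"
  by (rule tprod_mult[OF d, THEN trans]; (rule tprod_cong)?; use X V l in \<open>simp add: right_mult_one_mat[of _ d d] left_mult_one_mat[of _ d d]\<close>)+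

lemma commut_tprod:
  assumes d: "0 < d" and X: "\<And>r. r \<in> {1..N} \<Longrightarrow> X r \<in> carrier_mat d d" and V: "V \<in> carrier_mat d d"
    and l: "l \<in> {1..N}"
  shows "commut (tprod d N X) (one_body d N V l) = tprod d N (X(l := commut (X l) V))"
proof -
  have Xl: "X l \<in> carrier_mat d d" using X l by simp
  have "tprod d N X * tprod d N ((\<lambda>_. 1\<^sub>m d)(l := V)) = tprod d N (X(l := X l * V))"
    "tprod d N ((\<lambda>_. 1\<^sub>m d)(l := V)) * tprod d N X = tprod d N (X(l := V * X l))"
    by (rule tprod_mult_upd[OF d X V]; assumption)+
  thus ?thesis using Xl V l d unfolding commut_def one_body_tprod[OF d V l]
    by (simp add: tprod_upd_diff)
qed

text \<open>The adjoint of a one-body operator acts on the same site, so in every product the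
  factors at other sites are only multiplied by the identity.\<close>

lemma dissipator_dual_tprod:
  assumes d: "0 < d" and X: "\<And>r. r \<in> {1..N} \<Longrightarrow> X r \<in> carrier_mat d d" and L: "L \<in> carrier_mat d d"
    and l: "l \<in> {1..N}"
  shows "dissipator_dual (one_body d N L l) (tprod d N X) = tprod d N (X(l := dissipator_dual L (X l)))"
proof -
  let ?E = "\<lambda>Y. tprod d N ((\<lambda>_. 1\<^sub>m d)(l := Y))"
  define M where "M = mat_adjoint L"
  have M: "M \<in> carrier_mat d d" using L by (simp add: M_def)
  have Xl: "X l \<in> carrier_mat d d" using X l by simp
  have ad: "mat_adjoint (?E L) = ?E M"
    using L by (auto simp: tprod_adjoint[OF d] M_def mat_adjoint_one intro!: tprod_cong)
  have 1: "?E M * tprod d N X * ?E L = tprod d N (X(l := M * X l * L))"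
  proof -
    have "?E M * tprod d N X = tprod d N (X(l := M * X l))"
      by (rule tprod_mult_upd(2)[OF d X M])
    moreover have "tprod d N (X(l := M * X l)) * ?E L =
        tprod d N ((X(l := M * X l))(l := (X(l := M * X l)) l * L))"
      by (rule tprod_mult_upd(1)[OF d _ L]) (use X M in auto)
    ultimately show ?thesis by (simp only: fun_upd_same fun_upd_upd)
  qed
  have K: "?E M * ?E L = ?E (M * L)"
    using M L by (subst tprod_mult_upd(2)[OF d]) auto
  have LLc: "M * L \<in> carrier_mat d d" using M L by simp
  have 2: "anticommut (?E (M * L)) (tprod d N X) = tprod d N (X(l := anticommut (M * L) (X l)))"
  proof -
    have "tprod d N X * ?E (M * L) = tprod d N (X(l := X l * (M * L)))"
      "?E (M * L) * tprod d N X = tprod d N (X(l := (M * L) * X l))"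
      by (rule tprod_mult_upd[OF d X LLc]; assumption)+
    thus ?thesis unfolding anticommut_def using Xl LLc l d
      by (simp add: tprod_upd_add del: assoc_mult_mat_square assoc_mult_mat)
  qed
  show ?thesis
    unfolding dissipator_dual_def one_body_tprod[OF d L l] ad M_def[symmetric] K 1 2
    using Xl M L LLc l d by (simp add: tprod_upd_diff tprod_upd_smult del: assoc_mult_mat_square)
qed

section \<open>The generators in the Heisenberg picture, acting on product observables\<close>

definition prod_expect :: "nat \<Rightarrow> nat \<Rightarrow> complex mat \<Rightarrow> (nat \<Rightarrow> complex mat) \<Rightarrow> complex" where
  "prod_expect d N R X = mtrace (tprod d N X * R)"

text \<open>The expectation in the \<open>N\<close>-fold power of \<open>\<sigma>\<close>, already
  factorised so that it can be differentiated one factor at a time.\<close>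

definition indep_expect :: "nat \<Rightarrow> complex mat \<Rightarrow> (nat \<Rightarrow> complex mat) \<Rightarrow> complex" where
  "indep_expect N \<sigma> X = (\<Prod>l=1..N. mtrace (X l * \<sigma>))"

locale lindblad_model =
  fixes d :: nat and H A L :: "complex mat"
  assumes d: "0 < d" and H: "H \<in> carrier_mat d d" and A: "A \<in> carrier_mat (d * d) (d * d)"
    and A_flip: "flip_op d * A * flip_op d = A" and L: "L \<in> carrier_mat d d"
begin

text \<open>The one-site Heisenberg generator without interaction. Passing to the observable
  reverses the order in the commutator: the trace of \<open>X\<close> times
  \<open>commut H R\<close> is that of \<open>commut X H\<close> times \<open>R\<close>.\<close>

definition gen :: "complex mat \<Rightarrow> complex mat" where
  "gen X = (- \<i>) \<cdot>\<^sub>m commut X H + dissipator_dual L X"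

lemma gen_carrier [simp]: "X \<in> carrier_mat d d \<Longrightarrow> gen X \<in> carrier_mat d d"
  using H L by (simp add: gen_def)

definition pair_term :: "nat \<Rightarrow> complex mat \<Rightarrow> (nat \<Rightarrow> complex mat) \<Rightarrow> nat \<Rightarrow> nat \<Rightarrow> complex" where
  "pair_term N R X l l' = mtrace (commut (tprod d N X) (two_body d N A l l') * R)"

lemma two_body_carrier: "two_body d N A l l' \<in> carrier_mat (d ^ N) (d ^ N)"
  by (simp add: two_body_def)

lemma pair_term_sym: "pair_term N R X l l' = pair_term N R X l' l"
  unfolding pair_term_def two_body_commute[OF d A A_flip, of N l l'] ..

lemma pair_term_eq:
  assumes X_carrier: "\<forall>r\<in>{1..N}. X r \<in> carrier_mat d d" and R: "R \<in> carrier_mat (d ^ N) (d ^ N)"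
    and l: "l \<in> {1..N}" "l' \<in> {1..N}" "l \<noteq> l'"
  shows "pair_term N R X l l' = (\<Sum>(a, b)\<in>{..<d} \<times> {..<d}.
    prod_expect d N R (X(l := X l * mat_unit d a b, l' := X l' * mat_block d A a b)) -
    prod_expect d N R (X(l := mat_unit d a b * X l, l' := mat_block d A a b * X l')))"
proof -
  have X: "\<And>r. r \<in> {1..N} \<Longrightarrow> X r \<in> carrier_mat d d" using X_carrier by blast
  define F where "F = (\<lambda>(a, b). tprod d N ((\<lambda>_. 1\<^sub>m d)(l := mat_unit d a b, l' := mat_block d A a b)))"
  let ?n = "d ^ N" let ?Q = "{..<d} \<times> {..<d}" let ?P = "tprod d N X"
  have F: "F q \<in> carrier_mat ?n ?n" for q by (simp add: F_def split: prod.split)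
  have T: "two_body d N A l l' = msum ?n F ?Q"
    by (intro eq_matI)
      (auto simp: msum_def two_body_tprod[OF d l] sum.cartesian_product F_def two_body_def[of _ _ _ l l', THEN arg_cong[of _ _ dim_row]]
         two_body_def[of _ _ _ l l', THEN arg_cong[of _ _ dim_col]] split: prod.split intro!: sum.cong)
  have P: "?P \<in> carrier_mat ?n ?n" by simp
  have "pair_term N R X l l' = (\<Sum>q\<in>?Q. mtrace (?P * F q * R) - mtrace (F q * ?P * R))"
    unfolding pair_term_def T mtrace_commut_msum[OF P R F]
    by (intro sum.cong refl) (rule mtrace_commut_mult[OF P F R])
  also have "\<dots> = (\<Sum>(a, b)\<in>?Q. 
    prod_expect d N R (X(l := X l * mat_unit d a b, l' := X l' * mat_block d A a b)) -
    prod_expect d N R (X(l := mat_unit d a b * X l, l' := mat_block d A a b * X l')))"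
  proof (intro sum.cong refl, clarify)
    fix a b
    have "?P * F (a, b) = tprod d N (X(l := X l * mat_unit d a b, l' := X l' * mat_block d A a b))"
      "F (a, b) * ?P = tprod d N (X(l := mat_unit d a b * X l, l' := mat_block d A a b * X l'))"
      unfolding F_def prod.case
      by (rule tprod_mult_upd2[OF d X mat_unit_carrier mat_block_carrier l(3)]; assumption)+
    thus "mtrace (?P * F (a, b) * R) - mtrace (F (a, b) * ?P * R) =
      prod_expect d N R (X(l := X l * mat_unit d a b, l' := X l' * mat_block d A a b)) -
      prod_expect d N R (X(l := mat_unit d a b * X l, l' := mat_block d A a b * X l'))"
      by (simp only: prod_expect_def)
  qed
  finally show ?thesis .
qed

text \<open>Cyclicity moves the generator from the state to the observable. Hamiltonian and
  dissipator at site \<open>l\<close> then change only the factor \<open>X l\<close>, and the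
  interaction is kept as a sum of pair terms.\<close>

lemma mtrace_nbody_lindblad:
  assumes X_carrier: "\<forall>r\<in>{1..N}. X r \<in> carrier_mat d d" and R: "R \<in> carrier_mat (d ^ N) (d ^ N)"
  shows "mtrace (tprod d N X * nbody_lindblad d H A L N R) =
    (\<Sum>l=1..N. prod_expect d N R (X(l := gen (X l)))) +
    (- \<i> / of_nat N) * (\<Sum>(l, l')\<in>{(l, l'). 1 \<le> l \<and> l < l' \<and> l' \<le> N}. pair_term N R X l l')"
proof -
  have X: "\<And>r. r \<in> {1..N} \<Longrightarrow> X r \<in> carrier_mat d d" using X_carrier by blast
  let ?n = "d ^ N" let ?P = "tprod d N X" let ?I = "{(l, l'). 1 \<le> l \<and> l < l' \<and> l' \<le> N}"
  define Q where "Q = (\<lambda>(l, l'). two_body d N A l l')"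
  have P: "?P \<in> carrier_mat ?n ?n" by simp
  have Hl: "one_body d N H l \<in> carrier_mat ?n ?n" "one_body d N L l \<in> carrier_mat ?n ?n" if "l \<in> {1..N}" for l
    using one_body_tprod[OF d H that] one_body_tprod[OF d L that] by simp_all
  have Ql: "Q q \<in> carrier_mat ?n ?n" for q by (simp add: Q_def two_body_carrier split: prod.split)
  have cH: "commut ?P (one_body d N H l) = tprod d N (X(l := commut (X l) H))" if "l \<in> {1..N}" for l
    by (rule commut_tprod[OF d X H that])
  have cL: "dissipator_dual (one_body d N L l) ?P = tprod d N (X(l := dissipator_dual L (X l)))" if "l \<in> {1..N}" for l
    by (rule dissipator_dual_tprod[OF d X L that])
  define S1 where "S1 = msum ?n (one_body d N H) {1..N}"
  define S2 where "S2 = msum ?n Q ?I"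
  have S: "S1 \<in> carrier_mat ?n ?n" "S2 \<in> carrier_mat ?n ?n" by (simp_all add: S1_def S2_def)
  have HN: "nbody_hamiltonian d H A N = S1 + (1 / of_nat N) \<cdot>\<^sub>m S2"
    by (simp add: nbody_hamiltonian_def S1_def S2_def Q_def)
  have comm_lin: "commut ?P (S1 + c \<cdot>\<^sub>m S2) * R = commut ?P S1 * R + c \<cdot>\<^sub>m (commut ?P S2 * R)" for c
  proof -
    have "commut ?P (S1 + c \<cdot>\<^sub>m S2) = commut ?P S1 + c \<cdot>\<^sub>m commut ?P S2"
    proof -
      have "?P * (S1 + c \<cdot>\<^sub>m S2) = ?P * S1 + c \<cdot>\<^sub>m (?P * S2)"
        using P S by (simp add: mult_add_distrib_mat[of _ ?n ?n _ ?n] mult_smult_distrib[of _ ?n ?n _ ?n])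
      moreover have "(S1 + c \<cdot>\<^sub>m S2) * ?P = S1 * ?P + c \<cdot>\<^sub>m (S2 * ?P)"
        using P S by (simp add: add_mult_distrib_mat[of _ ?n ?n _ _ ?n] mult_smult_assoc_mat[of _ ?n ?n _ ?n])
      moreover have "?P * S1 + c \<cdot>\<^sub>m (?P * S2) - (S1 * ?P + c \<cdot>\<^sub>m (S2 * ?P)) = 
          (?P * S1 - S1 * ?P) + c \<cdot>\<^sub>m (?P * S2 - S2 * ?P)"
      proof -
        have "c \<cdot>\<^sub>m (?P * S2) - c \<cdot>\<^sub>m (S2 * ?P) = c \<cdot>\<^sub>m (?P * S2 - S2 * ?P)"
          by (intro smult_diff_mat[of _ ?n ?n, symmetric]) (use P S in simp_all)
        moreover have "?P * S1 + c \<cdot>\<^sub>m (?P * S2) - (S1 * ?P + c \<cdot>\<^sub>m (S2 * ?P)) = 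
            (?P * S1 - S1 * ?P) + (c \<cdot>\<^sub>m (?P * S2) - c \<cdot>\<^sub>m (S2 * ?P))"
          by (rule add_diff_add_mat[of _ ?n ?n]) (use P S in simp_all)
        ultimately show ?thesis by simp
      qed
      ultimately show ?thesis by (simp only: commut_def)
    qed
    thus ?thesis using P S R
      by (simp add: add_mult_distrib_mat[of _ ?n ?n _ _ ?n] mult_smult_assoc_mat[of _ ?n ?n _ ?n])
  qed
  let ?K = "nbody_hamiltonian d H A N"
  have K: "?K \<in> carrier_mat ?n ?n" unfolding HN using S by simp
  have "mtrace (commut ?P ?K * R) = mtrace (commut ?P S1 * R) + (1 / of_nat N) * mtrace (commut ?P S2 * R)"
    unfolding HN comm_lin using P S R by (simp add: mtrace_add[of _ ?n] mtrace_smult[of _ ?n])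
  also have "mtrace (commut ?P S1 * R) = (\<Sum>l=1..N. prod_expect d N R (X(l := commut (X l) H)))"
    unfolding S1_def by (subst mtrace_commut_msum[OF P R]) (auto simp: Hl cH prod_expect_def intro!: sum.cong)
  also have "mtrace (commut ?P S2 * R) = (\<Sum>(l, l')\<in>?I. pair_term N R X l l')"
    unfolding S2_def by (subst mtrace_commut_msum[OF P R]) (auto simp: Ql[unfolded Q_def] Q_def pair_term_def two_body_carrier intro!: sum.cong)
  finally have ham: "mtrace (commut ?P ?K * R) = (\<Sum>l=1..N. prod_expect d N R (X(l := commut (X l) H))) +
      (1 / of_nat N) * (\<Sum>(l, l')\<in>?I. pair_term N R X l l')" .
  have "mtrace (?P * msum ?n (\<lambda>l. dissipator (one_body d N L l) R) {1..N}) =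
      (\<Sum>l=1..N. mtrace (?P * dissipator (one_body d N L l) R))"
    using Hl(2) R P by (subst mult_msum[OF P]) (auto intro!: mtrace_msum)
  also have "\<dots> = (\<Sum>l=1..N. prod_expect d N R (X(l := dissipator_dual L (X l))))"
    by (intro sum.cong refl) (simp add: mtrace_mult_dissipator[OF P Hl(2) R] cL prod_expect_def)
  finally have dis: "mtrace (?P * msum ?n (\<lambda>l. dissipator (one_body d N L l) R) {1..N}) =
      (\<Sum>l=1..N. prod_expect d N R (X(l := dissipator_dual L (X l))))" .
  have "?P * nbody_lindblad d H A L N R = (- \<i>) \<cdot>\<^sub>m (?P * commut ?K R) + ?P * msum ?n (\<lambda>l. dissipator (one_body d N L l) R) {1..N}"
    unfolding nbody_lindblad_def using P K R
    by (simp add: mult_add_distrib_mat[of _ ?n ?n _ ?n] mult_smult_distrib[of _ ?n ?n _ ?n])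
  hence "mtrace (?P * nbody_lindblad d H A L N R) = - \<i> * mtrace (commut ?P ?K * R) +
      mtrace (?P * msum ?n (\<lambda>l. dissipator (one_body d N L l) R) {1..N})"
    using P K R by (simp add: mtrace_add[of _ ?n] mtrace_smult[of _ ?n] mtrace_mult_commut[OF P K R])
  also have "\<dots> = (\<Sum>l=1..N. - \<i> * prod_expect d N R (X(l := commut (X l) H)) + prod_expect d N R (X(l := dissipator_dual L (X l)))) +
    (- \<i> / of_nat N) * (\<Sum>(l, l')\<in>?I. pair_term N R X l l')"
    unfolding ham dis sum.distrib sum_distrib_left[symmetric] by (simp add: distrib_left)
  also have "(\<Sum>l=1..N. - \<i> * prod_expect d N R (X(l := commut (X l) H)) + prod_expect d N R (X(l := dissipator_dual L (X l)))) =
     (\<Sum>l=1..N. prod_expect d N R (X(l := gen (X l))))"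
  proof (intro sum.cong refl)
    fix l assume l: "l \<in> {1..N}"
    have Xl: "X l \<in> carrier_mat d d" using X l by simp
    have c: "commut (X l) H \<in> carrier_mat d d" "dissipator_dual L (X l) \<in> carrier_mat d d" using Xl H L by simp_all
    have "tprod d N (X(l := gen (X l))) = (- \<i>) \<cdot>\<^sub>m tprod d N (X(l := commut (X l) H)) + tprod d N (X(l := dissipator_dual L (X l)))"
      unfolding gen_def using l c d by (simp add: tprod_upd_add tprod_upd_smult)
    thus "- \<i> * prod_expect d N R (X(l := commut (X l) H)) + prod_expect d N R (X(l := dissipator_dual L (X l))) =
       prod_expect d N R (X(l := gen (X l)))"
      unfolding prod_expect_def using R
      by (simp add: add_mult_distrib_mat[of _ ?n ?n _ _ ?n] mult_smult_assoc_mat[of _ ?n ?n _ ?n] mtrace_add[of _ ?n] mtrace_smult[of _ ?n] del: fun_upd_apply)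
  qed
  finally show ?thesis .
qed

text \<open>Tracing out the second factor replaces each block of \<open>A\<close> by its expectation
  in \<open>\<sigma>\<close>, so the mean field is the matrix of these expectations.\<close>

lemma index_mean_field:
  assumes \<sigma>: "\<sigma> \<in> carrier_mat d d" and xy: "x < d" "y < d"
  shows "mean_field d A \<sigma> $$ (x, y) = mtrace (mat_block d A x y * \<sigma>)"
proof -
  let ?K = "kron (1\<^sub>m d) \<sigma>"
  have K: "?K \<in> carrier_mat (d * d) (d * d)" using \<sigma> by (intro kron_carrier) auto
  have "mean_field d A \<sigma> $$ (x, y) = (\<Sum>k<d. (?K * A) $$ (x * d + k, y * d + k))"
    using xy by (simp add: mean_field_def ptrace2_def)
  also have "\<dots> = (\<Sum>k<d. \<Sum>v<d. mat_block d A x y $$ (v, k) * \<sigma> $$ (k, v))"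
  proof (intro sum.cong refl)
    fix k assume "k \<in> {..<d}"
    hence k: "k < d" by simp
    have "(?K * A) $$ (x * d + k, y * d + k) = (\<Sum>u<d. \<Sum>v<d. ?K $$ (x * d + k, u * d + v) * A $$ (u * d + v, y * d + k))"
      unfolding index_mult_mat_sum[OF K A pair_less[OF xy(1) k] pair_less[OF xy(2) k]] sum_lessThan_mult ..
    also have "\<dots> = (\<Sum>u<d. \<Sum>v<d. if u = x then \<sigma> $$ (k, v) * A $$ (u * d + v, y * d + k) else 0)"
      using xy k by (intro sum.cong refl) (auto simp: index_kron[OF one_carrier_mat \<sigma>] pair_less)
    also have "\<dots> = (\<Sum>v<d. \<Sum>u<d. if u = x then \<sigma> $$ (k, v) * A $$ (u * d + v, y * d + k) else 0)"
      by (rule sum.swap)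
    also have "\<dots> = (\<Sum>v<d. mat_block d A x y $$ (v, k) * \<sigma> $$ (k, v))"
      using xy k by (simp add: mat_block_def mult.commute)
    finally show "(?K * A) $$ (x * d + k, y * d + k) = (\<Sum>v<d. mat_block d A x y $$ (v, k) * \<sigma> $$ (k, v))" .
  qed
  also have "\<dots> = mtrace (mat_block d A x y * \<sigma>)"
  proof -
    have "(\<Sum>k<d. \<Sum>v<d. mat_block d A x y $$ (v, k) * \<sigma> $$ (k, v)) = (\<Sum>v<d. (mat_block d A x y * \<sigma>) $$ (v, v))"
      by (subst sum.swap) (simp add: index_mult_mat_sum[OF mat_block_carrier \<sigma>] del: index_mult_mat(1))
    thus ?thesis by (simp add: mtrace_def mat_block_def)
  qed
  finally show ?thesis .
qed

lemma mean_field_carrier [simp]: "mean_field d A \<sigma> \<in> carrier_mat d d"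
  by (simp add: mean_field_def ptrace2_def)

text \<open>The mean field is expanded in the same matrix units as the two-body interaction, so that
  the two equations of motion can later be compared term by term.\<close>

lemma mtrace_mean_field_lindblad:
  assumes X: "X \<in> carrier_mat d d" and \<sigma>: "\<sigma> \<in> carrier_mat d d"
  shows "mtrace (X * mean_field_lindblad d H A L \<sigma>) = mtrace (gen X * \<sigma>) +
    (- \<i>) * (\<Sum>(a, b)\<in>{..<d} \<times> {..<d}. mtrace (mat_block d A a b * \<sigma>) * mtrace (commut X (mat_unit d a b) * \<sigma>))"
proof -
  let ?M = "mean_field d A \<sigma>"
  let ?Q = "{..<d} \<times> {..<d}"
  define F where "F = (\<lambda>(a, b). mtrace (mat_block d A a b * \<sigma>) \<cdot>\<^sub>m mat_unit d a b)"
  have F: "F q \<in> carrier_mat d d" for q by (simp add: F_def split: prod.split)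
  have M: "?M = msum d F ?Q"
  proof (rule eq_matI)
    fix x y assume "x < dim_row (msum d F ?Q)" "y < dim_col (msum d F ?Q)"
    hence xy: "x < d" "y < d" by (auto simp: msum_def)
    have "msum d F ?Q $$ (x, y) = (\<Sum>a<d. \<Sum>b<d. mat_unit d a b $$ (x, y) * mtrace (mat_block d A a b * \<sigma>))"
      using xy carrier_matD[OF mat_unit_carrier]
      by (auto simp: msum_def F_def sum.cartesian_product split: prod.split intro!: sum.cong)
    also have "\<dots> = ?M $$ (x, y)" using sum_mat_unit[OF xy] index_mean_field[OF \<sigma> xy] by simp
    finally show "?M $$ (x, y) = msum d F ?Q $$ (x, y)" ..
  qed (auto simp: msum_def mean_field_def ptrace2_def)
  have "mtrace (commut X ?M * \<sigma>) = (\<Sum>q\<in>?Q. mtrace (X * F q * \<sigma>) - mtrace (F q * X * \<sigma>))"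
    unfolding M mtrace_commut_msum[OF X \<sigma> F]
    by (intro sum.cong refl) (rule mtrace_commut_mult[OF X F \<sigma>])
  also have "\<dots> = (\<Sum>(a, b)\<in>?Q. mtrace (mat_block d A a b * \<sigma>) * mtrace (commut X (mat_unit d a b) * \<sigma>))"
  proof (intro sum.cong refl, clarify)
    fix a b
    let ?E = "mat_unit d a b" let ?c = "mtrace (mat_block d A a b * \<sigma>)"
    have "mtrace (commut X ?E * \<sigma>) = mtrace (X * ?E * \<sigma>) - mtrace (?E * X * \<sigma>)"
      by (rule mtrace_commut_mult[OF X mat_unit_carrier \<sigma>])
    moreover have "X * F (a, b) * \<sigma> = ?c \<cdot>\<^sub>m (X * ?E * \<sigma>)" "F (a, b) * X * \<sigma> = ?c \<cdot>\<^sub>m (?E * X * \<sigma>)"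
      unfolding F_def using X \<sigma> by (simp_all add: mult_smult_distrib[of _ d d _ d] mult_smult_assoc_mat[of _ d d _ d])
    ultimately show "mtrace (X * F (a, b) * \<sigma>) - mtrace (F (a, b) * X * \<sigma>) = ?c * mtrace (commut X ?E * \<sigma>)"
      using X \<sigma> by (simp add: mtrace_smult[of _ d] right_diff_distrib del: assoc_mult_mat_square)
  qed
  finally have mf: "mtrace (commut X ?M * \<sigma>) = (\<Sum>(a, b)\<in>?Q. mtrace (mat_block d A a b * \<sigma>) * mtrace (commut X (mat_unit d a b) * \<sigma>))" .
  have HM: "H + ?M \<in> carrier_mat d d" using H by simp
  have "commut X (H + ?M) = commut X H + commut X ?M"
  proof -
    have "X * (H + ?M) = X * H + X * ?M" "(H + ?M) * X = H * X + ?M * X"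
      using X H by (simp_all add: mult_add_distrib_mat[of _ d d _ d] add_mult_distrib_mat[of _ d d _ _ d])
    moreover have "X * H + X * ?M - (H * X + ?M * X) = (X * H - H * X) + (X * ?M - ?M * X)"
      by (rule add_diff_add_mat[of _ d d]) (use X H in auto)
    ultimately show ?thesis by (simp only: commut_def)
  qed
  hence hm: "mtrace (commut X (H + ?M) * \<sigma>) = mtrace (commut X H * \<sigma>) + mtrace (commut X ?M * \<sigma>)"
    using X H \<sigma> by (simp add: add_mult_distrib_mat[of _ d d _ _ d] mtrace_add[of _ d])
  have "X * mean_field_lindblad d H A L \<sigma> = (- \<i>) \<cdot>\<^sub>m (X * commut (H + ?M) \<sigma>) + X * dissipator L \<sigma>"
    unfolding mean_field_lindblad_def using X HM \<sigma> L
    by (simp add: mult_add_distrib_mat[of _ d d _ d] mult_smult_distrib[of _ d d _ d])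
  hence "mtrace (X * mean_field_lindblad d H A L \<sigma>) = - \<i> * mtrace (commut X (H + ?M) * \<sigma>) + mtrace (dissipator_dual L X * \<sigma>)"
    using X HM \<sigma> L by (simp add: mtrace_add[of _ d] mtrace_smult[of _ d] mtrace_mult_commut[OF X HM \<sigma>] mtrace_mult_dissipator[OF X L \<sigma>])
  moreover have "mtrace (gen X * \<sigma>) = - \<i> * mtrace (commut X H * \<sigma>) + mtrace (dissipator_dual L X * \<sigma>)"
    unfolding gen_def using X H \<sigma> L
    by (simp add: add_mult_distrib_mat[of _ d d _ _ d] mult_smult_assoc_mat[of _ d d _ d] mtrace_add[of _ d] mtrace_smult[of _ d])
  ultimately show ?thesis unfolding hm mf by (simp only: distrib_left ac_simps)
qed

end

section \<open>Defects of product observables and their time derivative\<close>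

text \<open>To be used with \<open>S\<close> the set of sites where an observable is not the
  identity. A mixed pair is listed once, with its member of \<open>S\<close> first; a pair inside
  \<open>S\<close> appears in both orders, hence the division by two.\<close>

lemma sum_pairs_symmetric:
  fixes p :: "'a::linorder \<Rightarrow> 'a \<Rightarrow> complex"
  assumes U: "finite U" and S: "S \<subseteq> U" and sym: "\<And>l l'. p l l' = p l' l"
    and 0: "\<And>l l'. l \<in> U - S \<Longrightarrow> l' \<in> U - S \<Longrightarrow> l \<noteq> l' \<Longrightarrow> p l l' = 0"
  shows "(\<Sum>(l, l')\<in>{(l, l'). l \<in> U \<and> l' \<in> U \<and> l < l'}. p l l') =
    (\<Sum>l\<in>S. \<Sum>l'\<in>U - S. p l l') + (\<Sum>l\<in>S. \<Sum>l'\<in>S - {l}. p l l') / 2"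
proof -
  let ?L = "{(l, l'). l \<in> U \<and> l' \<in> U \<and> l < l'}" and ?G = "{(l, l'). l \<in> U \<and> l' \<in> U \<and> l' < l}"
  have fin: "finite ?L" "finite ?G" and finS: "finite S"
    using U S by (auto intro: finite_subset[of _ "U \<times> U"] finite_subset)
  have "(\<Sum>(l, l')\<in>?G. p l l') = (\<Sum>(l, l')\<in>?L. p l l')"
    by (rule sum.reindex_bij_witness[of _ "\<lambda>(l, l'). (l', l)" "\<lambda>(l, l'). (l', l)"]) (auto intro: sym)
  hence "2 * (\<Sum>(l, l')\<in>?L. p l l') = (\<Sum>(l, l')\<in>?L. p l l') + (\<Sum>(l, l')\<in>?G. p l l')" by simp
  also have "\<dots> = (\<Sum>(l, l')\<in>?L \<union> ?G. p l l')"
    using fin by (intro sum.union_disjoint[symmetric]) auto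
  also have "?L \<union> ?G = (SIGMA l:U. U - {l})" by auto
  also have "(\<Sum>(l, l')\<in>(SIGMA l:U. U - {l}). p l l') = (\<Sum>l\<in>U. \<Sum>l'\<in>U - {l}. p l l')"
    using U by (intro sum.Sigma[symmetric]) auto
  also have "\<dots> = (\<Sum>l\<in>U - S. \<Sum>l'\<in>U - {l}. p l l') + (\<Sum>l\<in>S. \<Sum>l'\<in>U - {l}. p l l')"
    using U S by (intro sum.subset_diff)
  also have "(\<Sum>l\<in>S. \<Sum>l'\<in>U - {l}. p l l') = (\<Sum>l\<in>S. (\<Sum>l'\<in>U - S. p l l') + (\<Sum>l'\<in>S - {l}. p l l'))"
  proof (intro sum.cong refl)
    fix l assume l: "l \<in> S"
    hence "U - {l} = (U - S) \<union> (S - {l})" using S by auto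
    moreover have "sum (p l) ((U - S) \<union> (S - {l})) = (\<Sum>l'\<in>U - S. p l l') + (\<Sum>l'\<in>S - {l}. p l l')"
      using U finS by (intro sum.union_disjoint) auto
    ultimately show "(\<Sum>l'\<in>U - {l}. p l l') = (\<Sum>l'\<in>U - S. p l l') + (\<Sum>l'\<in>S - {l}. p l l')" by simp
  qed
  also have "(\<Sum>l\<in>U - S. \<Sum>l'\<in>U - {l}. p l l') = (\<Sum>l\<in>U - S. \<Sum>l'\<in>S. p l l')"
    using U S 0 by (intro sum.cong refl sum.mono_neutral_right) auto
  also have "\<dots> = (\<Sum>l\<in>S. \<Sum>l'\<in>U - S. p l l')"
    by (subst sum.swap) (intro sum.cong refl sym)
  finally have "2 * (\<Sum>(l, l')\<in>?L. p l l') = 2 * (\<Sum>l\<in>S. \<Sum>l'\<in>U - S. p l l') + (\<Sum>l\<in>S. \<Sum>l'\<in>S - {l}. p l l')"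
    by (simp add: sum.distrib)
  thus ?thesis by (simp add: field_simps)
qed

lemma indep_expect_upd:
  assumes "l \<in> {1..N}"
  shows "indep_expect N \<sigma> (X(l := Y)) = mtrace (Y * \<sigma>) * (\<Prod>r\<in>{1..N} - {l}. mtrace (X r * \<sigma>))"
proof -
  have "indep_expect N \<sigma> (X(l := Y)) = mtrace ((X(l := Y)) l * \<sigma>) * (\<Prod>r\<in>{1..N} - {l}. mtrace ((X(l := Y)) r * \<sigma>))"
    unfolding indep_expect_def using assms by (intro prod.remove) auto
  also have "(\<Prod>r\<in>{1..N} - {l}. mtrace ((X(l := Y)) r * \<sigma>)) = (\<Prod>r\<in>{1..N} - {l}. mtrace (X r * \<sigma>))"
    by (intro prod.cong) auto
  finally show ?thesis by (simp only: fun_upd_same)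
qed

lemma prod_expect_upd_diff:
  assumes "l \<in> {1..N}" "Y \<in> carrier_mat d d" "Z \<in> carrier_mat d d" "0 < d" "R \<in> carrier_mat (d ^ N) (d ^ N)"
  shows "prod_expect d N R (X(l := Y - Z)) = prod_expect d N R (X(l := Y)) - prod_expect d N R (X(l := Z))"
  using assms unfolding prod_expect_def
  by (simp add: tprod_upd_diff minus_mult_distrib_mat[of _ "d ^ N" "d ^ N" _ _ "d ^ N"] mtrace_diff[of _ "d ^ N"] del: fun_upd_apply)

lemma prod_expect_upd_smult:
  assumes "l \<in> {1..N}" "Y \<in> carrier_mat d d" "0 < d" "R \<in> carrier_mat (d ^ N) (d ^ N)"
  shows "prod_expect d N R (X(l := c \<cdot>\<^sub>m Y)) = c * prod_expect d N R (X(l := Y))"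
  using assms unfolding prod_expect_def
  by (simp add: tprod_upd_smult mult_smult_assoc_mat[of _ "d ^ N" "d ^ N" _ "d ^ N"] mtrace_smult[of _ "d ^ N"] del: fun_upd_apply)

lemma indep_expect_upd_smult:
  assumes "l \<in> {1..N}" "Y \<in> carrier_mat d d" "\<sigma> \<in> carrier_mat d d"
  shows "indep_expect N \<sigma> (X(l := c \<cdot>\<^sub>m Y)) = c * indep_expect N \<sigma> (X(l := Y))"
  using assms by (simp add: indep_expect_upd mult_smult_assoc_mat[of _ d d _ d] mtrace_smult[of _ d])

text \<open>Homogeneity: a bound on the unit ball scales with the radius. This brings generators and
  blocks, which leave the unit ball, back to admissible observables.\<close>

lemma schur_bounded_scale:
  fixes \<Phi> :: "complex mat \<Rightarrow> complex"
  assumes lin: "\<And>c Y. Y \<in> carrier_mat n n \<Longrightarrow> \<Phi> (c \<cdot>\<^sub>m Y) = c * \<Phi> Y"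
    and bnd: "\<And>Y. schur_bounded n 1 Y \<Longrightarrow> cmod (\<Phi> Y) \<le> B"
    and Z: "schur_bounded n r Z" and r: "0 < r"
  shows "cmod (\<Phi> Z) \<le> r * B"
proof -
  define Y where "Y = complex_of_real (1 / r) \<cdot>\<^sub>m Z"
  have Zc: "Z \<in> carrier_mat n n" using Z by (rule schur_bounded_carrier)
  have "schur_bounded n (cmod (complex_of_real (1 / r)) * r) Y"
    unfolding Y_def by (rule schur_bounded_smult[OF Z])
  hence Y: "schur_bounded n 1 Y" using r by (simp add: norm_divide)
  have "Z = complex_of_real r \<cdot>\<^sub>m Y"
    unfolding Y_def using Zc r by (intro eq_matI) auto
  hence "\<Phi> Z = complex_of_real r * \<Phi> Y" using lin[OF schur_bounded_carrier[OF Y]] by simp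
  thus ?thesis using bnd[OF Y] r by (simp add: norm_mult)
qed

context lindblad_model
begin

text \<open>The sites of the nontrivial factors are not prescribed, so an observable coupled to any
  further site stays within the same family with \<open>k\<close> raised by one.\<close>

definition admissible :: "nat \<Rightarrow> nat \<Rightarrow> (nat \<Rightarrow> complex mat) set" where
  "admissible N k = {X. (\<forall>l\<in>{1..N}. schur_bounded d 1 (X l)) \<and> card {l\<in>{1..N}. X l \<noteq> 1\<^sub>m d} \<le> k}"

definition defect :: "nat \<Rightarrow> complex mat \<Rightarrow> complex mat \<Rightarrow> (nat \<Rightarrow> complex mat) \<Rightarrow> complex" where
  "defect N R \<sigma> X = prod_expect d N R X - indep_expect N \<sigma> X"

text \<open>Up to the factor \<open>- \<i>\<close>, what the mean field at site \<open>l\<close>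
  contributes to the derivative of \<open>indep_expect\<close>.\<close>

definition mean_term :: "nat \<Rightarrow> complex mat \<Rightarrow> (nat \<Rightarrow> complex mat) \<Rightarrow> nat \<Rightarrow> complex" where
  "mean_term N \<sigma> X l = (\<Sum>(a, b)\<in>{..<d} \<times> {..<d}.
     mtrace (mat_block d A a b * \<sigma>) * indep_expect N \<sigma> (X(l := commut (X l) (mat_unit d a b))))"

text \<open>The time derivative of \<open>defect\<close> when \<open>R\<close> and
  \<open>\<sigma>\<close> follow their respective equations; the second sum is the product rule for
  \<open>indep_expect\<close>.\<close>

definition defect_deriv :: "nat \<Rightarrow> complex mat \<Rightarrow> complex mat \<Rightarrow> (nat \<Rightarrow> complex mat) \<Rightarrow> complex" where
  "defect_deriv N R \<sigma> X = mtrace (tprod d N X * nbody_lindblad d H A L N R) -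
     (\<Sum>l=1..N. mtrace (X l * mean_field_lindblad d H A L \<sigma>) * (\<Prod>r\<in>{1..N} - {l}. mtrace (X r * \<sigma>)))"

lemma indep_expect_deriv:
  assumes X_carrier: "\<forall>r\<in>{1..N}. X r \<in> carrier_mat d d" and \<sigma>: "\<sigma> \<in> carrier_mat d d"
  shows "(\<Sum>l=1..N. mtrace (X l * mean_field_lindblad d H A L \<sigma>) * (\<Prod>r\<in>{1..N} - {l}. mtrace (X r * \<sigma>))) =
    (\<Sum>l=1..N. indep_expect N \<sigma> (X(l := gen (X l))) - \<i> * mean_term N \<sigma> X l)"
proof (intro sum.cong refl)
  have X: "\<And>r. r \<in> {1..N} \<Longrightarrow> X r \<in> carrier_mat d d" using X_carrier by blast
  fix l assume l: "l \<in> {1..N}"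
  show "mtrace (X l * mean_field_lindblad d H A L \<sigma>) * (\<Prod>r\<in>{1..N} - {l}. mtrace (X r * \<sigma>)) =
     indep_expect N \<sigma> (X(l := gen (X l))) - \<i> * mean_term N \<sigma> X l"
    unfolding mtrace_mean_field_lindblad[OF X[OF l] \<sigma>] mean_term_def indep_expect_upd[OF l]
    by (simp add: left_diff_distrib sum_distrib_right split_def mult.assoc)
qed

text \<open>The Heisenberg form of trace preservation. It removes all sites that carry the identity
  from the sum of one-site terms, leaving at most \<open>k\<close> of \<open>N\<close>.\<close>

lemma gen_one: "gen (1\<^sub>m d) = 0\<^sub>m d d"
proof -
  have K: "mat_adjoint L * L \<in> carrier_mat d d" using L by simp
  have "anticommut (mat_adjoint L * L) (1\<^sub>m d) = mat_adjoint L * L + mat_adjoint L * L"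
    unfolding anticommut_def using K
    by (simp add: left_mult_one_mat[of _ d d] right_mult_one_mat[of _ d d] del: assoc_mult_mat assoc_mult_mat_square)
  moreover have "mat_adjoint L * 1\<^sub>m d * L = mat_adjoint L * L"
    using L by (simp add: right_mult_one_mat[of _ d d] left_mult_one_mat[of _ d d])
  ultimately have "dissipator_dual L (1\<^sub>m d) = 0\<^sub>m d d"
    unfolding dissipator_dual_def using K by (intro eq_matI) (auto simp del: index_mult_mat(1))
  moreover have "commut (1\<^sub>m d) H = 0\<^sub>m d d"
    unfolding commut_def using H by (simp add: left_mult_one_mat[of _ d d] right_mult_one_mat[of _ d d])
  ultimately show ?thesis by (simp add: gen_def)
qed

lemma commut_one: "X \<in> carrier_mat d d \<Longrightarrow> commut (1\<^sub>m d) X = 0\<^sub>m d d"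
  unfolding commut_def by (simp add: left_mult_one_mat[of _ d d] right_mult_one_mat[of _ d d])

lemma zero_slot:
  assumes "l \<in> {1..N}" "R \<in> carrier_mat (d ^ N) (d ^ N)" "\<sigma> \<in> carrier_mat d d"
  shows "prod_expect d N R (X(l := 0\<^sub>m d d)) = 0" "indep_expect N \<sigma> (X(l := 0\<^sub>m d d)) = 0"
proof -
  have z: "0\<^sub>m d d = 0 \<cdot>\<^sub>m (0\<^sub>m d d :: complex mat)" by (intro eq_matI) auto
  show "prod_expect d N R (X(l := 0\<^sub>m d d)) = 0"
    using prod_expect_upd_smult[OF assms(1) zero_carrier_mat d assms(2), of X 0] by (simp only: z[symmetric] mult_zero_left)
  show "indep_expect N \<sigma> (X(l := 0\<^sub>m d d)) = 0"
    using indep_expect_upd_smult[OF assms(1) zero_carrier_mat assms(3), of X 0] by (simp only: z[symmetric] mult_zero_left)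
qed

text \<open>A block at a site carrying the identity commutes with the factor there, so of the
  commutator only the part at \<open>l\<close> remains, and the block appears as a new factor at
  \<open>l'\<close>.\<close>

lemma pair_term_outside:
  assumes X_carrier: "\<forall>r\<in>{1..N}. X r \<in> carrier_mat d d" and R: "R \<in> carrier_mat (d ^ N) (d ^ N)"
    and l: "l \<in> {1..N}" "l' \<in> {1..N}" "l \<noteq> l'" and X1: "X l' = 1\<^sub>m d"
  shows "pair_term N R X l l' = (\<Sum>(a, b)\<in>{..<d} \<times> {..<d}.
     prod_expect d N R (X(l := commut (X l) (mat_unit d a b), l' := mat_block d A a b)))"
  unfolding pair_term_eq[OF X_carrier R l]
proof (intro sum.cong refl, clarify)
  have X: "\<And>r. r \<in> {1..N} \<Longrightarrow> X r \<in> carrier_mat d d" using X_carrier by blast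
  fix a b
  let ?E = "mat_unit d a b" and ?A = "mat_block d A a b"
  have Xl: "X l \<in> carrier_mat d d" using X l by simp
  have c: "X l * ?E \<in> carrier_mat d d" "?E * X l \<in> carrier_mat d d" using Xl by simp_all
  have "prod_expect d N R ((X(l' := ?A))(l := X l * ?E - ?E * X l)) =
     prod_expect d N R ((X(l' := ?A))(l := X l * ?E)) - prod_expect d N R ((X(l' := ?A))(l := ?E * X l))"
    by (rule prod_expect_upd_diff[OF l(1) c d R])
  thus "prod_expect d N R (X(l := X l * ?E, l' := X l' * ?A)) - prod_expect d N R (X(l := ?E * X l, l' := ?A * X l')) =
     prod_expect d N R (X(l := commut (X l) ?E, l' := ?A))"
    unfolding X1 commut_def fun_upd_twist[OF l(3)]
    by (simp add: left_mult_one_mat[of _ d d] right_mult_one_mat[of _ d d] del: fun_upd_apply)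
qed

text \<open>In the product state, coupling a site of \<open>S\<close> to a site outside gives
  exactly \<open>mean_term\<close>. There are \<open>N - card S\<close> such partners, each with
  weight \<open>1 / N\<close>, against weight one in the mean-field equation. What fails to cancel
  is the third term, with \<open>card S / N\<close>; pairs inside \<open>S\<close> form the
  fourth.\<close>

lemma defect_deriv_eq:
  assumes N: "1 \<le> N" and X_carrier: "\<forall>r\<in>{1..N}. X r \<in> carrier_mat d d"
    and R: "R \<in> carrier_mat (d ^ N) (d ^ N)" and \<sigma>: "\<sigma> \<in> carrier_mat d d" "mtrace \<sigma> = 1"
    and S: "S = {l\<in>{1..N}. X l \<noteq> 1\<^sub>m d}"
  shows "defect_deriv N R \<sigma> X = (\<Sum>l\<in>S. defect N R \<sigma> (X(l := gen (X l))))
    + (- \<i> / of_nat N) * (\<Sum>l\<in>S. \<Sum>l'\<in>{1..N} - S. \<Sum>(a, b)\<in>{..<d} \<times> {..<d}.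
         defect N R \<sigma> (X(l := commut (X l) (mat_unit d a b), l' := mat_block d A a b)))
    + (\<i> * of_nat (card S) / of_nat N) * (\<Sum>l\<in>S. mean_term N \<sigma> X l)
    + (- \<i> / of_nat N) * ((\<Sum>l\<in>S. \<Sum>l'\<in>S - {l}. pair_term N R X l l') / 2)"
proof -
  have X: "\<And>r. r \<in> {1..N} \<Longrightarrow> X r \<in> carrier_mat d d" using X_carrier by blast
  let ?U = "{1..N}" let ?Q = "{..<d} \<times> {..<d}"
  have SU: "S \<subseteq> ?U" and finS: "finite S" using S by auto
  have X1: "X l = 1\<^sub>m d" if "l \<in> ?U - S" for l using that S by auto
  have g: "(\<Sum>l\<in>?U. \<phi> (X(l := gen (X l)))) = (\<Sum>l\<in>S. \<phi> (X(l := gen (X l))))"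
    if "\<And>l. l \<in> ?U \<Longrightarrow> \<phi> (X(l := 0\<^sub>m d d)) = (0::complex)" for \<phi>
    using SU X1 that by (intro sum.mono_neutral_right) (auto simp: gen_one)
  have mt: "(\<Sum>l\<in>?U. mean_term N \<sigma> X l) = (\<Sum>l\<in>S. mean_term N \<sigma> X l)"
    using SU X1 by (intro sum.mono_neutral_right)
     (auto simp: mean_term_def commut_one zero_slot(2)[OF _ R \<sigma>(1)] intro!: sum.neutral)
  have I: "{(l, l'). 1 \<le> l \<and> l < l' \<and> l' \<le> N} = {(l, l'). l \<in> ?U \<and> l' \<in> ?U \<and> l < l'}" by auto
  \<comment> \<open>Both factors are the identity, so the commutator left at \<open>l\<close>
    vanishes.\<close>
  have pz: "pair_term N R X l l' = 0" if "l \<in> ?U - S" "l' \<in> ?U - S" "l \<noteq> l'" for l l'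
  proof -
    have "prod_expect d N R (X(l := commut (X l) (mat_unit d a b), l' := mat_block d A a b)) = 0" for a b
      unfolding X1[OF that(1)] commut_one[OF mat_unit_carrier] fun_upd_twist[OF that(3)]
      using that(1) by (intro zero_slot(1)[OF _ R \<sigma>(1)]) auto
    thus ?thesis using pair_term_outside[OF X_carrier R _ _ that(3) X1[OF that(2)]] that by (simp add: split_def)
  qed
  have pp: "(\<Sum>(l, l')\<in>{(l, l'). 1 \<le> l \<and> l < l' \<and> l' \<le> N}. pair_term N R X l l') =
     (\<Sum>l\<in>S. \<Sum>l'\<in>?U - S. pair_term N R X l l') + (\<Sum>l\<in>S. \<Sum>l'\<in>S - {l}. pair_term N R X l l') / 2"
    unfolding I by (rule sum_pairs_symmetric[OF _ SU pair_term_sym pz]) auto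
  have "(\<Sum>l\<in>S. \<Sum>l'\<in>?U - S. pair_term N R X l l') =
     (\<Sum>l\<in>S. \<Sum>l'\<in>?U - S. (\<Sum>(a, b)\<in>?Q. defect N R \<sigma> (X(l := commut (X l) (mat_unit d a b), l' := mat_block d A a b)))
       + mean_term N \<sigma> X l)"
  proof (intro sum.cong refl)
    fix l l' assume l: "l \<in> S" and l': "l' \<in> ?U - S"
    have lU: "l \<in> ?U" "l' \<in> ?U" "l \<noteq> l'" using l l' SU by auto
    have "indep_expect N \<sigma> (X(l := commut (X l) (mat_unit d a b), l' := mat_block d A a b)) =
       mtrace (mat_block d A a b * \<sigma>) * indep_expect N \<sigma> (X(l := commut (X l) (mat_unit d a b)))" for a b
    proof -
      let ?Y = "X(l := commut (X l) (mat_unit d a b))"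
      have "indep_expect N \<sigma> ?Y = indep_expect N \<sigma> (?Y(l' := 1\<^sub>m d))"
        using X1[OF l'] lU(3) by (metis fun_upd_other fun_upd_triv)
      also have "\<dots> = (\<Prod>r\<in>?U - {l'}. mtrace (?Y r * \<sigma>))"
        unfolding indep_expect_upd[OF lU(2)] using \<sigma> by (simp add: left_mult_one_mat[of _ d d])
      finally show ?thesis unfolding indep_expect_upd[OF lU(2)] by simp
    qed
    thus "pair_term N R X l l' =
      (\<Sum>(a, b)\<in>?Q. defect N R \<sigma> (X(l := commut (X l) (mat_unit d a b), l' := mat_block d A a b))) + mean_term N \<sigma> X l"
      unfolding pair_term_outside[OF X_carrier R lU X1[OF l']] mean_term_def defect_def
      by (simp add: split_def sum_subtractf del: fun_upd_apply)
  qed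
  \<comment> \<open>The mean term does not depend on \<open>l'\<close>, so it is counted once for
    each site outside \<open>S\<close>.\<close>
  also have "\<dots> = (\<Sum>l\<in>S. \<Sum>l'\<in>?U - S. \<Sum>(a, b)\<in>?Q. defect N R \<sigma> (X(l := commut (X l) (mat_unit d a b), l' := mat_block d A a b)))
       + (of_nat N - of_nat (card S)) * (\<Sum>l\<in>S. mean_term N \<sigma> X l)"
  proof -
    have "card S \<le> N" using card_mono[OF _ SU] by simp
    hence "of_nat (card (?U - S)) = (of_nat N - of_nat (card S) :: complex)"
      using SU finS by (simp add: card_Diff_subset of_nat_diff)
    thus ?thesis by (simp add: sum.distrib sum_distrib_left)
  qed
  finally have pm: "(\<Sum>l\<in>S. \<Sum>l'\<in>?U - S. pair_term N R X l l') = 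
     (\<Sum>l\<in>S. \<Sum>l'\<in>?U - S. \<Sum>(a, b)\<in>?Q. defect N R \<sigma> (X(l := commut (X l) (mat_unit d a b), l' := mat_block d A a b)))
       + (of_nat N - of_nat (card S)) * (\<Sum>l\<in>S. mean_term N \<sigma> X l)" .
  have e: "(\<Sum>l\<in>?U. prod_expect d N R (X(l := gen (X l)))) = (\<Sum>l\<in>S. prod_expect d N R (X(l := gen (X l))))"
    "(\<Sum>l\<in>?U. indep_expect N \<sigma> (X(l := gen (X l)))) = (\<Sum>l\<in>S. indep_expect N \<sigma> (X(l := gen (X l))))"
    by (rule g, rule zero_slot[OF _ R \<sigma>(1)], assumption)+
  have N0: "of_nat N \<noteq> (0::complex)" using N by simp
  show ?thesis
    unfolding defect_deriv_def mtrace_nbody_lindblad[OF X_carrier R] indep_expect_deriv[OF X_carrier \<sigma>(1)] pp pm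
      sum_subtractf e sum_distrib_left[symmetric] mt
    using N0 by (simp add: defect_def[of _ _ _ "_(_ := gen _)"] sum_subtractf) (simp add: field_simps)
qed

lemma admissible_carrier: "X \<in> admissible N k \<Longrightarrow> l \<in> {1..N} \<Longrightarrow> X l \<in> carrier_mat d d"
  by (auto simp: admissible_def intro: schur_bounded_carrier)

lemma admissible_upd:
  assumes X: "X \<in> admissible N k" and Y: "schur_bounded d 1 Y" and l: "l \<in> {1..N}"
  shows "X(l := Y) \<in> admissible N (k + 1)"
    and "X l \<noteq> 1\<^sub>m d \<Longrightarrow> X(l := Y) \<in> admissible N k"
proof -
  let ?S = "{l\<in>{1..N}. X l \<noteq> 1\<^sub>m d}" and ?T = "{r\<in>{1..N}. (X(l := Y)) r \<noteq> 1\<^sub>m d}"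
  have b: "\<forall>r\<in>{1..N}. schur_bounded d 1 ((X(l := Y)) r)" using X Y by (auto simp: admissible_def)
  have "card ?T \<le> card (insert l ?S)" by (intro card_mono) auto
  also have "\<dots> \<le> card ?S + 1" by (simp add: card_insert_if)
  finally show "X(l := Y) \<in> admissible N (k + 1)" using X b by (auto simp: admissible_def)
  assume "X l \<noteq> 1\<^sub>m d"
  hence "card ?T \<le> card ?S" using l by (intro card_mono) auto
  thus "X(l := Y) \<in> admissible N k" using X b by (auto simp: admissible_def)
qed

lemma cmod_prod_expect_le:
  assumes X: "\<And>l. l \<in> {1..N} \<Longrightarrow> schur_bounded d 1 (X l)" and R: "density_op (d ^ N) R"
  shows "cmod (prod_expect d N R X) \<le> 1"
  unfolding prod_expect_def by (rule cmod_mtrace_mult_le[OF schur_bounded_tprod[OF d X] R]) auto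

lemma cmod_indep_expect_le:
  assumes X: "\<And>l. l \<in> {1..N} \<Longrightarrow> schur_bounded d 1 (X l)" and \<sigma>: "density_op d \<sigma>"
  shows "cmod (indep_expect N \<sigma> X) \<le> 1"
  unfolding indep_expect_def prod_norm[symmetric]
  using cmod_mtrace_mult_le[OF X \<sigma>] by (intro prod_le_1) auto

lemma cmod_defect_le:
  assumes "X \<in> admissible N k" "density_op (d ^ N) R" "density_op d \<sigma>"
  shows "cmod (defect N R \<sigma> X) \<le> 2"
proof -
  have b: "\<And>l. l \<in> {1..N} \<Longrightarrow> schur_bounded d 1 (X l)" using assms(1) by (auto simp: admissible_def)
  have "cmod (defect N R \<sigma> X) \<le> cmod (prod_expect d N R X) + cmod (indep_expect N \<sigma> X)"
    unfolding defect_def by (rule norm_triangle_ineq4)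
  also have "\<dots> \<le> 1 + 1"
    by (intro add_mono cmod_prod_expect_le[OF b assms(2)] cmod_indep_expect_le[OF b assms(3)])
  finally show ?thesis by simp
qed

lemma gen_bounded: "\<exists>g>0. \<forall>X. schur_bounded d 1 X \<longrightarrow> schur_bounded d g (gen X)"
proof -
  obtain h where h: "0 \<le> h" "schur_bounded d h H" using schur_bounded_ex[OF H] by blast
  obtain r where r: "0 \<le> r" "schur_bounded d r L" using schur_bounded_ex[OF L] by blast
  obtain s where s: "0 \<le> s" "schur_bounded d s (mat_adjoint L)"
    using schur_bounded_ex[of "mat_adjoint L" d] L by auto
  let ?g = "(1 * h + h * 1) + (s * 1 * r + 1 / 2 * (s * r * 1 + 1 * (s * r)))"
  \<comment> \<open>The added \<open>1\<close> makes the constant strictly positive, as needed for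
    rescaling by it.\<close>
  have b: "schur_bounded d (1 + ?g) (gen X)" if X: "schur_bounded d 1 X" for X
  proof -
    have "schur_bounded d (1 * h + h * 1) (commut X H)"
      unfolding commut_def by (intro schur_bounded_diff schur_bounded_mult X h zero_le_one)
    from schur_bounded_smult[OF this, of "- \<i>"]
    have 1: "schur_bounded d (1 * h + h * 1) ((- \<i>) \<cdot>\<^sub>m commut X H)" by simp
    have "schur_bounded d (s * r * 1 + 1 * (s * r)) (anticommut (mat_adjoint L * L) X)"
      unfolding anticommut_def
      by (intro schur_bounded_add schur_bounded_mult X r s zero_le_one mult_nonneg_nonneg)
    from schur_bounded_smult[OF this, of "1 / 2"]
    have 2: "schur_bounded d (1 / 2 * (s * r * 1 + 1 * (s * r))) ((1 / 2) \<cdot>\<^sub>m anticommut (mat_adjoint L * L) X)" by simp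
    have 3: "schur_bounded d (s * 1 * r) (mat_adjoint L * X * L)"
      by (intro schur_bounded_mult X r s zero_le_one mult_nonneg_nonneg)
    have "schur_bounded d ?g (gen X)"
      unfolding gen_def dissipator_dual_def by (intro schur_bounded_add schur_bounded_diff 1 2 3)
    thus ?thesis by (rule schur_bounded_mono) simp
  qed
  show ?thesis
  proof (intro exI conjI)
    show "0 < 1 + ?g" using h r s by (intro add_pos_nonneg) auto
  qed (use b in blast)
qed

lemma block_bounded: "\<exists>a>0. \<forall>x<d. \<forall>y<d. schur_bounded d a (mat_block d A x y)"
proof -
  have "\<forall>x y. \<exists>r\<ge>0. schur_bounded d r (mat_block d A x y)"
    using schur_bounded_ex[OF mat_block_carrier] by blast
  then obtain r where r: "\<And>x y. 0 \<le> r x y" "\<And>x y. schur_bounded d (r x y) (mat_block d A x y)" by metis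
  let ?a = "1 + (\<Sum>x<d. \<Sum>y<d. r x y)"
  have "r x y \<le> ?a" if "x < d" "y < d" for x y
  proof -
    have "r x y \<le> (\<Sum>y<d. r x y)" using that r by (intro member_le_sum) auto
    also have "\<dots> \<le> (\<Sum>x<d. \<Sum>y<d. r x y)"
      using that r by (intro member_le_sum[of x "{..<d}" "\<lambda>x. \<Sum>y<d. r x y"]) (auto intro: sum_nonneg)
    finally show ?thesis by simp
  qed
  hence "\<forall>x<d. \<forall>y<d. schur_bounded d ?a (mat_block d A x y)"
    using schur_bounded_mono[OF r(2)] by auto
  moreover have "0 < ?a" using r by (intro add_pos_nonneg sum_nonneg) auto
  ultimately show ?thesis by blast
qed

lemma commut_unit_bounded:
  assumes "schur_bounded d 1 X"
  shows "schur_bounded d 2 (commut X (mat_unit d a b))"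
proof -
  have "schur_bounded d (1 * 1 + 1 * 1) (commut X (mat_unit d a b))"
    unfolding commut_def using assms schur_bounded_mat_unit
    by (intro schur_bounded_diff schur_bounded_mult) auto
  thus ?thesis by simp
qed

lemma defect_upd_smult:
  assumes "l \<in> {1..N}" "Y \<in> carrier_mat d d" "\<sigma> \<in> carrier_mat d d" "R \<in> carrier_mat (d ^ N) (d ^ N)"
  shows "defect N R \<sigma> (X(l := c \<cdot>\<^sub>m Y)) = c * defect N R \<sigma> (X(l := Y))"
  using assms d by (simp add: defect_def prod_expect_upd_smult indep_expect_upd_smult right_diff_distrib del: fun_upd_apply)

text \<open>The mean-field terms of order \<open>1\<close> cancel, which leaves the defects of observables with at most
  one more nontrivial factor and a contribution of order \<open>k\<^sup>2 / N\<close>.\<close>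

lemma defect_deriv_bound:
  "\<exists>C>0. \<forall>N\<ge>1. \<forall>k R \<sigma> X B. density_op (d ^ N) R \<longrightarrow> density_op d \<sigma> \<longrightarrow> X \<in> admissible N k \<longrightarrow> 0 \<le> B \<longrightarrow>
     (\<forall>Y\<in>admissible N (k + 1). cmod (defect N R \<sigma> Y) \<le> B) \<longrightarrow>
     cmod (defect_deriv N R \<sigma> X) \<le> C * real k * B + C * (real k)\<^sup>2 / real N"
proof -
  obtain g where g: "0 < g" and gb: "\<And>X. schur_bounded d 1 X \<Longrightarrow> schur_bounded d g (gen X)"
    using gen_bounded by blast
  obtain a where a: "0 < a" and ab: "\<And>x y. x < d \<Longrightarrow> y < d \<Longrightarrow> schur_bounded d a (mat_block d A x y)"
    using block_bounded by blast
  define D where "D = real d * real d"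
  have D: "0 < D" using d by (simp add: D_def)
  \<comment> \<open>The constant collects \<open>g\<close> from the one-site generator and, with
    \<open>D\<close> matrix units, blocks bounded by \<open>a\<close> and commutators with a unit
    bounded by \<open>2\<close>, the following: \<open>2 * a * D\<close> from coupling to sites
    outside, and for the \<open>1 / N\<close> part \<open>2 * a * D\<close> from the uncancelled
    mean terms plus \<open>a * D\<close> from pairs inside, after halving.\<close>
  have "cmod (defect_deriv N R \<sigma> X) \<le> (g + 3 * a * D) * real k * B + (g + 3 * a * D) * (real k)\<^sup>2 / real N"
    if N: "1 \<le> N" and R: "density_op (d ^ N) R" and \<sigma>: "density_op d \<sigma>" and X: "X \<in> admissible N k" and B: "0 \<le> B"
    and ind: "\<And>Y. Y \<in> admissible N (k + 1) \<Longrightarrow> cmod (defect N R \<sigma> Y) \<le> B" for N k R \<sigma> X B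
  proof -
    let ?U = "{1..N}" let ?Q = "{..<d} \<times> {..<d}"
    define S where "S = {l\<in>?U. X l \<noteq> 1\<^sub>m d}"
    have SU: "S \<subseteq> ?U" and finS: "finite S" by (auto simp: S_def)
    have k: "card S \<le> k" using X by (simp add: admissible_def S_def)
    have kN: "card S \<le> N" using card_mono[OF _ SU] by simp
    have Rc: "R \<in> carrier_mat (d ^ N) (d ^ N)" and \<sigma>c: "\<sigma> \<in> carrier_mat d d" and tr: "mtrace \<sigma> = 1"
      using R \<sigma> by (auto simp: density_op_carrier) (simp add: density_op_def)
    have Xb: "schur_bounded d 1 (X l)" if "l \<in> ?U" for l using X that by (simp add: admissible_def)
    have X_carrier: "\<forall>r\<in>?U. X r \<in> carrier_mat d d" using schur_bounded_carrier[OF Xb] by blast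
    have cardQ: "real (card ?Q) = D" by (simp add: D_def)
    have t1: "cmod (defect N R \<sigma> (X(l := gen (X l)))) \<le> g * B" if l: "l \<in> S" for l
    proof (rule schur_bounded_scale[of d "\<lambda>Y. defect N R \<sigma> (X(l := Y))"])
      have lU: "l \<in> ?U" using l SU by auto
      show "defect N R \<sigma> (X(l := c \<cdot>\<^sub>m Y)) = c * defect N R \<sigma> (X(l := Y))" if "Y \<in> carrier_mat d d" for c Y
        by (rule defect_upd_smult[OF lU that \<sigma>c Rc])
      show "cmod (defect N R \<sigma> (X(l := Y))) \<le> B" if "schur_bounded d 1 Y" for Y
        by (rule ind, rule admissible_upd(1)[OF X that lU])
      show "schur_bounded d g (gen (X l))" by (rule gb[OF Xb[OF lU]])
    qed (rule g)
    \<comment> \<open>Rescaling in two slots, one after the other: the inner step treats the slot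
      \<open>l'\<close> with the slot \<open>l\<close> already in the unit ball.\<close>
    have two: "cmod (\<Phi> (X(l := Y, l' := Z))) \<le> r * (s * K)"
      if l: "l \<in> ?U" "l' \<in> ?U" "l \<noteq> l'"
      and lin: "\<And>X l c Y. l \<in> ?U \<Longrightarrow> Y \<in> carrier_mat d d \<Longrightarrow> \<Phi> (X(l := c \<cdot>\<^sub>m Y)) = c * \<Phi> (X(l := Y))"
      and bnd: "\<And>Y Z. schur_bounded d 1 Y \<Longrightarrow> schur_bounded d 1 Z \<Longrightarrow> cmod (\<Phi> (X(l := Y, l' := Z))) \<le> K"
      and Y: "schur_bounded d r Y" "0 < r" and Z: "schur_bounded d s Z" "0 < s"
    for \<Phi> l l' Y Z r s K
    proof (rule schur_bounded_scale[of d "\<lambda>Y. \<Phi> (X(l := Y, l' := Z))", OF _ _ Y])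
      show "\<Phi> (X(l := c \<cdot>\<^sub>m Y, l' := Z)) = c * \<Phi> (X(l := Y, l' := Z))" if "Y \<in> carrier_mat d d" for c Y
        unfolding fun_upd_twist[OF l(3)] by (rule lin[OF l(1) that])
      show "cmod (\<Phi> (X(l := Y, l' := Z))) \<le> s * K" if "schur_bounded d 1 Y" for Y
        by (rule schur_bounded_scale[of d "\<lambda>Z. \<Phi> (X(l := Y, l' := Z))", OF lin[OF l(2)] bnd[OF that] Z])
    qed
    have t2: "cmod (defect N R \<sigma> (X(l := commut (X l) (mat_unit d x y), l' := mat_block d A x y))) \<le> 2 * (a * B)"
      if l: "l \<in> S" and l': "l' \<in> ?U - S" and xy: "x < d" "y < d" for l l' x y
    proof (rule two[of l l' "defect N R \<sigma>"])
      show lU: "l \<in> ?U" "l' \<in> ?U" "l \<noteq> l'" using l l' SU by auto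
      show "defect N R \<sigma> (X(l := c \<cdot>\<^sub>m Y)) = c * defect N R \<sigma> (X(l := Y))" if "l \<in> ?U" "Y \<in> carrier_mat d d" for X l c Y
        by (rule defect_upd_smult[OF that \<sigma>c Rc])
      show "cmod (defect N R \<sigma> (X(l := Y, l' := Z))) \<le> B" if "schur_bounded d 1 Y" "schur_bounded d 1 Z" for Y Z
        \<comment> \<open>The site \<open>l\<close> is already nontrivial and keeps the count at
          \<open>k\<close>; only the new site \<open>l'\<close> raises it. This is where the
          hierarchy moves up one level.\<close>
        by (rule ind, rule admissible_upd(1)[OF admissible_upd(2)[OF X that(1) lU(1)] that(2) lU(2)])
          (use l in \<open>auto simp: S_def\<close>)
      show "schur_bounded d 2 (commut (X l) (mat_unit d x y))" by (rule commut_unit_bounded[OF Xb[OF lU(1)]])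
      show "schur_bounded d a (mat_block d A x y)" by (rule ab[OF xy])
    qed (use a in auto)
    have t3: "cmod (mean_term N \<sigma> X l) \<le> D * (a * 2)" if l: "l \<in> S" for l
    proof -
      have lU: "l \<in> ?U" using l SU by auto
      have i: "cmod (indep_expect N \<sigma> (X(l := commut (X l) (mat_unit d x y)))) \<le> 2 * 1" for x y
      proof (rule schur_bounded_scale[of d "\<lambda>Y. indep_expect N \<sigma> (X(l := Y))"])
        show "indep_expect N \<sigma> (X(l := c \<cdot>\<^sub>m Y)) = c * indep_expect N \<sigma> (X(l := Y))" if "Y \<in> carrier_mat d d" for c Y
          by (rule indep_expect_upd_smult[OF lU that \<sigma>c])
        show "cmod (indep_expect N \<sigma> (X(l := Y))) \<le> 1" if "schur_bounded d 1 Y" for Y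
          by (rule cmod_indep_expect_le[OF _ \<sigma>]) (use Xb that in auto)
        show "schur_bounded d 2 (commut (X l) (mat_unit d x y))" by (rule commut_unit_bounded[OF Xb[OF lU]])
      qed simp
      have "cmod (mean_term N \<sigma> X l) \<le> (\<Sum>q\<in>?Q. a * 2)"
        unfolding mean_term_def
      proof (rule sum_norm_le, clarify)
        fix x y assume "x < d" "y < d"
        hence "cmod (mtrace (mat_block d A x y * \<sigma>)) \<le> a"
          using a by (intro cmod_mtrace_mult_le[OF ab \<sigma>]) auto
        thus "cmod (mtrace (mat_block d A x y * \<sigma>) * indep_expect N \<sigma> (X(l := commut (X l) (mat_unit d x y)))) \<le> a * 2"
          unfolding norm_mult using i[of x y] a by (intro mult_mono) auto
      qed
      thus ?thesis by (simp add: D_def)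
    qed
    have t4: "cmod (pair_term N R X l l') \<le> D * (2 * a)" if l: "l \<in> S" "l' \<in> S - {l}" for l l'
    proof -
      have lU: "l \<in> ?U" "l' \<in> ?U" "l \<noteq> l'" using l SU by auto
      have q: "cmod (prod_expect d N R (X(l := Y, l' := Z))) \<le> 1 * (a * 1)" if "schur_bounded d 1 Y" "schur_bounded d a Z" for Y Z
      proof (rule two[of l l' "prod_expect d N R"])
        show "l \<in> ?U" "l' \<in> ?U" "l \<noteq> l'" by fact+
        show "prod_expect d N R (X(l := c \<cdot>\<^sub>m Y)) = c * prod_expect d N R (X(l := Y))" if "l \<in> ?U" "Y \<in> carrier_mat d d" for X l c Y
          by (rule prod_expect_upd_smult[OF that d Rc])
        show "cmod (prod_expect d N R (X(l := Y, l' := Z))) \<le> 1" if "schur_bounded d 1 Y" "schur_bounded d 1 Z" for Y Z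
          by (rule cmod_prod_expect_le[OF _ R]) (use Xb that in auto)
      qed (use that a in auto)
      have m: "schur_bounded d (r * s) (P * Q)" if "schur_bounded d r P" "schur_bounded d s Q" "0 < r" "0 < s" for P Q r s
        using schur_bounded_mult[OF that(1,2)] that(3,4) by simp
      have "cmod (pair_term N R X l l') \<le> (\<Sum>q\<in>?Q. 2 * a)"
        unfolding pair_term_eq[OF X_carrier Rc lU]
      proof (rule sum_norm_le, clarify)
        fix x y assume xy: "x < d" "y < d"
        have "cmod (prod_expect d N R (X(l := X l * mat_unit d x y, l' := X l' * mat_block d A x y))) \<le> 1 * (a * 1)"
          using m[OF Xb[OF lU(1)] schur_bounded_mat_unit] m[OF Xb[OF lU(2)] ab[OF xy]] a by (intro q) auto
        moreover have "cmod (prod_expect d N R (X(l := mat_unit d x y * X l, l' := mat_block d A x y * X l'))) \<le> 1 * (a * 1)"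
          using m[OF schur_bounded_mat_unit Xb[OF lU(1)]] m[OF ab[OF xy] Xb[OF lU(2)]] a by (intro q) auto
        ultimately show "cmod (prod_expect d N R (X(l := X l * mat_unit d x y, l' := X l' * mat_block d A x y)) -
           prod_expect d N R (X(l := mat_unit d x y * X l, l' := mat_block d A x y * X l'))) \<le> 2 * a"
          using norm_triangle_ineq4[of "prod_expect d N R (X(l := X l * mat_unit d x y, l' := X l' * mat_block d A x y))"
            "prod_expect d N R (X(l := mat_unit d x y * X l, l' := mat_block d A x y * X l'))"] by linarith
      qed
      thus ?thesis by (simp add: D_def)
    qed
    let ?s = "real (card S)"
    have s: "?s \<le> real k" using k by simp
    have b1: "cmod (\<Sum>l\<in>S. defect N R \<sigma> (X(l := gen (X l)))) \<le> ?s * (g * B)"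
      using sum_norm_le[OF t1] by simp
    have "cmod (\<Sum>l\<in>S. \<Sum>l'\<in>?U - S. \<Sum>(x, y)\<in>?Q. defect N R \<sigma> (X(l := commut (X l) (mat_unit d x y), l' := mat_block d A x y)))
        \<le> (\<Sum>l\<in>S. \<Sum>l'\<in>?U - S. \<Sum>q\<in>?Q. 2 * (a * B))"
      using t2 by (intro sum_norm_le) auto
    also have "\<dots> = ?s * real (card (?U - S)) * (D * (2 * (a * B)))" by (simp add: D_def)
    also have "\<dots> \<le> ?s * real N * (D * (2 * (a * B)))"
      using card_mono[of ?U "?U - S"] a B D by (intro mult_right_mono mult_left_mono mult_nonneg_nonneg) auto
    finally have b2: "cmod (\<Sum>l\<in>S. \<Sum>l'\<in>?U - S. \<Sum>(x, y)\<in>?Q. defect N R \<sigma> (X(l := commut (X l) (mat_unit d x y), l' := mat_block d A x y)))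
        \<le> ?s * real N * (D * (2 * (a * B)))" .
    have b3: "cmod (\<Sum>l\<in>S. mean_term N \<sigma> X l) \<le> ?s * (D * (a * 2))"
      using sum_norm_le[OF t3] by simp
    have "cmod (\<Sum>l\<in>S. \<Sum>l'\<in>S - {l}. pair_term N R X l l') \<le> (\<Sum>l\<in>S. \<Sum>l'\<in>S - {l}. D * (2 * a))"
      using t4 by (intro sum_norm_le) auto
    also have "\<dots> \<le> (\<Sum>l\<in>S. ?s * (D * (2 * a)))"
    proof (intro sum_mono)
      fix l assume "l \<in> S"
      have "card (S - {l}) \<le> card S" using finS by (intro card_mono) auto
      thus "(\<Sum>l'\<in>S - {l}. D * (2 * a)) \<le> ?s * (D * (2 * a))"
        using a D by (simp add: mult_right_mono)
    qed
    also have "\<dots> = ?s * ?s * (D * (2 * a))" by simp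
    finally have b4: "cmod (\<Sum>l\<in>S. \<Sum>l'\<in>S - {l}. pair_term N R X l l') \<le> ?s * ?s * (D * (2 * a))" .
    have N0: "0 < real N" using N by simp
    let ?T2 = "\<Sum>l\<in>S. \<Sum>l'\<in>?U - S. \<Sum>(x, y)\<in>?Q. defect N R \<sigma> (X(l := commut (X l) (mat_unit d x y), l' := mat_block d A x y))"
    have "cmod (defect_deriv N R \<sigma> X) \<le> cmod (\<Sum>l\<in>S. defect N R \<sigma> (X(l := gen (X l))))
      + cmod ((- \<i> / of_nat N) * ?T2)
      + cmod ((\<i> * of_nat (card S) / of_nat N) * (\<Sum>l\<in>S. mean_term N \<sigma> X l))
      + cmod ((- \<i> / of_nat N) * ((\<Sum>l\<in>S. \<Sum>l'\<in>S - {l}. pair_term N R X l l') / 2))"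
      unfolding defect_deriv_eq[OF N X_carrier Rc \<sigma>c tr S_def]
      by (intro norm_triangle_mono add_mono norm_triangle_ineq order.refl order.trans[OF norm_triangle_ineq])
    also have "\<dots> \<le> ?s * (g * B) + 1 / real N * (?s * real N * (D * (2 * (a * B)))) + ?s / real N * (?s * (D * (a * 2)))
       + 1 / real N * ((?s * ?s * (D * (2 * a))) / 2)"
      using b1 b2 b3 b4 N0 unfolding norm_mult norm_divide
      by (intro add_mono mult_mono) (auto simp: divide_right_mono)
    also have "\<dots> = ?s * ((g + 2 * a * D) * B) + (?s * ?s) * (3 * a * D) / real N"
      using N0 by (simp add: field_simps)
    also have "\<dots> \<le> real k * ((g + 3 * a * D) * B) + (real k * real k) * (g + 3 * a * D) / real N"
      using s a D g B N0 by (intro add_mono mult_mono divide_right_mono) auto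
    finally show ?thesis by (simp add: power2_eq_square algebra_simps)
  qed
  thus ?thesis using g a D by (intro exI[of _ "g + 3 * a * D"]) (auto intro: add_pos_pos)
qed

end

section \<open>Hierarchies of differential inequalities\<close>

text \<open>A mean value inequality for complex functions: after multiplication by the phase
  \<open>z\<close> that makes the total increment real and nonnegative, it is a monotonicity
  statement about the real function \<open>h\<close>.\<close>

lemma norm_increment_le:
  fixes u :: "real \<Rightarrow> complex"
  assumes ab: "a \<le> b"
    and u: "\<And>t. t \<in> {a..b} \<Longrightarrow> (u has_vector_derivative u' t) (at t within {a..b})"
    and \<phi>: "\<And>t. t \<in> {a..b} \<Longrightarrow> (\<phi> has_real_derivative \<phi>' t) (at t within {a..b})"
    and le: "\<And>t. t \<in> {a..b} \<Longrightarrow> cmod (u' t) \<le> \<phi>' t"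
  shows "cmod (u b - u a) \<le> \<phi> b - \<phi> a"
proof -
  define z where "z = cnj (sgn (u b - u a))"
  have z: "cmod z \<le> 1" by (simp add: z_def norm_sgn)
  have zw: "Re (z * (u b - u a)) = cmod (u b - u a)"
  proof (cases "u b - u a = 0")
    case False
    have "z * (u b - u a) = (u b - u a) * cnj (u b - u a) / of_real (cmod (u b - u a))"
      by (simp add: z_def sgn_eq)
    also have "\<dots> = of_real (cmod (u b - u a))"
      unfolding complex_norm_square[symmetric] using False by (simp add: power2_eq_square)
    finally show ?thesis by simp
  qed (simp add: z_def)
  define h where "h t = \<phi> t - Re (z * u t)" for t
  have h: "(h has_real_derivative \<phi>' t - Re (z * u' t)) (at t within {a..b})" if "t \<in> {a..b}" for t
  proof -
    have "((\<lambda>t. z * u t) has_vector_derivative z * u' t) (at t within {a..b})"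
      using u[OF that] by (rule has_vector_derivative_mult_right)
    hence "((\<lambda>t. Re (z * u t)) has_vector_derivative Re (z * u' t)) (at t within {a..b})"
      by (rule bounded_linear.has_vector_derivative[OF bounded_linear_Re])
    thus ?thesis unfolding h_def has_real_derivative_iff_has_vector_derivative
      using \<phi>[OF that, unfolded has_real_derivative_iff_has_vector_derivative]
      by (intro has_vector_derivative_diff)
  qed
  have nn: "0 \<le> \<phi>' t - Re (z * u' t)" if "t \<in> {a..b}" for t
  proof -
    have "Re (z * u' t) \<le> cmod z * cmod (u' t)" using complex_Re_le_cmod[of "z * u' t"] by (simp add: norm_mult)
    also have "\<dots> \<le> 1 * cmod (u' t)" using z by (intro mult_right_mono) auto
    finally show ?thesis using le[OF that] by simp
  qed
  have "h a \<le> h b"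
  proof (rule DERIV_nonneg_imp_increasing_open[OF ab])
    show "\<exists>y. DERIV h x :> y \<and> 0 \<le> y" if "a < x" "x < b" for x
      using h[of x] nn[of x] that by (auto simp: at_within_Icc_at)
    show "continuous_on {a..b} h"
      using h by (rule DERIV_continuous_on)
  qed
  thus ?thesis using zw by (simp add: h_def algebra_simps)
qed

text \<open>Each use of the differential inequality shifts \<open>k\<close> to \<open>k + 1\<close> and costs a factor \<open>C * k\<close>, so after
  \<open>n\<close> uses the trivial bound \<open>2\<close> has become \<open>2 * C ^ n * ((k + n - 1) choose n) * t ^ n\<close>.  This tends
  to \<open>0\<close> only for short times, hence the steps of length \<open>1 / (4 * C)\<close>.\<close>

lemma hierarchy_vanishes:
  fixes u u' :: "nat \<Rightarrow> 'x \<Rightarrow> real \<Rightarrow> complex" and adm :: "nat \<Rightarrow> nat \<Rightarrow> 'x set"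
  assumes T: "0 \<le> T" and C: "0 < C"
    and der: "\<And>N k x t. 1 \<le> N \<Longrightarrow> x \<in> adm N k \<Longrightarrow> t \<in> {0..T} \<Longrightarrow>
      (u N x has_vector_derivative u' N x t) (at t within {0..T})"
    and two: "\<And>N k x t. 1 \<le> N \<Longrightarrow> x \<in> adm N k \<Longrightarrow> t \<in> {0..T} \<Longrightarrow> cmod (u N x t) \<le> 2"
    and init: "\<And>N k x. 1 \<le> N \<Longrightarrow> x \<in> adm N k \<Longrightarrow> u N x 0 = 0"
    and step: "\<And>N k x t B. 1 \<le> N \<Longrightarrow> x \<in> adm N k \<Longrightarrow> t \<in> {0..T} \<Longrightarrow> 0 \<le> B \<Longrightarrow>
      (\<And>y. y \<in> adm N (k + 1) \<Longrightarrow> cmod (u N y t) \<le> B) \<Longrightarrow>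
      cmod (u' N x t) \<le> C * real k * B + C * (real k)\<^sup>2 / real N"
    and \<epsilon>: "0 < \<epsilon>"
  shows "\<forall>\<^sub>F N in sequentially. \<forall>x\<in>adm N k. \<forall>t\<in>{0..T}. cmod (u N x t) \<le> \<epsilon>"
proof -
  \<comment> \<open>All levels enter at once, because the estimate at level \<open>k\<close> on the
    next time step draws on the values at time \<open>s\<close> of higher levels.\<close>
  define P where "P s \<longleftrightarrow> (\<forall>k. \<forall>\<epsilon>>0. \<forall>\<^sub>F N in sequentially. \<forall>x\<in>adm N k. \<forall>t\<in>{0..s}. cmod (u N x t) \<le> \<epsilon>)" for s
  define \<tau> where "\<tau> = 1 / (4 * C)"
  have \<tau>: "0 < \<tau>" using C by (simp add: \<tau>_def)
  have step_time: "P s'" if Ps: "P s" and s: "0 \<le> s" "s \<le> s'" "s' \<le> T" "s' - s \<le> \<tau>" for s s'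
  proof -
    have claim: "\<forall>k. \<forall>\<epsilon>>0. \<forall>\<^sub>F N in sequentially. \<forall>x\<in>adm N k. \<forall>t\<in>{s..s'}.
        cmod (u N x t) \<le> 2 * C ^ n * real ((k + n - 1) choose n) * (t - s) ^ n + \<epsilon>" for n
    proof (induction n)
      case 0
      have "\<forall>x\<in>adm N k. \<forall>t\<in>{s..s'}. cmod (u N x t) \<le> 2 + \<epsilon>" if "1 \<le> N" "0 < \<epsilon>" for N k and \<epsilon> :: real
        using two[OF that(1)] that(2) s by (smt (verit) atLeastAtMost_iff)
      hence "\<forall>\<^sub>F N in sequentially. \<forall>x\<in>adm N k. \<forall>t\<in>{s..s'}. cmod (u N x t) \<le> 2 + \<epsilon>"
        if "0 < \<epsilon>" for k and \<epsilon> :: real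
        using that by (intro eventually_mono[OF eventually_ge_at_top[of "1::nat"]]) blast
      thus ?case by simp
    next
      case (Suc n)
      show ?case
      proof (intro allI impI)
        fix k and \<epsilon> :: real assume \<epsilon>: "0 < \<epsilon>"
        \<comment> \<open>The tolerance is spent in three equal parts: on the value at time
          \<open>s\<close>, on the term of order \<open>1 / N\<close>, and on the error
          \<open>e2\<close> inherited from level \<open>k + 1\<close>, which is multiplied by
          \<open>C * real k\<close> and acts for a time at most \<open>\<tau>\<close>. The
          \<open>+ 1\<close> keeps the denominator positive when \<open>k = 0\<close>.\<close>
        define e2 where "e2 = \<epsilon> / (3 * (C * real k * \<tau> + 1))"
        have den: "0 < C * real k * \<tau> + 1" using C \<tau> by (intro add_nonneg_pos mult_nonneg_nonneg) auto
        have e2: "0 < e2" using \<epsilon> den by (simp add: e2_def)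
        have e2': "C * real k * e2 * \<tau> \<le> \<epsilon> / 3"
        proof -
          have "C * real k * e2 * \<tau> = (\<epsilon> / 3) * (C * real k * \<tau> / (C * real k * \<tau> + 1))"
            by (simp add: e2_def)
          also have "\<dots> \<le> (\<epsilon> / 3) * 1"
            using \<epsilon> den by (intro mult_left_mono) (auto simp: divide_le_eq_1)
          finally show ?thesis by simp
        qed
        have "(\<lambda>N. C * (real k)\<^sup>2 * \<tau> / real N) \<longlonglongrightarrow> 0"
          by (rule tendsto_divide_0[OF tendsto_const]) (rule filterlim_at_top_imp_at_infinity[OF filterlim_real_sequentially])
        hence ev1: "\<forall>\<^sub>F N in sequentially. C * (real k)\<^sup>2 * \<tau> / real N < \<epsilon> / 3"
          using \<epsilon> by (intro order_tendstoD(2)[where y = 0]) auto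
        have ev2: "\<forall>\<^sub>F N in sequentially. \<forall>x\<in>adm N k. \<forall>t\<in>{0..s}. cmod (u N x t) \<le> \<epsilon> / 3"
        proof -
          have "0 < \<epsilon> / 3" using \<epsilon> by simp
          thus ?thesis using Ps unfolding P_def by blast
        qed
        have ev3: "\<forall>\<^sub>F N in sequentially. \<forall>x\<in>adm N (k + 1). \<forall>t\<in>{s..s'}.
            cmod (u N x t) \<le> 2 * C ^ n * real ((k + 1 + n - 1) choose n) * (t - s) ^ n + e2"
          using Suc.IH e2 by blast
        show "\<forall>\<^sub>F N in sequentially. \<forall>x\<in>adm N k. \<forall>t\<in>{s..s'}.
            cmod (u N x t) \<le> 2 * C ^ Suc n * real ((k + Suc n - 1) choose Suc n) * (t - s) ^ Suc n + \<epsilon>"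
          using ev1 ev2 ev3 eventually_ge_at_top[of "1::nat"]
        proof eventually_elim
          case (elim N)
          show ?case
          proof (intro ballI)
            fix x t assume x: "x \<in> adm N k" and t: "t \<in> {s..s'}"
            define b where "b = 2 * C ^ n * real ((k + n) choose n)"
            have b: "0 \<le> b" using C by (simp add: b_def)
            define c where "c = C * real k * e2 + C * (real k)\<^sup>2 / real N"
            \<comment> \<open>The antiderivative, vanishing at \<open>s\<close>, of the bound on the
              derivative; \<open>c\<close> collects the parts that are constant in time.\<close>
            define \<phi> where "\<phi> r = C * real k * b / real (Suc n) * (r - s) ^ Suc n + c * (r - s)" for r
            have "cmod (u N x t - u N x s) \<le> \<phi> t - \<phi> s"
            proof (rule norm_increment_le)
              show "s \<le> t" using t by simp
              fix r assume r: "r \<in> {s..t}"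
              hence r': "r \<in> {0..T}" "r \<in> {s..s'}" using s t by auto
              show "(u N x has_vector_derivative u' N x r) (at r within {s..t})"
                unfolding has_vector_derivative_def
                by (rule has_derivative_subset[OF der[OF elim(4) x r'(1), unfolded has_vector_derivative_def]]) (use s t in auto)
              show "(\<phi> has_real_derivative C * real k * (b * (r - s) ^ n) + c) (at r within {s..t})"
              proof -
                have "((\<lambda>r. (r - s) ^ Suc n) has_real_derivative real (Suc n) * (r - s) ^ n) (at r within {s..t})"
                  using DERIV_power[OF DERIV_diff[OF DERIV_ident DERIV_const], where n = "Suc n"] by (simp del: power_Suc)
                from DERIV_add[OF DERIV_cmult[OF this] DERIV_cmult[OF DERIV_diff[OF DERIV_ident DERIV_const]],
                    of "C * real k * b / real (Suc n)" c s]
                show ?thesis unfolding \<phi>_def by (simp add: mult.assoc del: power_Suc of_nat_Suc)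
              qed
              have "cmod (u' N x r) \<le> C * real k * (b * (r - s) ^ n + e2) + C * (real k)\<^sup>2 / real N"
              proof (rule step[OF elim(4) x r'(1)])
                show "0 \<le> b * (r - s) ^ n + e2" using b e2 r by simp
                show "cmod (u N y r) \<le> b * (r - s) ^ n + e2" if "y \<in> adm N (k + 1)" for y
                  using elim(3) that r'(2) by (simp add: b_def)
              qed
              thus "cmod (u' N x r) \<le> C * real k * (b * (r - s) ^ n) + c"
                by (simp add: c_def distrib_left)
            qed
            moreover have "cmod (u N x s) \<le> \<epsilon> / 3" using elim(2) x s by auto
            ultimately have "cmod (u N x t) \<le> \<epsilon> / 3 + (\<phi> t - \<phi> s)"
              using norm_triangle_sub[of "u N x t" "u N x s"] by linarith
            also have "\<phi> t - \<phi> s = C * real k * b / real (Suc n) * (t - s) ^ Suc n + c * (t - s)"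
              by (simp add: \<phi>_def)
            also have "c * (t - s) \<le> c * \<tau>"
              using s t C e2 by (intro mult_left_mono) (auto simp: c_def)
            also have "c * \<tau> = C * real k * e2 * \<tau> + C * (real k)\<^sup>2 * \<tau> / real N"
              by (simp add: c_def algebra_simps)
            also have "\<dots> \<le> \<epsilon> / 3 + \<epsilon> / 3" using e2' elim(1) by linarith
            also have "C * real k * b / real (Suc n) = 2 * C ^ Suc n * real ((k + Suc n - 1) choose Suc n)"
            proof -
              \<comment> \<open>Integration contributes \<open>1 / (n + 1)\<close> and the hierarchy
                a factor \<open>k\<close>; together they turn one binomial coefficient into the
                next.\<close>
              have "Suc n * ((k + n) choose Suc n) = k * ((k + n) choose n)"
                using choose_mult_lemma[of 0 n] binomial_absorb_comp[of "k + n" n] binomial_absorption[of n "k + n"]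
                  Suc_times_binomial_eq[of "k + n - 1" n] by (cases k) (auto simp: binomial_absorb_comp algebra_simps)
              hence "real (Suc n) * real ((k + n) choose Suc n) = real k * real ((k + n) choose n)"
                by (metis of_nat_mult)
              thus ?thesis by (simp add: b_def field_simps)
            qed
            finally show "cmod (u N x t) \<le> 2 * C ^ Suc n * real ((k + Suc n - 1) choose Suc n) * (t - s) ^ Suc n + \<epsilon>"
              by simp
          qed
        qed
      qed
    qed
    show "P s'"
      unfolding P_def
    proof (intro allI impI)
      fix k and \<epsilon> :: real assume \<epsilon>: "0 < \<epsilon>"
      \<comment> \<open>The binomial coefficient is at most \<open>2 ^ (k + n)\<close>, so
        \<open>n\<close> iterations leave at most \<open>2 * 2 ^ k * (2 * C * \<tau>) ^ n\<close>,
        and the choice of \<open>\<tau>\<close> makes the base \<open>1 / 2\<close>. The number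
        \<open>n\<close> is fixed before \<open>N\<close> tends to infinity.\<close>
      have "(\<lambda>n. 2 * 2 ^ k * (1 / 2) ^ n :: real) \<longlonglongrightarrow> 2 * 2 ^ k * 0"
        by (intro tendsto_intros LIMSEQ_power_zero) auto
      hence "\<forall>\<^sub>F n in sequentially. 2 * 2 ^ k * (1 / 2) ^ n < \<epsilon> / 2"
        using \<epsilon> by (intro order_tendstoD(2)[where y = "2 * 2 ^ k * 0"]) auto
      then obtain n where n: "2 * 2 ^ k * (1 / 2) ^ n < \<epsilon> / 2"
        using eventually_happens trivial_limit_sequentially by blast
      have small: "2 * C ^ n * real ((k + n - 1) choose n) * (t - s) ^ n \<le> \<epsilon> / 2" if "t \<in> {s..s'}" for t
      proof -
        have t: "0 \<le> t - s" "t - s \<le> \<tau>" using that s by auto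
        have "real ((k + n - 1) choose n) \<le> 2 ^ (k + n)"
        proof -
          have "(k + n - 1) choose n \<le> 2 ^ (k + n - 1)" by (rule binomial_le_pow2)
          also have "\<dots> \<le> 2 ^ (k + n)" by (intro power_increasing) auto
          finally show ?thesis by (metis of_nat_le_iff of_nat_numeral of_nat_power)
        qed
        hence "2 * C ^ n * real ((k + n - 1) choose n) * (t - s) ^ n \<le> 2 * C ^ n * 2 ^ (k + n) * \<tau> ^ n"
          using t C by (intro mult_mono power_mono) auto
        also have "\<dots> = 2 * 2 ^ k * (2 * C * \<tau>) ^ n"
          by (simp add: power_mult_distrib power_add)
        also have "2 * C * \<tau> = 1 / 2" using C by (simp add: \<tau>_def)
        finally show ?thesis using n by simp
      qed
      have "\<forall>\<^sub>F N in sequentially. \<forall>x\<in>adm N k. \<forall>t\<in>{s..s'}.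
        cmod (u N x t) \<le> 2 * C ^ n * real ((k + n - 1) choose n) * (t - s) ^ n + \<epsilon> / 2"
        using claim[of n] \<epsilon> by simp
      moreover have "\<forall>\<^sub>F N in sequentially. \<forall>x\<in>adm N k. \<forall>t\<in>{0..s}. cmod (u N x t) \<le> \<epsilon>"
        using Ps \<epsilon> unfolding P_def by blast
      ultimately show "\<forall>\<^sub>F N in sequentially. \<forall>x\<in>adm N k. \<forall>t\<in>{0..s'}. cmod (u N x t) \<le> \<epsilon>"
      proof eventually_elim
        case (elim N)
        show ?case
        proof (intro ballI)
          fix x t assume x: "x \<in> adm N k" and t: "t \<in> {0..s'}"
          show "cmod (u N x t) \<le> \<epsilon>"
          proof (cases "t \<le> s")
            case False
            hence t': "t \<in> {s..s'}" using t by simp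
            have "cmod (u N x t) \<le> 2 * C ^ n * real ((k + n - 1) choose n) * (t - s) ^ n + \<epsilon> / 2"
              using elim(1) x t' by blast
            thus ?thesis using small[OF t'] by simp
          qed (use elim(2) x t in auto)
        qed
      qed
    qed
  qed
  have P0: "P 0"
    unfolding P_def
  proof (intro allI impI)
    fix k and \<epsilon> :: real assume "0 < \<epsilon>"
    thus "\<forall>\<^sub>F N in sequentially. \<forall>x\<in>adm N k. \<forall>t\<in>{0..0}. cmod (u N x t) \<le> \<epsilon>"
      by (intro eventually_mono[OF eventually_ge_at_top[of "1::nat"]]) (auto simp: init)
  qed
  \<comment> \<open>Finitely many steps of length \<open>\<tau>\<close> cover the interval; the
    minimum cuts the last one off at \<open>T\<close>.\<close>
  have PT: "P (min T (real j * \<tau>))" for j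
  proof (induction j)
    case 0
    thus ?case using P0 T by simp
  next
    case (Suc j)
    show ?case
      by (rule step_time[OF Suc.IH]) (use T \<tau> in \<open>auto simp: algebra_simps min_def\<close>)
  qed
  obtain j :: nat where "T / \<tau> \<le> real j" using real_arch_simple by blast
  hence "min T (real j * \<tau>) = T" using \<tau> by (simp add: field_simps)
  hence "P T" using PT[of j] by simp
  thus ?thesis using \<epsilon> unfolding P_def by blast
qed

section \<open>Faithfulness along the mean-field flow\<close>

text \<open>Writes a quadratic form as a trace, so that cyclicity and the trace identities for the
  generators become available for it.\<close>

lemma mtrace_rank_one:
  assumes M: "M \<in> carrier_mat n n" and v: "v \<in> carrier_vec n"
  shows "mtrace (mat n n (\<lambda>(i, j). v $ i * cnj (v $ j)) * M) = (M *\<^sub>v v) \<bullet>c v"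
proof -
  let ?P = "mat n n (\<lambda>(i, j). v $ i * cnj (v $ j))"
  have P: "?P \<in> carrier_mat n n" by simp
  have "mtrace (?P * M) = (\<Sum>i<n. \<Sum>j<n. v $ i * cnj (v $ j) * M $$ (j, i))"
    by (simp add: mtrace_mult_sum[OF P M])
  also have "\<dots> = (M *\<^sub>v v) \<bullet>c v"
    unfolding inner_mult_mat_vec[OF M v] by (subst sum.swap) (simp add: mult_ac)
  finally show ?thesis .
qed

context lindblad_model
begin

text \<open>On an eigenvector of \<open>\<sigma>\<close> the commutator has mean zero and the gain term \<open>L \<sigma> L\<^sup>*\<close> is positive,
  so only the loss term can decrease the eigenvalue.\<close>

lemma eigenvalue_decay:
  assumes \<sigma>: "positive_op d \<sigma>" and v: "v \<in> carrier_vec d" and ev: "\<sigma> *\<^sub>v v = complex_of_real \<mu> \<cdot>\<^sub>v v"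
  shows "Re ((mean_field_lindblad d H A L \<sigma> *\<^sub>v v) \<bullet>c v) \<ge> - \<mu> * Re ((mat_adjoint L * L *\<^sub>v v) \<bullet>c v)"
proof -
  define P where "P = mat d d (\<lambda>(i, j). v $ i * cnj (v $ j))"
  have P: "P \<in> carrier_mat d d" by (simp add: P_def)
  have \<sigma>c: "\<sigma> \<in> carrier_mat d d" and herm: "\<And>i j. i < d \<Longrightarrow> j < d \<Longrightarrow> \<sigma> $$ (i, j) = cnj (\<sigma> $$ (j, i))"
    using \<sigma> unfolding positive_op_def self_adjoint_iff by blast+
  define G where "G = H + mean_field d A \<sigma>"
  have G: "G \<in> carrier_mat d d" using H by (simp add: G_def)
  define K where "K = mat_adjoint L * L"
  have K: "K \<in> carrier_mat d d" using L by (simp add: K_def)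
  have M: "mat_adjoint L \<in> carrier_mat d d" using L by simp
  have evi: "(\<Sum>k<d. \<sigma> $$ (i, k) * v $ k) = of_real \<mu> * v $ i" if "i < d" for i
    using index_mult_mat_vec_sum[OF \<sigma>c v that] ev v that by simp
  have \<sigma>P: "\<sigma> * P = of_real \<mu> \<cdot>\<^sub>m P"
  proof (rule eq_matI)
    fix i j assume "i < dim_row (of_real \<mu> \<cdot>\<^sub>m P)" "j < dim_col (of_real \<mu> \<cdot>\<^sub>m P)"
    hence ij: "i < d" "j < d" by (auto simp: P_def)
    have "(\<sigma> * P) $$ (i, j) = (\<Sum>k<d. \<sigma> $$ (i, k) * v $ k) * cnj (v $ j)"
      unfolding index_mult_mat_sum[OF \<sigma>c P ij] sum_distrib_right using ij by (simp add: P_def mult.assoc)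
    thus "(\<sigma> * P) $$ (i, j) = (of_real \<mu> \<cdot>\<^sub>m P) $$ (i, j)" using ij evi by (simp add: P_def)
  qed (use \<sigma>c in \<open>auto simp: P_def\<close>)
  have P\<sigma>: "P * \<sigma> = of_real \<mu> \<cdot>\<^sub>m P"
  proof (rule eq_matI)
    fix i j assume "i < dim_row (of_real \<mu> \<cdot>\<^sub>m P)" "j < dim_col (of_real \<mu> \<cdot>\<^sub>m P)"
    hence ij: "i < d" "j < d" by (auto simp: P_def)
    have "(P * \<sigma>) $$ (i, j) = v $ i * cnj (\<Sum>k<d. \<sigma> $$ (j, k) * v $ k)"
      unfolding index_mult_mat_sum[OF P \<sigma>c ij] cnj_sum sum_distrib_left
    proof (intro sum.cong refl)
      fix k assume "k \<in> {..<d}"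
      thus "P $$ (i, k) * \<sigma> $$ (k, j) = v $ i * cnj (\<sigma> $$ (j, k) * v $ k)"
        using ij herm[of k j] by (simp add: P_def mult_ac)
    qed
    thus "(P * \<sigma>) $$ (i, j) = (of_real \<mu> \<cdot>\<^sub>m P) $$ (i, j)" using ij evi by (simp add: P_def)
  qed (use \<sigma>c in \<open>auto simp: P_def\<close>)
  have sm: "mtrace ((of_real \<mu> \<cdot>\<^sub>m P) * X) = of_real \<mu> * mtrace (P * X)" if "X \<in> carrier_mat d d" for X
    using that P by (simp add: mult_smult_assoc_mat[of _ d d _ d] mtrace_smult[of _ d])
  \<comment> \<open>On an eigenvector, \<open>\<sigma>\<close> can be absorbed by \<open>P\<close>
    from either side at the price of the same scalar \<open>\<mu>\<close>. Hence the commutator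
    cancels and both halves of the anticommutator give the same loss.\<close>
  have r: "mtrace (P * (X * \<sigma>)) = of_real \<mu> * mtrace (P * X)" if X: "X \<in> carrier_mat d d" for X
    using mtrace_mult_comm_assoc[OF P X \<sigma>c] sm[OF X] by (simp only: \<sigma>P)
  have l: "mtrace (P * (\<sigma> * X)) = of_real \<mu> * mtrace (P * X)" if X: "X \<in> carrier_mat d d" for X
    using sm[OF X] P \<sigma>c X by (simp only: P\<sigma>[symmetric]) simp
  have com: "mtrace (P * commut G \<sigma>) = 0"
  proof -
    have "P * commut G \<sigma> = P * (G * \<sigma>) - P * (\<sigma> * G)"
      unfolding commut_def using P G \<sigma>c by (intro mult_minus_distrib_mat[of _ d d _ d]) auto
    hence "mtrace (P * commut G \<sigma>) = mtrace (P * (G * \<sigma>)) - mtrace (P * (\<sigma> * G))"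
      using P G \<sigma>c by (simp only: mtrace_diff[of _ d] mult_carrier_mat_square)
    thus ?thesis by (simp only: r[OF G] l[OF G] diff_self)
  qed
  define w where "w = mat_adjoint L *\<^sub>v v"
  have w: "w \<in> carrier_vec d" using M v by (simp add: w_def)
  have gain: "0 \<le> Re (mtrace (P * (L * \<sigma> * mat_adjoint L)))"
  proof -
    \<comment> \<open>Conjugation carries the rank-one operator of \<open>v\<close> to that of
      \<open>w\<close>, so the gain is the quadratic form of \<open>\<sigma>\<close> at
      \<open>w\<close> and thus nonnegative.\<close>
    have "mat_adjoint L * P * L = mat d d (\<lambda>(i, j). w $ i * cnj (w $ j))"
    proof (rule eq_matI)
      fix i j assume "i < dim_row (mat d d (\<lambda>(i, j). w $ i * cnj (w $ j)))" "j < dim_col (mat d d (\<lambda>(i, j). w $ i * cnj (w $ j)))"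
      hence ij: "i < d" "j < d" by auto
      have wi: "w $ i = (\<Sum>k<d. mat_adjoint L $$ (i, k) * v $ k)" if "i < d" for i
        unfolding w_def using index_mult_mat_vec_sum[OF M v that] .
      have MP: "(mat_adjoint L * P) $$ (i, k) = w $ i * cnj (v $ k)" if "k < d" for k
        unfolding index_mult_mat_sum[OF M P ij(1) that] wi[OF ij(1)] sum_distrib_right
        using that by (intro sum.cong refl) (simp add: P_def)
      have "(mat_adjoint L * P * L) $$ (i, j) = (\<Sum>k<d. w $ i * cnj (v $ k) * L $$ (k, j))"
        using index_mult_mat_sum[OF mult_carrier_mat[OF M P] L ij] MP by simp
      also have "\<dots> = w $ i * cnj (w $ j)"
        unfolding wi[OF ij(2)] cnj_sum sum_distrib_left
        using ij by (intro sum.cong refl) (simp add: index_mat_adjoint[OF L])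
      finally show "(mat_adjoint L * P * L) $$ (i, j) = mat d d (\<lambda>(i, j). w $ i * cnj (w $ j)) $$ (i, j)"
        using ij by simp
    qed (use L in auto)
    moreover have "mtrace (P * (L * \<sigma> * mat_adjoint L)) = mtrace (mat_adjoint L * P * L * \<sigma>)"
      using mtrace_mult_comm_assoc[of P d "L * \<sigma>" "mat_adjoint L"] P L \<sigma>c M
      by (simp add: assoc_mult_mat[of _ d d _ d _ d])
    ultimately have "mtrace (P * (L * \<sigma> * mat_adjoint L)) = (\<sigma> *\<^sub>v w) \<bullet>c w"
      using mtrace_rank_one[OF \<sigma>c w] by simp
    thus ?thesis using \<sigma> w by (simp add: positive_op_def)
  qed
  have dis: "mtrace (P * dissipator L \<sigma>) = mtrace (P * (L * \<sigma> * mat_adjoint L)) - of_real \<mu> * mtrace (P * K)"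
  proof -
    have 1: "P * dissipator L \<sigma> = P * (L * \<sigma> * mat_adjoint L) - P * ((1/2) \<cdot>\<^sub>m anticommut K \<sigma>)"
      unfolding dissipator_def K_def[symmetric] using P L M K \<sigma>c
      by (intro mult_minus_distrib_mat[of _ d d _ d]) auto
    have 2: "P * ((1/2) \<cdot>\<^sub>m anticommut K \<sigma>) = (1/2) \<cdot>\<^sub>m (P * (K * \<sigma>) + P * (\<sigma> * K))"
      unfolding anticommut_def using P K \<sigma>c
      by (simp add: mult_smult_distrib[of _ d d _ d] mult_add_distrib_mat[of _ d d _ d])
    have "mtrace (P * dissipator L \<sigma>) = mtrace (P * (L * \<sigma> * mat_adjoint L)) - 1/2 * (mtrace (P * (K * \<sigma>)) + mtrace (P * (\<sigma> * K)))"
      unfolding 1 2 using P L M K \<sigma>c by (simp add: mtrace_diff[of _ d] mtrace_smult[of _ d] mtrace_add[of _ d])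
    thus ?thesis unfolding r[OF K] l[OF K] by simp
  qed
  have "P * mean_field_lindblad d H A L \<sigma> = (- \<i>) \<cdot>\<^sub>m (P * commut G \<sigma>) + P * dissipator L \<sigma>"
    unfolding mean_field_lindblad_def G_def[symmetric] using P G \<sigma>c L
    by (simp add: mult_add_distrib_mat[of _ d d _ d] mult_smult_distrib[of _ d d _ d])
  hence "mtrace (P * mean_field_lindblad d H A L \<sigma>) = mtrace (P * (L * \<sigma> * mat_adjoint L)) - of_real \<mu> * mtrace (P * K)"
    using P G \<sigma>c L by (simp add: mtrace_add[of _ d] mtrace_smult[of _ d] com dis)
  moreover have "mean_field_lindblad d H A L \<sigma> \<in> carrier_mat d d"
    unfolding mean_field_lindblad_def G_def[symmetric] using G \<sigma>c L by simp
  ultimately show ?thesis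
    using gain mtrace_rank_one[OF _ v, of "mean_field_lindblad d H A L \<sigma>"] mtrace_rank_one[OF K v]
    unfolding P_def[symmetric] K_def[symmetric] by simp
qed

text \<open>The smallest eigenvalue satisfies
  \<open>lam t \<ge> \<epsilon> * exp (- \<kappa> * t)\<close>. At a first time \<open>s\<close> of
  failure, let \<open>v\<close> be an eigenvector for \<open>lam s\<close>. Its quadratic form along
  the flow lies above \<open>lam\<close> and meets it at \<open>s\<close>, and multiplied by
  \<open>exp (\<kappa> * t)\<close> it has positive derivative there, so it was already below
  \<open>\<epsilon>\<close> shortly before, a contradiction.\<close>

lemma faithful_uniform:
  assumes T: "0 \<le> T" and sol: "density_solution d T (mean_field_lindblad d H A L) m\<^sub>0 m"
    and m0: "strictly_positive_op d m\<^sub>0"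
  shows "\<exists>c>0. \<forall>t\<in>{0..T}. \<exists>U e. unitary_op d U \<and> m t = spectral_decomp d U e \<and>
    (\<forall>i<d. c \<le> e i) \<and> (\<Sum>i<d. e i) = 1"
proof -
  have m_0: "m 0 = m\<^sub>0" and dens: "\<And>t. t \<in> {0..T} \<Longrightarrow> density_op d (m t)"
    and der: "\<And>t i j. t \<in> {0..T} \<Longrightarrow> i < d \<Longrightarrow> j < d \<Longrightarrow>
      ((\<lambda>s. m s $$ (i, j)) has_vector_derivative mean_field_lindblad d H A L (m t) $$ (i, j)) (at t within {0..T})"
    using sol by (auto simp: density_solution_def)
  have mc: "m t \<in> carrier_mat d d" if "t \<in> {0..T}" for t using dens[OF that] by (rule density_op_carrier)
  \<comment> \<open>A diagonalisation is chosen for each time separately, without any continuity in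
    \<open>t\<close>; only the smallest eigenvalue will be shown to be continuous.\<close>
  have "\<forall>t\<in>{0..T}. \<exists>Ue. unitary_op d (fst Ue) \<and> m t = spectral_decomp d (fst Ue) (snd Ue) \<and> (\<Sum>i<d. snd Ue i) = 1"
    using density_op_spectral[OF dens] by fastforce
  then obtain Ue where Ue: "\<forall>t\<in>{0..T}. unitary_op d (fst (Ue t)) \<and> m t = spectral_decomp d (fst (Ue t)) (snd (Ue t)) \<and> (\<Sum>i<d. snd (Ue t) i) = 1"
    by (rule bchoice[THEN exE])
  define U where "U t = fst (Ue t)" for t
  define e where "e t = snd (Ue t)" for t
  have U: "unitary_op d (U t)" and mU: "m t = spectral_decomp d (U t) (e t)" and sum1: "(\<Sum>i<d. e t i) = 1"
    if "t \<in> {0..T}" for t using Ue that by (auto simp: U_def e_def)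
  define lam where "lam t = Min (e t ` {..<d})" for t
  have ne: "{..<d} \<noteq> {}" using d by auto
  have lam_le: "lam t \<le> e t i" if "i < d" for t i using that by (simp add: lam_def)
  define q where "q v t = Re ((m t *\<^sub>v v) \<bullet>c v)" for v t
  define unit where "unit v \<longleftrightarrow> v \<in> carrier_vec d \<and> (\<Sum>i<d. (cmod (v $ i))\<^sup>2) = 1" for v :: "complex vec"
  have q_ge: "lam t \<le> q v t" if t: "t \<in> {0..T}" and v: "unit v" for t v
  proof -
    have Uc: "U t \<in> carrier_mat d d" using U[OF t] by (simp add: unitary_op_def)
    have vc: "v \<in> carrier_vec d" using v by (simp add: unit_def)
    have "lam t = (\<Sum>k<d. lam t * (cmod (\<Sum>i<d. cnj (U t $$ (i, k)) * v $ i))\<^sup>2)"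
      unfolding sum_distrib_left[symmetric] parseval[OF U[OF t] vc] using v by (simp add: unit_def)
    also have "\<dots> \<le> (\<Sum>k<d. e t k * (cmod (\<Sum>i<d. cnj (U t $$ (i, k)) * v $ i))\<^sup>2)"
      using lam_le by (intro sum_mono mult_right_mono) auto
    also have "\<dots> = q v t" unfolding q_def mU[OF t] inner_spectral_decomp[OF Uc vc] by simp
    finally show ?thesis .
  qed
  have q_ev: "\<exists>v. unit v \<and> m t *\<^sub>v v = of_real (lam t) \<cdot>\<^sub>v v \<and> q v t = lam t" if t: "t \<in> {0..T}" for t
  proof -
    have "lam t \<in> e t ` {..<d}" unfolding lam_def using ne by (intro Min_in) auto
    then obtain k where k: "k < d" "lam t = e t k" by auto
    have Uc: "U t \<in> carrier_mat d d" using U[OF t] by (simp add: unitary_op_def)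
    have "unit (col (U t) k)" using norm_unitary_col[OF U[OF t] k(1)] Uc k by (simp add: unit_def)
    moreover have "m t *\<^sub>v col (U t) k = of_real (lam t) \<cdot>\<^sub>v col (U t) k"
      unfolding mU[OF t] k(2) by (rule spectral_eigenvector[OF U[OF t] k(1)])
    moreover have "q (col (U t) k) t = lam t"
      unfolding q_def k(2) unfolding mU[OF t] using inner_unitary_col[OF U[OF t] k(1)] by simp
    ultimately show ?thesis by blast
  qed
  have unit_le: "cmod (v $ i) \<le> 1" if "unit v" "i < d" for v i
  proof -
    have "(cmod (v $ i))\<^sup>2 \<le> (\<Sum>i<d. (cmod (v $ i))\<^sup>2)" using that(2) by (intro member_le_sum) auto
    thus ?thesis using that(1) by (simp add: unit_def power_le_one_iff abs_square_le_1)
  qed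
  have form_le: "Re ((M *\<^sub>v v) \<bullet>c v) \<le> (\<Sum>i<d. \<Sum>j<d. cmod (M $$ (i, j)))" if M: "M \<in> carrier_mat d d" and v: "unit v" for M v
  proof -
    have vc: "v \<in> carrier_vec d" using v by (simp add: unit_def)
    have "Re ((M *\<^sub>v v) \<bullet>c v) \<le> cmod ((M *\<^sub>v v) \<bullet>c v)" by (rule complex_Re_le_cmod)
    also have "\<dots> \<le> (\<Sum>i<d. \<Sum>j<d. cmod (M $$ (i, j)))"
      unfolding inner_mult_mat_vec[OF M vc]
    proof (intro sum_norm_le)
      fix i j assume "i \<in> {..<d}" "j \<in> {..<d}"
      hence "cmod (v $ i) * cmod (M $$ (i, j)) * cmod (v $ j) \<le> 1 * cmod (M $$ (i, j)) * 1"
        using unit_le[OF v] by (intro mult_mono) auto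
      thus "cmod (cnj (v $ i) * M $$ (i, j) * v $ j) \<le> cmod (M $$ (i, j))" by (simp add: norm_mult)
    qed
    finally show ?thesis .
  qed
  \<comment> \<open>This entrywise distance bounds the change of every quadratic form on unit
    vectors, hence the change of their minimum \<open>lam\<close>, even though the chosen
    eigenvectors may jump.\<close>
  define w where "w s t = (\<Sum>i<d. \<Sum>j<d. cmod (m s $$ (i, j) - m t $$ (i, j)))" for s t
  have q_diff: "q v s \<le> q v t + w s t" if "s \<in> {0..T}" "t \<in> {0..T}" and v: "unit v" for s t v
  proof -
    have vc: "v \<in> carrier_vec d" using v by (simp add: unit_def)
    have M: "m s - m t \<in> carrier_mat d d" using mc[OF that(2)] by (rule minus_carrier_mat)
    have "q v s - q v t = Re (((m s - m t) *\<^sub>v v) \<bullet>c v)"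
      unfolding q_def inner_mult_mat_vec[OF M vc] inner_mult_mat_vec[OF mc[OF that(1)] vc] inner_mult_mat_vec[OF mc[OF that(2)] vc]
        minus_complex.sel[symmetric] sum_subtractf[symmetric]
      using mc[OF that(1)] mc[OF that(2)] by (intro arg_cong[of _ _ Re] sum.cong refl) (simp add: algebra_simps)
    also have "\<dots> \<le> (\<Sum>i<d. \<Sum>j<d. cmod ((m s - m t) $$ (i, j)))" by (rule form_le[OF M v])
    also have "\<dots> = w s t" unfolding w_def using mc[OF that(1)] mc[OF that(2)] by (intro sum.cong refl) auto
    finally show ?thesis by simp
  qed
  have lam_diff: "lam s \<le> lam t + w s t" if st: "s \<in> {0..T}" "t \<in> {0..T}" for s t
  proof -
    obtain v where v: "unit v" "q v t = lam t" using q_ev[OF st(2)] by blast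
    thus ?thesis using q_ge[OF st(1) v(1)] q_diff[OF st v(1)] by simp
  qed
  have w_sym: "w s t = w t s" for s t by (simp add: w_def norm_minus_commute)
  have cont: "continuous_on {0..T} lam"
    unfolding continuous_on_def
  proof
    fix t assume t: "t \<in> {0..T}"
    have "((\<lambda>s. w s t) \<longlongrightarrow> (\<Sum>i<d. \<Sum>j<d. cmod (m t $$ (i, j) - m t $$ (i, j)))) (at t within {0..T})"
      unfolding w_def
    proof (intro tendsto_sum tendsto_norm tendsto_diff tendsto_const)
      fix i j assume "i \<in> {..<d}" "j \<in> {..<d}"
      thus "((\<lambda>s. m s $$ (i, j)) \<longlongrightarrow> m t $$ (i, j)) (at t within {0..T})"
        using has_vector_derivative_continuous[OF der[OF t]] by (auto simp: continuous_within)
    qed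
    hence w0: "((\<lambda>s. w s t) \<longlongrightarrow> 0) (at t within {0..T})" by simp
    have "((\<lambda>s. lam s - lam t) \<longlongrightarrow> 0) (at t within {0..T})"
    proof (rule tendsto_0_le[OF w0])
      have "norm (lam s - lam t) \<le> norm (w s t) * 1" if s: "s \<in> {0..T}" for s
        using lam_diff[OF s t] lam_diff[OF t s] w_sym[of s t] by (simp add: abs_le_iff)
      thus "\<forall>\<^sub>F s in at t within {0..T}. norm (lam s - lam t) \<le> norm (w s t) * 1"
        unfolding eventually_at_filter by (intro always_eventually) blast
    qed
    thus "(lam \<longlongrightarrow> lam t) (at t within {0..T})" by (simp add: LIM_zero_iff)
  qed
  have K: "mat_adjoint L * L \<in> carrier_mat d d" using L by simp
  define c where "c = (\<Sum>i<d. \<Sum>j<d. cmod ((mat_adjoint L * L) $$ (i, j)))"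
  have c: "0 \<le> c" unfolding c_def by (intro sum_nonneg) auto
  \<comment> \<open>The loss can decrease the eigenvalue at relative rate at most \<open>c\<close>;
    the additional \<open>1\<close> makes the derivative strictly positive.\<close>
  define \<kappa> where "\<kappa> = c + 1"
  have T0: "(0::real) \<in> {0..T}" using T by simp
  have lam0: "0 < lam 0"
  proof -
    obtain v where v: "unit v" "q v 0 = lam 0" using q_ev[OF T0] by blast
    have "v \<noteq> 0\<^sub>v d" using v(1) by (auto simp: unit_def)
    thus ?thesis using v m0 by (auto simp: q_def m_0 unit_def strictly_positive_op_def)
  qed
  \<comment> \<open>Strictly below the initial value, so that the first bad time is positive and
    there is room to its left.\<close>
  define \<epsilon> where "\<epsilon> = lam 0 / 2"
  have \<epsilon>: "0 < \<epsilon>" "\<epsilon> < lam 0" using lam0 by (auto simp: \<epsilon>_def)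
  have main: "\<epsilon> < lam t * exp (\<kappa> * t)" if t: "t \<in> {0..T}" for t
  proof (rule ccontr)
    assume nt: "\<not> \<epsilon> < lam t * exp (\<kappa> * t)"
    define Z where "Z = {t\<in>{0..T}. lam t * exp (\<kappa> * t) \<le> \<epsilon>}"
    have "closed ((\<lambda>t. lam t * exp (\<kappa> * t)) -` {..\<epsilon>} \<inter> {0..T})"
      by (intro closed_vimage_Int continuous_intros cont)
    hence "compact ({0..T} \<inter> ((\<lambda>t. lam t * exp (\<kappa> * t)) -` {..\<epsilon>} \<inter> {0..T}))"
      by (intro compact_Int_closed compact_Icc)
    also have "{0..T} \<inter> ((\<lambda>t. lam t * exp (\<kappa> * t)) -` {..\<epsilon>} \<inter> {0..T}) = Z"
      by (auto simp: Z_def)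
    finally have "compact Z" .
    moreover have "Z \<noteq> {}" using t nt by (auto simp: Z_def)
    ultimately have "\<exists>s\<in>Z. \<forall>t\<in>Z. s \<le> t" by (rule compact_attains_inf)
    then obtain s where sZ: "s \<in> Z" and s_min: "\<And>t. t \<in> Z \<Longrightarrow> s \<le> t" by blast
    have s: "s \<in> {0..T}" and s_le: "lam s * exp (\<kappa> * s) \<le> \<epsilon>" using sZ by (auto simp: Z_def)
    have s0: "0 < s"
    proof (rule ccontr)
      assume "\<not> 0 < s"
      hence "s = 0" using s by simp
      thus False using s_le \<epsilon> by simp
    qed
    have before: "\<epsilon> < lam r * exp (\<kappa> * r)" if "0 \<le> r" "r < s" for r
    proof (rule ccontr)
      assume "\<not> ?thesis"
      hence "r \<in> Z" using that s by (auto simp: Z_def)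
      hence "s \<le> r" by (rule s_min)
      thus False using that by simp
    qed
    obtain v where v: "unit v" and ev: "m s *\<^sub>v v = of_real (lam s) \<cdot>\<^sub>v v" and qs: "q v s = lam s"
      using q_ev[OF s] by blast
    have vc: "v \<in> carrier_vec d" using v by (simp add: unit_def)
    define \<phi> where "\<phi> r = q v r * exp (\<kappa> * r)" for r
    have \<phi>_before: "\<epsilon> < \<phi> r" if "0 \<le> r" "r < s" for r
    proof -
      have "lam r \<le> q v r" using that s by (intro q_ge v) auto
      hence "lam r * exp (\<kappa> * r) \<le> \<phi> r" by (simp add: \<phi>_def)
      thus ?thesis using before[OF that] by simp
    qed
    define G where "G = mean_field_lindblad d H A L (m s)"
    have Gc: "G \<in> carrier_mat d d"
      unfolding G_def mean_field_lindblad_def using H L mc[OF s] by simp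
    have qd: "(q v has_real_derivative Re ((G *\<^sub>v v) \<bullet>c v)) (at s within {0..T})"
    proof -
      have "((\<lambda>r. \<Sum>i<d. \<Sum>j<d. cnj (v $ i) * m r $$ (i, j) * v $ j) has_vector_derivative
         (\<Sum>i<d. \<Sum>j<d. cnj (v $ i) * G $$ (i, j) * v $ j)) (at s within {0..T})"
        unfolding G_def using der[OF s]
        by (intro has_vector_derivative_sum has_vector_derivative_mult_left has_vector_derivative_mult_right) auto
      hence "((\<lambda>r. Re (\<Sum>i<d. \<Sum>j<d. cnj (v $ i) * m r $$ (i, j) * v $ j)) has_vector_derivative
         Re ((G *\<^sub>v v) \<bullet>c v)) (at s within {0..T})"
        unfolding inner_mult_mat_vec[OF Gc vc] by (rule bounded_linear.has_vector_derivative[OF bounded_linear_Re])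
      thus ?thesis unfolding has_real_derivative_iff_has_vector_derivative has_vector_derivative_def
        by (rule has_derivative_transform[OF s, rotated]) (simp add: q_def inner_mult_mat_vec[OF mc vc])
    qed
    have \<phi>d: "(\<phi> has_real_derivative (Re ((G *\<^sub>v v) \<bullet>c v) + \<kappa> * lam s) * exp (\<kappa> * s)) (at s within {0..T})"
      unfolding \<phi>_def by (rule derivative_eq_intros qd refl)+ (simp add: qs algebra_simps)
    \<comment> \<open>Multiplying the bound on the loss by \<open>lam s\<close> requires its sign,
      which comes from the left limit: \<open>\<phi>\<close> exceeds \<open>\<epsilon>\<close>
      before \<open>s\<close>.\<close>
    have ls: "0 < lam s"
    proof -
      have "continuous (at s within {0..T}) \<phi>" using \<phi>d by (rule DERIV_continuous)
      hence "(\<phi> \<longlongrightarrow> \<phi> s) (at s within {0..T})" by (simp add: continuous_within)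
      hence lim: "(\<phi> \<longlongrightarrow> \<phi> s) (at s within {0..s})" by (rule tendsto_within_subset) (use s in auto)
      have nb: "at s within {0..s} \<noteq> bot" using s0 by (simp add: at_within_Icc_at_left)
      have "\<epsilon> \<le> \<phi> s"
        by (rule tendsto_lowerbound[OF lim _ nb])
          (auto simp: eventually_at_filter intro!: always_eventually less_imp_le \<phi>_before)
      hence "0 < lam s * exp (\<kappa> * s)" using \<epsilon> by (simp add: \<phi>_def qs)
      thus ?thesis by (simp add: zero_less_mult_iff)
    qed
    have "Re ((G *\<^sub>v v) \<bullet>c v) \<ge> - lam s * Re ((mat_adjoint L * L *\<^sub>v v) \<bullet>c v)"
      unfolding G_def using dens[OF s] by (intro eigenvalue_decay vc ev) (simp add: density_op_def)
    moreover have "lam s * Re ((mat_adjoint L * L *\<^sub>v v) \<bullet>c v) \<le> lam s * c"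
      using form_le[OF K v] ls by (intro mult_left_mono) (auto simp: c_def)
    moreover have "\<kappa> * lam s = lam s * c + lam s" by (simp add: \<kappa>_def algebra_simps)
    ultimately have "0 < Re ((G *\<^sub>v v) \<bullet>c v) + \<kappa> * lam s" using ls by linarith
    hence "0 < (Re ((G *\<^sub>v v) \<bullet>c v) + \<kappa> * lam s) * exp (\<kappa> * s)" by simp
    from has_real_derivative_pos_inc_left[OF \<phi>d this] obtain \<delta> where \<delta>: "0 < \<delta>"
      and inc: "\<And>h. 0 < h \<Longrightarrow> s - h \<in> {0..T} \<Longrightarrow> h < \<delta> \<Longrightarrow> \<phi> (s - h) < \<phi> s" by blast
    define h where "h = min s \<delta> / 2"
    have h: "0 < h" "h < s" "h < \<delta>" using s0 \<delta> by (auto simp: h_def)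
    have "\<phi> (s - h) < \<phi> s" using h s by (intro inc) auto
    also have "\<phi> s \<le> \<epsilon>" using s_le by (simp add: \<phi>_def qs)
    finally show False using \<phi>_before[of "s - h"] h by simp
  qed
  \<comment> \<open>The exponential bound at its smallest, at the final time.\<close>
  define c' where "c' = \<epsilon> * exp (- \<kappa> * T)"
  have c': "0 < c'" using \<epsilon> by (simp add: c'_def)
  have "c' \<le> e t i" if t: "t \<in> {0..T}" and i: "i < d" for t i
  proof -
    have "c' \<le> \<epsilon> * exp (- \<kappa> * t)"
      unfolding c'_def using t c \<epsilon> by (intro mult_left_mono) (auto simp: \<kappa>_def intro!: mult_left_mono)
    also have "\<dots> \<le> lam t" using main[OF t] by (simp add: exp_minus field_simps)
    also have "\<dots> \<le> e t i" using i by (rule lam_le)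
    finally show ?thesis .
  qed
  thus ?thesis using c' U mU sum1 by blast
qed

end

section \<open>Propagation of chaos\<close>

lemma overlap_tprod:
  assumes d: "0 < d" and U: "U \<in> carrier_mat d d" and V: "V \<in> carrier_mat d d" and ij: "i < d ^ N" "j < d ^ N"
  shows "overlap (d ^ N) (tprod d N (\<lambda>_. U)) (tprod d N (\<lambda>_. V)) i j =
    (\<Prod>l=1..N. overlap d U V (digit d N l i) (digit d N l j))"
proof -
  have "mat_adjoint (tprod d N (\<lambda>_. U)) * tprod d N (\<lambda>_. V) = tprod d N (\<lambda>_. mat_adjoint U * V)"
    using U V by (simp add: tprod_adjoint[OF d] tprod_mult[OF d])
  thus ?thesis
    unfolding overlap_def by (simp add: index_tprod[OF ij] prod_norm[symmetric] prod_power_distrib[symmetric])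
qed

text \<open>The logarithm of a product eigenvalue is a sum over the sites \<open>r\<close>. In the
  \<open>r\<close>-th summand each other site contributes the sum of
  \<open>overlap d U V x y * p x\<close>, which is one, and site \<open>r\<close> contributes the
  one-site entropy.\<close>

lemma rel_entropy_tensor_power:
  assumes d: "0 < d" and U: "unitary_op d U" and V: "unitary_op d V"
    and p: "\<And>i. i < d \<Longrightarrow> 0 \<le> p i" "(\<Sum>i<d. p i) = 1" and q: "\<And>i. i < d \<Longrightarrow> 0 < q i"
  shows "rel_entropy (tensor_power (spectral_decomp d U p) N) (tensor_power (spectral_decomp d V q) N) =
    ereal (real N * (\<Sum>i<d. \<Sum>j<d. overlap d U V i j * (p i * (ln (p i) - ln (q j)))))"
proof -
  have Uc: "U \<in> carrier_mat d d" and Vc: "V \<in> carrier_mat d d" using U V by (auto simp: unitary_op_def)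
  let ?g = "digit d N" and ?o = "overlap d U V"
  let ?P = "\<lambda>i. \<Prod>l=1..N. p (?g l i)" and ?Q = "\<lambda>i. \<Prod>l=1..N. q (?g l i)"
  let ?D = "\<Sum>i<d. \<Sum>j<d. ?o i j * (p i * (ln (p i) - ln (q j)))"
  define f where "f r l x y = (if l = r then ?o x y * (p x * (ln (p x) - ln (q y))) else ?o x y * p x)" for r l x y :: nat
  have dg: "?g l i < d" for l i by (rule digit_less[OF d])
  have pt: "overlap (d ^ N) (tprod d N (\<lambda>_. U)) (tprod d N (\<lambda>_. V)) i j * (?P i * (ln (?P i) - ln (?Q j))) =
      (\<Sum>r=1..N. \<Prod>l=1..N. f r l (?g l i) (?g l j))" if ij: "i < d ^ N" "j < d ^ N" for i j
  \<comment> \<open>With a vanishing eigenvalue the logarithm of the product does not split, but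
    then both sides contain a factor zero.\<close>
  proof (cases "\<exists>l\<in>{1..N}. p (?g l i) = 0")
    case True
    then obtain l where l: "l \<in> {1..N}" "p (?g l i) = 0" by blast
    have "?P i = 0" using l by (intro prod_zero) auto
    moreover have "(\<Prod>l=1..N. f r l (?g l i) (?g l j)) = 0" for r
      using l by (intro prod_zero) (auto simp: f_def)
    ultimately show ?thesis by simp
  next
    case False
    hence pp: "0 < p (?g l i)" if "l \<in> {1..N}" for l using that p(1)[OF dg, of l i] by force
    have qp: "0 < q (?g l j)" for l by (rule q[OF dg])
    have "ln (?P i) - ln (?Q j) = (\<Sum>r=1..N. ln (p (?g r i)) - ln (q (?g r j)))"
    proof -
      have "ln (?P i) = (\<Sum>r=1..N. ln (p (?g r i)))" by (intro ln_prod) (use pp in force)+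
      moreover have "ln (?Q j) = (\<Sum>r=1..N. ln (q (?g r j)))" by (intro ln_prod finite_atLeastAtMost less_imp_neq[OF qp, symmetric])
      ultimately show ?thesis by (simp add: sum_subtractf)
    qed
    hence "overlap (d ^ N) (tprod d N (\<lambda>_. U)) (tprod d N (\<lambda>_. V)) i j * (?P i * (ln (?P i) - ln (?Q j))) =
      (\<Sum>r=1..N. (\<Prod>l=1..N. ?o (?g l i) (?g l j) * p (?g l i)) * (ln (p (?g r i)) - ln (q (?g r j))))"
      unfolding overlap_tprod[OF d Uc Vc ij] by (simp add: prod.distrib sum_distrib_left mult.assoc)
    also have "\<dots> = (\<Sum>r=1..N. \<Prod>l=1..N. f r l (?g l i) (?g l j))"
    proof (intro sum.cong refl)
      fix r assume r: "r \<in> {1..N}"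
      have "(\<Prod>l=1..N. f r l (?g l i) (?g l j)) =
          f r r (?g r i) (?g r j) * (\<Prod>l\<in>{1..N} - {r}. f r l (?g l i) (?g l j))"
        using r by (intro prod.remove) auto
      also have "(\<Prod>l\<in>{1..N} - {r}. f r l (?g l i) (?g l j)) = (\<Prod>l\<in>{1..N} - {r}. ?o (?g l i) (?g l j) * p (?g l i))"
        by (intro prod.cong refl) (auto simp: f_def)
      also have "f r r (?g r i) (?g r j) * \<dots> = (?o (?g r i) (?g r j) * p (?g r i) * (\<Prod>l\<in>{1..N} - {r}. ?o (?g l i) (?g l j) * p (?g l i)))
          * (ln (p (?g r i)) - ln (q (?g r j)))"
        by (simp add: f_def mult_ac)
      also have "?o (?g r i) (?g r j) * p (?g r i) * (\<Prod>l\<in>{1..N} - {r}. ?o (?g l i) (?g l j) * p (?g l i)) =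
         (\<Prod>l=1..N. ?o (?g l i) (?g l j) * p (?g l i))"
        using r by (intro prod.remove[symmetric]) auto
      finally show "(\<Prod>l=1..N. ?o (?g l i) (?g l j) * p (?g l i)) * (ln (p (?g r i)) - ln (q (?g r j))) =
        (\<Prod>l=1..N. f r l (?g l i) (?g l j))" ..
    qed
    finally show ?thesis .
  qed
  have fs: "(\<Sum>x<d. \<Sum>y<d. f r l x y) = (if l = r then ?D else 1)" for r l
    using p(2) by (simp add: f_def sum_distrib_right[symmetric] overlap_rows[OF U V])
  have "rel_entropy (tensor_power (spectral_decomp d U p) N) (tensor_power (spectral_decomp d V q) N) =
     ereal (\<Sum>i<d ^ N. \<Sum>j<d ^ N. overlap (d ^ N) (tprod d N (\<lambda>_. U)) (tprod d N (\<lambda>_. V)) i j * (?P i * (ln (?P i) - ln (?Q j))))"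
    unfolding tensor_power_spectral(2)[OF d U] tensor_power_spectral(2)[OF d V]
    using q dg by (intro rel_entropy_spectral tensor_power_spectral(1)[OF d] U V prod_pos) auto
  also have "(\<Sum>i<d ^ N. \<Sum>j<d ^ N. overlap (d ^ N) (tprod d N (\<lambda>_. U)) (tprod d N (\<lambda>_. V)) i j * (?P i * (ln (?P i) - ln (?Q j)))) =
      (\<Sum>i<d ^ N. \<Sum>j<d ^ N. \<Sum>r=1..N. \<Prod>l=1..N. f r l (?g l i) (?g l j))"
    by (intro sum.cong refl pt) auto
  also have "\<dots> = (\<Sum>r=1..N. \<Sum>i<d ^ N. \<Sum>j<d ^ N. \<Prod>l=1..N. f r l (?g l i) (?g l j))"
    by (rule sum_rotate3)
  also have "\<dots> = (\<Sum>r=1..N. \<Prod>l=1..N. if l = r then ?D else 1)"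
    unfolding sum2_prod_digits fs ..
  also have "\<dots> = (\<Sum>r=1..N. ?D)" by (intro sum.cong refl) simp
  also have "\<dots> = real N * ?D" by simp
  finally show ?thesis .
qed

text \<open>Relative entropy is additive on product states, so the assumption on the initial entropy per
  particle means that \<open>\<rho>\<^sub>0\<close> and \<open>m\<^sub>0\<close> have relative entropy zero.\<close>

lemma initial_states_equal:
  assumes d: "0 < d" and \<rho>: "density_op d \<rho>\<^sub>0" and m: "density_op d m\<^sub>0" "strictly_positive_op d m\<^sub>0"
    and lim: "(\<lambda>N. rel_entropy (tensor_power \<rho>\<^sub>0 N) (tensor_power m\<^sub>0 N) / ereal (real N)) \<longlonglongrightarrow> 0"
  shows "\<rho>\<^sub>0 = m\<^sub>0"
proof -
  obtain U p where U: "unitary_op d U" "\<rho>\<^sub>0 = spectral_decomp d U p"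
    and p: "\<And>i. i < d \<Longrightarrow> 0 \<le> p i" "(\<Sum>i<d. p i) = 1" using density_op_spectral[OF \<rho>] by blast
  obtain V q where V: "unitary_op d V" "m\<^sub>0 = spectral_decomp d V q"
    and q: "\<And>i. i < d \<Longrightarrow> 0 < q i" using strictly_positive_op_spectral[OF m(2)] by blast
  have sq: "(\<Sum>i<d. q i) = 1"
    using m(1) unfolding density_op_def V(2) mtrace_spectral_decomp[OF V(1)] by (simp only: of_real_eq_1_iff)
  let ?D = "\<Sum>i<d. \<Sum>j<d. overlap d U V i j * (p i * (ln (p i) - ln (q j)))"
  have "rel_entropy (tensor_power \<rho>\<^sub>0 N) (tensor_power m\<^sub>0 N) / ereal (real N) = ereal ?D" if N: "1 \<le> N" for N
  proof -
    have "rel_entropy (tensor_power \<rho>\<^sub>0 N) (tensor_power m\<^sub>0 N) = ereal (real N * ?D)"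
      unfolding U(2) V(2) by (rule rel_entropy_tensor_power[OF d U(1) V(1) p q])
    thus ?thesis using N by simp
  qed
  hence "\<forall>\<^sub>F N in sequentially. rel_entropy (tensor_power \<rho>\<^sub>0 N) (tensor_power m\<^sub>0 N) / ereal (real N) = ereal ?D"
    by (intro eventually_mono[OF eventually_ge_at_top[of "1::nat"]])
  hence "(\<lambda>N. rel_entropy (tensor_power \<rho>\<^sub>0 N) (tensor_power m\<^sub>0 N) / ereal (real N)) \<longlonglongrightarrow> ereal ?D"
    by (rule tendsto_eventually)
  from LIMSEQ_unique[OF this lim] have "?D = 0" by simp
  thus ?thesis unfolding U(2) V(2) using p q sq by (intro spectral_entropy_eq_0 U V) auto
qed

lemma mtrace_mult_has_vector_derivative:
  assumes P: "P \<in> carrier_mat n n" and R: "\<And>s. s \<in> S \<Longrightarrow> R s \<in> carrier_mat n n" and R': "R' \<in> carrier_mat n n"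
    and t: "t \<in> S"
    and der: "\<And>i j. i < n \<Longrightarrow> j < n \<Longrightarrow> ((\<lambda>s. R s $$ (i, j)) has_vector_derivative R' $$ (i, j)) (at t within S)"
  shows "((\<lambda>s. mtrace (P * R s)) has_vector_derivative mtrace (P * R')) (at t within S)"
proof -
  have "((\<lambda>s. \<Sum>i<n. \<Sum>j<n. P $$ (i, j) * R s $$ (j, i)) has_vector_derivative
      (\<Sum>i<n. \<Sum>j<n. P $$ (i, j) * R' $$ (j, i))) (at t within S)"
    using der by (intro has_vector_derivative_sum has_vector_derivative_mult_right) auto
  thus ?thesis unfolding mtrace_mult_sum[OF P R'] has_vector_derivative_def
    by (rule has_derivative_transform[OF t, rotated]) (simp add: mtrace_mult_sum[OF P R])
qed

lemma prod_has_vector_derivative: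
  fixes f :: "'i \<Rightarrow> real \<Rightarrow> complex"
  assumes "\<And>i. i \<in> I \<Longrightarrow> (f i has_vector_derivative f' i) (at t within S)"
  shows "((\<lambda>s. \<Prod>i\<in>I. f i s) has_vector_derivative (\<Sum>i\<in>I. f' i * (\<Prod>j\<in>I - {i}. f j t))) (at t within S)"
proof -
  have "((\<lambda>s. \<Prod>i\<in>I. f i s) has_derivative (\<lambda>y. \<Sum>i\<in>I. (y *\<^sub>R f' i) * (\<Prod>j\<in>I - {i}. f j t))) (at t within S)"
    using assms unfolding has_vector_derivative_def by (rule has_derivative_prod)
  thus ?thesis unfolding has_vector_derivative_def by (simp add: scaleR_sum_right)
qed

text \<open>Nonemptiness matters because the supremum over the empty set is minus infinity; together
  with the sign condition it bounds the supremum from below.\<close>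

lemma SUP_tendsto_0:
  fixes f :: "nat \<Rightarrow> real \<Rightarrow> ereal"
  assumes S: "S \<noteq> {}"
    and nn: "\<forall>\<^sub>F N in sequentially. \<forall>t\<in>S. 0 \<le> f N t"
    and le: "\<And>\<eta>. 0 < \<eta> \<Longrightarrow> \<forall>\<^sub>F N in sequentially. \<forall>t\<in>S. f N t \<le> ereal \<eta>"
  shows "(\<lambda>N. SUP t\<in>S. f N t) \<longlonglongrightarrow> 0"
proof (rule order_tendstoI)
  fix a :: ereal assume a: "a < 0"
  show "\<forall>\<^sub>F N in sequentially. a < (SUP t\<in>S. f N t)"
    using nn
  proof eventually_elim
    case (elim N)
    obtain t where t: "t \<in> S" using S by blast
    have "0 \<le> f N t" using elim t by blast
    also have "\<dots> \<le> (SUP t\<in>S. f N t)" by (rule SUP_upper[OF t])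
    finally have "0 \<le> (SUP t\<in>S. f N t)" .
    thus ?case by (rule order.strict_trans2[OF a])
  qed
next
  fix a :: ereal assume "0 < a"
  then obtain \<eta> where \<eta>: "0 < ereal \<eta>" "ereal \<eta> < a" using ereal_dense2 by blast
  hence "0 < \<eta>" by simp
  from le[OF this] show "\<forall>\<^sub>F N in sequentially. (SUP t\<in>S. f N t) < a"
  proof eventually_elim
    case (elim N)
    hence "(SUP t\<in>S. f N t) \<le> ereal \<eta>" by (intro SUP_least) blast
    thus ?case using \<eta>(2) by (rule order.strict_trans1)
  qed
qed

context lindblad_model
begin

lemma nbody_lindblad_carrier: "nbody_lindblad d H A L N R \<in> carrier_mat (d ^ N) (d ^ N)"
  unfolding nbody_lindblad_def by (intro add_carrier_mat msum_carrier)

lemma prod_expect_tensor_power: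
  assumes X: "\<forall>l\<in>{1..N}. X l \<in> carrier_mat d d" and \<sigma>: "\<sigma> \<in> carrier_mat d d"
  shows "prod_expect d N (tensor_power \<sigma> N) X = indep_expect N \<sigma> X"
proof -
  have "tprod d N X * tprod d N (\<lambda>_. \<sigma>) = tprod d N (\<lambda>l. X l * \<sigma>)"
    using X \<sigma> by (intro tprod_mult[OF d]) auto
  moreover have "mtrace (tprod d N (\<lambda>l. X l * \<sigma>)) = (\<Prod>l=1..N. mtrace (X l * \<sigma>))"
    using X \<sigma> by (intro mtrace_tprod) auto
  ultimately show ?thesis by (simp add: prod_expect_def indep_expect_def tensor_power_tprod[OF d \<sigma>])
qed

text \<open>Every entry of the difference is the defect of one admissible observable, so the
  abstract hierarchy, applied to \<open>defect\<close> and \<open>defect_deriv\<close>, bounds all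
  entries at once.\<close>

lemma marginal_entries_vanish:
  assumes T: "0 < T"
    and \<rho>: "\<And>N. N \<ge> 1 \<Longrightarrow> density_solution (d ^ N) T (nbody_lindblad d H A L N) (tensor_power m\<^sub>0 N) (\<rho> N)"
    and m: "density_solution d T (mean_field_lindblad d H A L) m\<^sub>0 m"
    and \<epsilon>: "0 < \<epsilon>"
  shows "\<forall>\<^sub>F N in sequentially. \<forall>t\<in>{0..T}. \<forall>i<d ^ k. \<forall>j<d ^ k.
    cmod ((marginal d N k (\<rho> N t) - tensor_power (m t) k) $$ (i, j)) \<le> \<epsilon>"
proof -
  have \<rho>0: "\<rho> N 0 = tensor_power m\<^sub>0 N" and \<rho>d: "\<And>t. t \<in> {0..T} \<Longrightarrow> density_op (d ^ N) (\<rho> N t)"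
    and \<rho>': "\<And>t i j. t \<in> {0..T} \<Longrightarrow> i < d ^ N \<Longrightarrow> j < d ^ N \<Longrightarrow>
      ((\<lambda>s. \<rho> N s $$ (i, j)) has_vector_derivative nbody_lindblad d H A L N (\<rho> N t) $$ (i, j)) (at t within {0..T})"
    if "1 \<le> N" for N using \<rho>[OF that] by (auto simp: density_solution_def)
  have m0: "m 0 = m\<^sub>0" and md: "\<And>t. t \<in> {0..T} \<Longrightarrow> density_op d (m t)"
    and m': "\<And>t i j. t \<in> {0..T} \<Longrightarrow> i < d \<Longrightarrow> j < d \<Longrightarrow>
      ((\<lambda>s. m s $$ (i, j)) has_vector_derivative mean_field_lindblad d H A L (m t) $$ (i, j)) (at t within {0..T})"
    using m by (auto simp: density_solution_def)
  have m0c: "m\<^sub>0 \<in> carrier_mat d d" using md[of 0] T m0 by (auto simp: density_op_carrier)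
  obtain C where C: "0 < C" and Cb: "\<And>N k R \<sigma> X B. 1 \<le> N \<Longrightarrow> density_op (d ^ N) R \<Longrightarrow> density_op d \<sigma> \<Longrightarrow>
      X \<in> admissible N k \<Longrightarrow> 0 \<le> B \<Longrightarrow> (\<forall>Y\<in>admissible N (k + 1). cmod (defect N R \<sigma> Y) \<le> B) \<Longrightarrow>
      cmod (defect_deriv N R \<sigma> X) \<le> C * real k * B + C * (real k)\<^sup>2 / real N"
    using defect_deriv_bound by blast
  have ev: "\<forall>\<^sub>F N in sequentially. \<forall>X\<in>admissible N k. \<forall>t\<in>{0..T}. cmod (defect N (\<rho> N t) (m t) X) \<le> \<epsilon>"
  proof (rule hierarchy_vanishes[where u = "\<lambda>N X t. defect N (\<rho> N t) (m t) X" and u' = "\<lambda>N X t. defect_deriv N (\<rho> N t) (m t) X", OF _ C])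
    fix N k X t assume N: "1 \<le> N" and X: "X \<in> admissible N k" and t: "t \<in> {0..T}"
    have Xc: "X l \<in> carrier_mat d d" if "l \<in> {1..N}" for l using admissible_carrier[OF X that] .
    have "((\<lambda>s. prod_expect d N (\<rho> N s) X) has_vector_derivative mtrace (tprod d N X * nbody_lindblad d H A L N (\<rho> N t))) (at t within {0..T})"
      unfolding prod_expect_def
      by (rule mtrace_mult_has_vector_derivative[OF tprod_carrier density_op_carrier[OF \<rho>d[OF N]] nbody_lindblad_carrier t \<rho>'[OF N t]])
    moreover have "((\<lambda>s. indep_expect N (m s) X) has_vector_derivative
        (\<Sum>l=1..N. mtrace (X l * mean_field_lindblad d H A L (m t)) * (\<Prod>r\<in>{1..N} - {l}. mtrace (X r * m t)))) (at t within {0..T})"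
      unfolding indep_expect_def
    proof (rule prod_has_vector_derivative)
      fix l assume l: "l \<in> {1..N}"
      have mf: "mean_field_lindblad d H A L (m t) \<in> carrier_mat d d"
        unfolding mean_field_lindblad_def using H L density_op_carrier[OF md[OF t]] by simp
      show "((\<lambda>s. mtrace (X l * m s)) has_vector_derivative mtrace (X l * mean_field_lindblad d H A L (m t))) (at t within {0..T})"
        by (rule mtrace_mult_has_vector_derivative[OF Xc[OF l] density_op_carrier[OF md] mf t m'[OF t]])
    qed
    ultimately show "((\<lambda>s. defect N (\<rho> N s) (m s) X) has_vector_derivative defect_deriv N (\<rho> N t) (m t) X) (at t within {0..T})"
      unfolding defect_def defect_deriv_def by (rule has_vector_derivative_diff)
    show "cmod (defect N (\<rho> N t) (m t) X) \<le> 2"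
      by (rule cmod_defect_le[OF X \<rho>d[OF N t] md[OF t]])
    show "cmod (defect_deriv N (\<rho> N t) (m t) X) \<le> C * real k * B + C * (real k)\<^sup>2 / real N"
      if "0 \<le> B" "\<And>Y. Y \<in> admissible N (k + 1) \<Longrightarrow> cmod (defect N (\<rho> N t) (m t) Y) \<le> B" for B
      using that by (intro Cb[OF N \<rho>d[OF N t] md[OF t] X]) auto
  next
    fix N k X assume N: "1 \<le> N" and X: "X \<in> admissible N k"
    show "defect N (\<rho> N 0) (m 0) X = 0"
      unfolding defect_def \<rho>0[OF N] m0 using admissible_carrier[OF X] m0c
      by (simp add: prod_expect_tensor_power)
  qed (use T \<epsilon> in auto)
  show ?thesis
    using ev eventually_ge_at_top[of "max 1 k"]
  proof eventually_elim
    case (elim N)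
    hence N: "1 \<le> N" "k \<le> N" by auto
    show ?case
    proof (intro ballI allI impI)
      fix t i j assume t: "t \<in> {0..T}" and ij: "i < d ^ k" "j < d ^ k"
      \<comment> \<open>Matrix units have row and column sums at most one, so this observable is
        admissible without rescaling.\<close>
      define X where "X l = (if l \<le> k then mat_unit d (digit d k l j) (digit d k l i) else 1\<^sub>m d)" for l
      have Xb: "schur_bounded d 1 (X l)" for l
        by (simp add: X_def schur_bounded_one schur_bounded_mat_unit)
      have "card {l\<in>{1..N}. X l \<noteq> 1\<^sub>m d} \<le> card {1..k}"
        by (intro card_mono) (auto simp: X_def split: if_splits)
      hence X: "X \<in> admissible N k" using Xb by (simp add: admissible_def)
      have mc: "m t \<in> carrier_mat d d" and tr: "mtrace (m t) = 1"
        using density_op_carrier[OF md[OF t]] md[OF t] by (auto simp: density_op_def)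
      have "marginal d N k (\<rho> N t) $$ (i, j) = prod_expect d N (\<rho> N t) X"
        unfolding prod_expect_def X_def
        by (rule marginal_eq_mtrace[OF d N(2) ij density_op_carrier[OF \<rho>d[OF N(1) t]]])
      moreover have "tensor_power (m t) k $$ (i, j) = indep_expect N (m t) X"
      proof -
        \<comment> \<open>As \<open>m t\<close> has trace one, the limit is itself a marginal of the
          \<open>N\<close>-fold power, and the same formula for entries applies to it.\<close>
        have "tensor_power (m t) k $$ (i, j) = marginal d N k (tensor_power (m t) N) $$ (i, j)"
          by (simp add: marginal_tensor_power[OF d mc tr N(2)])
        also have "\<dots> = prod_expect d N (tensor_power (m t) N) X"
          unfolding prod_expect_def X_def
          by (rule marginal_eq_mtrace[OF d N(2) ij]) (simp add: tensor_power_tprod[OF d mc])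
        also have "\<dots> = indep_expect N (m t) X"
          using admissible_carrier[OF X] mc by (intro prod_expect_tensor_power) auto
        finally show ?thesis .
      qed
      moreover have "tensor_power (m t) k \<in> carrier_mat (d ^ k) (d ^ k)" by (simp add: tensor_power_tprod[OF d mc])
      ultimately have "(marginal d N k (\<rho> N t) - tensor_power (m t) k) $$ (i, j) = defect N (\<rho> N t) (m t) X"
        using ij by (auto simp: defect_def)
      thus "cmod ((marginal d N k (\<rho> N t) - tensor_power (m t) k) $$ (i, j)) \<le> \<epsilon>"
        using elim(1) X t by simp
    qed
  qed
qed

text \<open>Both quantities are bounded by the Hilbert-Schmidt distance with constants depending
  only on \<open>d\<close>, \<open>k\<close> and the eigenvalue bound: the \<open>k\<close>-fold
  power of \<open>m t\<close> has eigenvalues at least \<open>c ^ k\<close>, at all times.\<close>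

lemma chaos_uniform:
  assumes T: "0 < T"
    and \<rho>: "\<And>N. N \<ge> 1 \<Longrightarrow> density_solution (d ^ N) T (nbody_lindblad d H A L N) (tensor_power m\<^sub>0 N) (\<rho> N)"
    and m: "density_solution d T (mean_field_lindblad d H A L) m\<^sub>0 m" and m0: "strictly_positive_op d m\<^sub>0"
  shows "(\<lambda>N. SUP t\<in>{0..T}. rel_entropy (marginal d N k (\<rho> N t)) (tensor_power (m t) k)) \<longlonglongrightarrow> 0"
    and "(\<lambda>N. SUP t\<in>{0..T}. ereal (trace_norm (marginal d N k (\<rho> N t) - tensor_power (m t) k))) \<longlonglongrightarrow> 0"
proof -
  let ?n = "d ^ k" let ?D = "\<lambda>N t. marginal d N k (\<rho> N t) - tensor_power (m t) k"
  have n: "0 < real ?n" using d by simp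
  have md: "density_op d (m t)" if "t \<in> {0..T}" for t using m that by (auto simp: density_solution_def)
  have marg: "density_op ?n (marginal d N k (\<rho> N t))" if "1 \<le> N" "k \<le> N" "t \<in> {0..T}" for N t
    using \<rho>[OF that(1)] that by (intro density_op_marginal d) (auto simp: density_solution_def)
  have Dc: "?D N t \<in> carrier_mat ?n ?n" if "t \<in> {0..T}" for N t
    by (rule minus_carrier_mat) (simp add: tensor_power_tprod[OF d density_op_carrier[OF md[OF that]]])
  have Nk: "\<forall>\<^sub>F N in sequentially. 1 \<le> N \<and> k \<le> N"
    using eventually_ge_at_top[of "max 1 k"] by (rule eventually_mono) auto
  have frob: "\<forall>\<^sub>F N in sequentially. \<forall>t\<in>{0..T}. frob_sq (?D N t) \<le> \<eta>\<^sup>2" if \<eta>: "0 < \<eta>" for \<eta>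
  proof -
    have "0 < \<eta> / real ?n" using \<eta> n by simp
    have "\<forall>\<^sub>F N in sequentially. \<forall>t\<in>{0..T}. \<forall>i<?n. \<forall>j<?n. cmod (?D N t $$ (i, j)) \<le> \<eta> / real ?n"
      by (rule marginal_entries_vanish[OF T \<rho> m \<open>0 < \<eta> / real ?n\<close>])
    thus ?thesis
    proof eventually_elim
      case (elim N)
      have "frob_sq (?D N t) \<le> (real ?n * (\<eta> / real ?n))\<^sup>2" if "t \<in> {0..T}" for t
        using elim that by (intro frob_sq_le[OF Dc[OF that]]) auto
      thus ?case using d by simp
    qed
  qed
  obtain c where c: "0 < c" and spec: "\<And>t. t \<in> {0..T} \<Longrightarrow> \<exists>U e. unitary_op d U \<and> m t = spectral_decomp d U e \<and>
    (\<forall>i<d. c \<le> e i) \<and> (\<Sum>i<d. e i) = 1"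
    using faithful_uniform[OF less_imp_le[OF T] m m0] by blast
  have bounds: "0 \<le> rel_entropy (marginal d N k (\<rho> N t)) (tensor_power (m t) k)"
    "rel_entropy (marginal d N k (\<rho> N t)) (tensor_power (m t) k) \<le> ereal (frob_sq (?D N t) / c ^ k)"
    if N: "1 \<le> N" "k \<le> N" and t: "t \<in> {0..T}" for N t
  proof -
    obtain U e where U: "unitary_op d U" "m t = spectral_decomp d U e" and e: "\<And>i. i < d \<Longrightarrow> c \<le> e i" "(\<Sum>i<d. e i) = 1"
      using spec[OF t] by blast
    let ?e = "\<lambda>i. \<Prod>l=1..k. e (digit d k l i)"
    have ck: "c ^ k \<le> ?e i" for i
    proof -
      have "(\<Prod>l=1..k. c) \<le> ?e i" using c e digit_less[OF d] by (intro prod_mono) auto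
      thus ?thesis by simp
    qed
    have s: "(\<Sum>i<?n. ?e i) = 1" unfolding sum_prod_digits[of "\<lambda>_. e" d k] using e(2) by simp
    note b = rel_entropy_bounds[OF marg[OF N t] tensor_power_spectral(1)[OF d U(1)] ck _ s]
    show "0 \<le> rel_entropy (marginal d N k (\<rho> N t)) (tensor_power (m t) k)"
      "rel_entropy (marginal d N k (\<rho> N t)) (tensor_power (m t) k) \<le> ereal (frob_sq (?D N t) / c ^ k)"
      unfolding U(2) tensor_power_spectral(2)[OF d U(1)] using b c by simp_all
  qed
  have ne: "{0..T} \<noteq> {}" using T by simp
  show "(\<lambda>N. SUP t\<in>{0..T}. rel_entropy (marginal d N k (\<rho> N t)) (tensor_power (m t) k)) \<longlonglongrightarrow> 0"
  proof (rule SUP_tendsto_0[OF ne])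
    show "\<forall>\<^sub>F N in sequentially. \<forall>t\<in>{0..T}. 0 \<le> rel_entropy (marginal d N k (\<rho> N t)) (tensor_power (m t) k)"
      using Nk by (rule eventually_mono) (simp add: bounds(1))
    fix \<eta> :: real assume \<eta>: "0 < \<eta>"
    \<comment> \<open>The tolerance for the Hilbert-Schmidt distance at which the entropy bound, its
      square divided by \<open>c ^ k\<close>, is at most \<open>\<eta>\<close>.\<close>
    have "0 < sqrt (\<eta> * c ^ k)" using \<eta> c by simp
    from frob[OF this] Nk
    show "\<forall>\<^sub>F N in sequentially. \<forall>t\<in>{0..T}. rel_entropy (marginal d N k (\<rho> N t)) (tensor_power (m t) k) \<le> ereal \<eta>"
    proof eventually_elim
      case (elim N)
      show ?case
      proof
        fix t assume t: "t \<in> {0..T}"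
        have "frob_sq (?D N t) / c ^ k \<le> \<eta>" using elim(1) t \<eta> c by (simp add: divide_le_eq)
        thus "rel_entropy (marginal d N k (\<rho> N t)) (tensor_power (m t) k) \<le> ereal \<eta>"
          using bounds(2)[of N t] elim(2) t by (meson ereal_less_eq(3) order.trans)
      qed
    qed
  qed
  show "(\<lambda>N. SUP t\<in>{0..T}. ereal (trace_norm (?D N t))) \<longlonglongrightarrow> 0"
  proof (rule SUP_tendsto_0[OF ne])
    show "\<forall>\<^sub>F N in sequentially. \<forall>t\<in>{0..T}. 0 \<le> ereal (trace_norm (?D N t))"
      using trace_norm_bounds(1)[OF Dc] by simp
    fix \<eta> :: real assume \<eta>: "0 < \<eta>"
    have "0 < \<eta> / real ?n" using \<eta> n by simp
    from frob[OF this]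
    show "\<forall>\<^sub>F N in sequentially. \<forall>t\<in>{0..T}. ereal (trace_norm (?D N t)) \<le> ereal \<eta>"
    proof eventually_elim
      case (elim N)
      show ?case
      proof
        fix t assume t: "t \<in> {0..T}"
        have "sqrt (frob_sq (?D N t)) \<le> \<eta> / real ?n"
          using elim t \<eta> n by (intro real_le_lsqrt frob_sq_nonneg) auto
        hence "real ?n * sqrt (frob_sq (?D N t)) \<le> real ?n * (\<eta> / real ?n)" using n by (intro mult_left_mono) auto
        thus "ereal (trace_norm (?D N t)) \<le> ereal \<eta>" using trace_norm_bounds(2)[OF Dc[OF t, of N]] d by simp
      qed
    qed
  qed
qed

end

theorem corollary1:
  fixes d :: nat and T :: real
    and H A L \<rho>\<^sub>0 m\<^sub>0 :: "complex mat"
    and \<rho> :: "nat \<Rightarrow> real \<Rightarrow> complex mat"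
    and m :: "real \<Rightarrow> complex mat"
  assumes "T > 0"
    and "self_adjoint d H"
    and "self_adjoint (d * d) A"
    and "flip_op d * A * flip_op d = A"
    and "L \<in> carrier_mat d d"
    and "density_op d \<rho>\<^sub>0"
    and "\<And>N. N \<ge> 1 \<Longrightarrow>
           density_solution (d ^ N) T (nbody_lindblad d H A L N) (tensor_power \<rho>\<^sub>0 N) (\<rho> N)"
    and "density_op d m\<^sub>0"
    and "strictly_positive_op d m\<^sub>0"
    and "density_solution d T (mean_field_lindblad d H A L) m\<^sub>0 m"
    and "(\<lambda>N. rel_entropy (\<rho> N 0) (tensor_power (m 0) N) / ereal (real N)) \<longlonglongrightarrow> 0"
  shows "(\<forall>k\<ge>1. (\<lambda>N. SUP t\<in>{0..T}. rel_entropy (marginal d N k (\<rho> N t)) (tensor_power (m t) k))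
            \<longlonglongrightarrow> 0) \<and>
         (\<forall>k\<ge>1. (\<lambda>N. SUP t\<in>{0..T}. ereal (trace_norm (marginal d N k (\<rho> N t) - tensor_power (m t) k)))
            \<longlonglongrightarrow> 0)"
proof -
  \<comment> \<open>In dimension zero every trace vanishes, so the existence of a state makes
    \<open>d\<close> positive, as digit coordinates require.\<close>
  have d: "0 < d"
  proof (rule ccontr)
    assume "\<not> 0 < d"
    hence "mtrace m\<^sub>0 = 0" using density_op_carrier[OF assms(8)] by (auto simp: mtrace_def)
    thus False using assms(8) by (simp add: density_op_def)
  qed
  interpret lindblad_model d H A L
    using d assms(2-5) by unfold_locales (auto simp: self_adjoint_def)
  have m0: "m 0 = m\<^sub>0" using assms(10) by (simp add: density_solution_def)
  have "\<rho> N 0 = tensor_power \<rho>\<^sub>0 N" if "1 \<le> N" for N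
    using assms(7)[OF that] by (simp add: density_solution_def)
  \<comment> \<open>The initial datum is known only for \<open>N \<ge> 1\<close>, so the two entropy
    sequences are identified eventually.\<close>
  hence "\<forall>\<^sub>F N in sequentially. rel_entropy (\<rho> N 0) (tensor_power (m 0) N) / ereal (real N) =
      rel_entropy (tensor_power \<rho>\<^sub>0 N) (tensor_power m\<^sub>0 N) / ereal (real N)"
    unfolding m0 by (intro eventually_mono[OF eventually_ge_at_top[of "1::nat"]]) simp
  from Lim_transform_eventually[OF assms(11) this]
  have "\<rho>\<^sub>0 = m\<^sub>0" by (rule initial_states_equal[OF d assms(6,8,9)])
  from chaos_uniform[OF assms(1) assms(7)[unfolded this] assms(10,9)] show ?thesis by blast
qed

end
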